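(* For all integers $n \geq 42$, \[ \bigl(\overline{p}(n)^2-\overline{p}(n-1)\overline{p}(n+1)\bigr)^2-\bigl(\overline{p}(n-1)^2-\overline{p}(n-2)\overline{p}(n)\bigr)\bigl(\overline{p}(n+1)^2-\overline{p}(n)\overline{p}(n+2)\bigr)> 0. \]
   Context: An overpartition of a nonnegative integer $n$ is a nonincreasing sequence of positive integers summing to $n$ in which the first occurrence of each distinct part may (or may not) be overlined. $\overline{p}(n)$ denotes the number of overpartitions of $n$, with $\overline{p}(0)=1$. *)

theory Defs
  imports Main "HOL-Library.Multiset"
begin

text \<open>An overpartition of n: a partition of n (a multiset of positive integers summing
to n, i.e. a nonincreasing sequence) together with the set of distinct parts whose
first occurrence is overlined (any subset of the distinct parts).\<close>

definition overpartitions :: "nat \<Rightarrow> (nat multiset \<times> nat set) set" where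
  "overpartitions n = {(P, S). (\<forall>x\<in>#P. 0 < x) \<and> sum_mset P = n \<and> S \<subseteq> set_mset P}"

definition overpartition_count :: "nat \<Rightarrow> nat" where
  "overpartition_count n = card (overpartitions n)"

end

theory Submission
  imports Defs "HOL-Complex_Analysis.Complex_Analysis" "HOL-Real_Asymp.Real_Asymp" "HOL-Probability.Distributions"
begin

text \<open>
  The generating function of overpartitions is \<open>1 / \<theta>\<close>, where \<open>\<theta>(q)\<close> is the sum of \<open>(-1)^k q^(k^2)\<close>
  over all integers \<open>k\<close> (Gauss). By the transformation formula of \<open>\<theta>\<close>, near \<open>q = 1\<close> it agrees
  with an explicit combination of the series \<open>\<Sum>n. n^j q^n\<close> up to a bounded error, and away from
  \<open>q = 1\<close> it is exponentially smaller than at \<open>\<bar>q\<bar>\<close>. Cauchy's inequality for the difference then yields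
  \<open>p(n) = (cosh (\<pi> X) - sinh (\<pi> X) / (\<pi> X)) / (4 X^2) + O(exp (c X))\<close> with \<open>X = sqrt n\<close> and an explicit
  \<open>c < \<pi>\<close>.

  In terms of \<open>\<delta>(n) = 1 - p(n-1) p(n+1) / p(n)^2\<close> the claim reads
  \<open>\<delta>(n-1) \<delta>(n+1) (1 - \<delta>(n))^2 < \<delta>(n)^2\<close>. By AM-GM it suffices that the mean of \<open>\<delta>(n-1)\<close> and
  \<open>\<delta>(n+1)\<close> is below \<open>\<delta>(n) + \<delta>(n)^2\<close>, and this holds for large \<open>n\<close> because \<open>\<delta>(n)\<close> is
  \<open>\<pi>/4 h^3 - h^4 + 3/(4\<pi>) h^5\<close> with \<open>h = 1 / sqrt n\<close> up to an error of order \<open>h^6\<close> that is smaller than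
  \<open>\<delta>(n)^2\<close>. The remaining \<open>n \<le> 1025\<close> are computed from the recurrence given by the squares.
\<close>

section \<open>The generating function of overpartitions\<close>

text \<open>The series with coefficients n^j equals j! / s^(j+1) + O(1) at q = exp (-s), so near q =
  1 any polynomial in 1/s without constant term is matched by a series with exactly known
  coefficients. The principal part of 1 / \<theta> contains a square root of s; it is first replaced
  by an entire function of 1/s, then by Taylor sections of length J, and J goes to infinity only
  after the coefficient estimate. Since the difference is bounded near q = 1, its maximum over the
  circle suffices and no arc has to be integrated. The radius exp (-u) with u = pi / (2 X) minimises
  pi^2 / (4 u) + n u, the exponent of the trivial bound; far from q = 1 a factor exp (-15 / (8 u))
  is saved, which keeps c below 2. The second differences leave little room: \<delta>(n)^2 is about
  0.61 h^6, while the estimates give away 0.46 h^6. This forces explicit bounds on the h^6 term.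
  They are proved for h \<le> 1/32, and as p(n-2) occurs, n - 2 \<ge> 32^2 is required; hence the
  limit 1025 of the computation.\<close>

definition bounded_parts :: "nat \<Rightarrow> nat \<Rightarrow> nat multiset set" where
  "bounded_parts N n = {P. set_mset P \<subseteq> {1..N} \<and> sum_mset P = n}"

text \<open>The weight counts the choices of overlined parts, so this is the number of
  overpartitions of \<open>n\<close> with parts at most \<open>N\<close>: a coefficient of a partial
  product of the generating function.\<close>

definition bounded_count :: "nat \<Rightarrow> nat \<Rightarrow> nat" where
  "bounded_count N n = (\<Sum>P\<in>bounded_parts N n. 2 ^ card (set_mset P))"

lemma size_le_sum_mset: "(\<forall>x\<in>#P. 0 < x) \<Longrightarrow> size P \<le> sum_mset (P :: nat multiset)"
  by (induction P) auto

lemma finite_bounded_parts [simp]: "finite (bounded_parts N n)"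
proof (rule finite_subset)
  show "bounded_parts N n \<subseteq> (\<Union>k\<in>{..n}. multisets_of_size {1..N} k)"
  proof
    fix P assume "P \<in> bounded_parts N n"
    then have *: "set_mset P \<subseteq> {1..N}" "sum_mset P = n" by (auto simp: bounded_parts_def)
    then have "size P \<le> n" using size_le_sum_mset[of P] by force
    with * show "P \<in> (\<Union>k\<in>{..n}. multisets_of_size {1..N} k)"
      by (auto simp: multisets_of_size_def)
  qed
qed (auto intro!: finite_multisets_of_size)

lemma overpartition_count_eq_bounded_count:
  assumes "n \<le> N"
  shows "overpartition_count n = bounded_count N n"
proof -
  have "overpartitions n = (SIGMA P:bounded_parts N n. Pow (set_mset P))"
  proof -
    have "x \<le> N" if "x \<in># P" "sum_mset P = n" for x P
      using that assms by (metis add.commute insert_DiffM le_add2 le_trans sum_mset.add_mset)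
    then show ?thesis
      by (fastforce simp: overpartitions_def bounded_parts_def Suc_le_eq)
  qed
  then show ?thesis
    by (simp add: overpartition_count_def bounded_count_def card_SigmaI card_Pow)
qed

lemma bounded_count_le: "bounded_count N n \<le> overpartition_count n"
proof -
  have "overpartition_count n = bounded_count (max N n) n"
    by (rule overpartition_count_eq_bounded_count) simp
  also have "\<dots> \<ge> bounded_count N n"
    unfolding bounded_count_def
    by (intro sum_mono2 finite_bounded_parts) (fastforce simp: bounded_parts_def)+
  finally show ?thesis .
qed

lemma bounded_count_0: "bounded_count 0 n = (if n = 0 then 1 else 0)"
proof -
  have "bounded_parts 0 n = (if n = 0 then {{#}} else {})"
    by (auto simp: bounded_parts_def)
  then show ?thesis by (simp add: bounded_count_def)
qed

lemma bounded_count_small: "n < Suc N \<Longrightarrow> bounded_count (Suc N) n = bounded_count N n"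
  using overpartition_count_eq_bounded_count[of n N] overpartition_count_eq_bounded_count[of n "Suc N"]
  by simp

text \<open>Coefficient form of F_k (1 - q^k) = F_(k-1) (1 + q^k) with k = \<open>Suc N\<close>.
  Remove one copy of the part k: if it was the only copy, one distinct part disappears and the
  weight halves; otherwise the weight is unchanged.\<close>

lemma bounded_count_Suc:
  assumes "Suc N \<le> n"
  shows "bounded_count (Suc N) n = bounded_count N n + bounded_count N (n - Suc N)
           + bounded_count (Suc N) (n - Suc N)"
proof -
  define B where "B n = {P \<in> bounded_parts (Suc N) n. Suc N \<in># P}" for n
  define w where "w P = (2::nat) ^ card (set_mset P)" for P :: "nat multiset"
  have split: "bounded_parts (Suc N) n = bounded_parts N n \<union> B n"
    "bounded_parts N n \<inter> B n = {}" for n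
    by (auto simp: bounded_parts_def B_def le_Suc_eq subset_iff)
  have fin: "finite (B n)" for n by (simp add: B_def)
  have count: "bounded_count (Suc N) n = bounded_count N n + sum w (B n)" for n
    unfolding bounded_count_def w_def split(1)[of n] using split(2)[of n] fin
    by (subst sum.union_disjoint) auto
  have img: "B n = add_mset (Suc N) ` bounded_parts (Suc N) (n - Suc N)"
  proof (intro equalityI subsetI)
    fix P assume "P \<in> B n"
    then obtain Q where "P = add_mset (Suc N) Q"
      by (auto simp: B_def dest: multi_member_split)
    with \<open>P \<in> B n\<close> show "P \<in> add_mset (Suc N) ` bounded_parts (Suc N) (n - Suc N)"
      by (auto simp: B_def bounded_parts_def)
  qed (use assms in \<open>auto simp: B_def bounded_parts_def\<close>)
  have "sum w (B n) = (\<Sum>Q\<in>bounded_parts (Suc N) (n - Suc N). w (add_mset (Suc N) Q))"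
    unfolding img by (subst sum.reindex) (auto simp: inj_on_def)
  also have "\<dots> = (\<Sum>Q\<in>bounded_parts N (n - Suc N). w (add_mset (Suc N) Q))
      + (\<Sum>Q\<in>B (n - Suc N). w (add_mset (Suc N) Q))"
    unfolding split(1)[of "n - Suc N"] using split(2) fin by (subst sum.union_disjoint) auto
  also have "(\<Sum>Q\<in>bounded_parts N (n - Suc N). w (add_mset (Suc N) Q))
      = 2 * (\<Sum>Q\<in>bounded_parts N (n - Suc N). w Q)"
    unfolding sum_distrib_left
  proof (intro sum.cong refl)
    fix Q assume "Q \<in> bounded_parts N (n - Suc N)"
    then have "Suc N \<notin> set_mset Q" by (auto simp: bounded_parts_def)
    then show "w (add_mset (Suc N) Q) = 2 * w Q" by (simp add: w_def)
  qed
  also have "(\<Sum>Q\<in>B (n - Suc N). w (add_mset (Suc N) Q)) = sum w (B (n - Suc N))"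
    by (intro sum.cong refl) (auto simp: B_def w_def insert_absorb)
  finally show ?thesis using count[of n] count[of "n - Suc N"]
    by (simp add: bounded_count_def w_def)
qed

text \<open>Absolute convergence is carried through the induction: the recurrence gives S = P + q^k
  (P + S) for the new sum S, which determines S only after convergence is known.\<close>

lemma bounded_count_sums:
  fixes q :: complex
  assumes "norm q < 1"
  shows "summable (\<lambda>n. norm (of_nat (bounded_count N n) * q ^ n))
    \<and> (\<lambda>n. of_nat (bounded_count N n) * q ^ n) sums (\<Prod>i=1..N. (1 + q ^ i) / (1 - q ^ i))"
proof (induction N)
  case 0
  have eq: "(\<lambda>n. of_nat (bounded_count 0 n) * q ^ n) = (\<lambda>n. if n = 0 then 1 else 0)"
    by (auto simp: bounded_count_0)
  have "summable (\<lambda>n. norm (of_nat (bounded_count 0 n) * q ^ n))"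
    by (rule summable_finite[of "{0}"]) (auto simp: bounded_count_0)
  moreover have "(\<lambda>n. of_nat (bounded_count 0 n) * q ^ n) sums 1"
    unfolding eq by (rule sums_single)
  ultimately show ?case by simp
next
  case (Suc N)
  define r where "r = norm q"
  define k where "k = Suc N"
  define f where "f n = of_nat (bounded_count N n) * q ^ n" for n
  define g where "g n = of_nat (bounded_count k n) * q ^ n" for n
  have r: "0 \<le> r" "r < 1" using assms by (auto simp: r_def)
  have rk: "r ^ k < 1" using r mult_left_le[of "r^N" r] power_le_one[of r N] by (simp add: k_def)
  have rec: "g n = f n + (if n < k then 0 else q ^ k * (f (n - k) + g (n - k)))" for n
  proof (cases "n < k")
    case True then show ?thesis by (simp add: g_def f_def k_def bounded_count_small)
  next
    case False
    then have "q ^ n = q ^ (n - k) * q ^ k" by (simp add: power_add[symmetric])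
    with False show ?thesis using bounded_count_Suc[of N n]
      by (simp add: g_def f_def k_def algebra_simps)
  qed
  have recn: "norm (g n) \<le> norm (f n) + (if n < k then 0 else r ^ k * (norm (f (n - k)) + norm (g (n - k))))" for n
  proof -
    have "norm (g n) \<le> norm (f n) + norm (if n < k then 0 else q ^ k * (f (n - k) + g (n - k)))"
      unfolding rec[of n] by (rule norm_triangle_ineq)
    also have "norm (if n < k then 0 else q ^ k * (f (n - k) + g (n - k)))
        \<le> (if n < k then 0 else r ^ k * (norm (f (n - k)) + norm (g (n - k))))"
      by (auto simp: norm_mult norm_power r_def intro!: mult_left_mono norm_triangle_ineq)
    finally show ?thesis by simp
  qed
  have sf: "summable (\<lambda>n. norm (f n))" and fs: "f sums (\<Prod>i=1..N. (1 + q ^ i) / (1 - q ^ i))"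
    using Suc by (simp_all add: f_def[abs_def])
  define A where "A = (\<Sum>n. norm (f n))"
  have A: "(\<Sum>n<M. norm (f n)) \<le> A" for M
    unfolding A_def by (rule sum_le_suminf[OF sf]) auto
  have shift: "(\<Sum>n<M. if n < k then 0 else u (n - k)) \<le> (\<Sum>n<M. u n)"
    if "\<And>n. u n \<ge> (0::real)" for u M
  proof (cases "k \<le> M")
    case True
    then obtain d where d: "M = d + k" by (metis add.commute le_Suc_ex)
    have "(\<Sum>n<M. if n < k then 0 else u (n - k)) = (\<Sum>n<d. u n)"
      unfolding d by (induction d) auto
    also have "\<dots> \<le> (\<Sum>n<M. u n)" unfolding d by (rule sum_mono2) (use that in auto)
    finally show ?thesis .
  next
    case False
    then have "(\<Sum>n<M. if n < k then 0 else u (n - k)) = 0" by (intro sum.neutral) auto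
    then show ?thesis using that by (simp add: sum_nonneg)
  qed
  \<comment> \<open>The same partial sum reappears on the right with the factor r^k < 1, so the
    inequality can be solved for it.\<close>
  have bd: "(\<Sum>n<M. norm (g n)) \<le> (1 + r ^ k) * A / (1 - r ^ k)" for M
  proof -
    have "(\<Sum>n<M. norm (g n)) \<le> (\<Sum>n<M. norm (f n) + (if n < k then 0 else r ^ k * (norm (f (n - k)) + norm (g (n - k)))))"
      by (intro sum_mono recn)
    also have "\<dots> = (\<Sum>n<M. norm (f n)) + (\<Sum>n<M. if n < k then 0 else r ^ k * (norm (f (n - k)) + norm (g (n - k))))"
      by (simp add: sum.distrib)
    also have "\<dots> \<le> A + (\<Sum>n<M. r ^ k * (norm (f n) + norm (g n)))"
      using r by (intro add_mono A shift) auto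
    also have "\<dots> \<le> A + r ^ k * (A + (\<Sum>n<M. norm (g n)))"
      using A[of M] r by (simp add: sum_distrib_left[symmetric] sum.distrib mult_left_mono)
    finally show ?thesis using rk by (simp add: field_simps)
  qed
  have sg: "summable (\<lambda>n. norm (g n))"
    by (rule summableI_nonneg_bounded[OF _ bd]) auto
  then have gs: "g sums (\<Sum>n. g n)"
    by (simp add: summable_norm_cancel summable_sums)
  have "(\<lambda>n. q ^ k * (f n + g n)) sums (q ^ k * ((\<Prod>i=1..N. (1 + q ^ i) / (1 - q ^ i)) + (\<Sum>n. g n)))"
    by (intro sums_mult sums_add fs gs)
  then have "(\<lambda>n. if n < k then 0 else q ^ k * (f (n - k) + g (n - k))) sums
      (q ^ k * ((\<Prod>i=1..N. (1 + q ^ i) / (1 - q ^ i)) + (\<Sum>n. g n)))"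
    using sums_zero_iff_shift[of k "\<lambda>n. if n < k then 0 else q ^ k * (f (n - k) + g (n - k))"] by simp
  from sums_add[OF fs this] have "g sums ((\<Prod>i=1..N. (1 + q ^ i) / (1 - q ^ i)) + q ^ k * ((\<Prod>i=1..N. (1 + q ^ i) / (1 - q ^ i)) + (\<Sum>n. g n)))"
    by (simp add: rec[symmetric])
  with gs have "(\<Sum>n. g n) = (\<Prod>i=1..N. (1 + q ^ i) / (1 - q ^ i)) + q ^ k * ((\<Prod>i=1..N. (1 + q ^ i) / (1 - q ^ i)) + (\<Sum>n. g n))"
    using sums_unique2 by blast
  moreover have "q ^ k \<noteq> 1"
    using rk by (metis norm_one norm_power order_less_irrefl r_def)
  moreover have "S = P * ((1 + Q) / (1 - Q))" if "S = P + Q * (P + S)" "Q \<noteq> 1" for S P Q :: complex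
  proof -
    have "S * (1 - Q) = P * (1 + Q)" using that(1) by algebra
    then show ?thesis using that(2) by (simp add: eq_divide_eq)
  qed
  ultimately have "(\<Sum>n. g n) = (\<Prod>i=1..N. (1 + q ^ i) / (1 - q ^ i)) * ((1 + q ^ k) / (1 - q ^ k))"
    by blast
  then have val: "(\<Sum>n. g n) = (\<Prod>i=1..Suc N. (1 + q ^ i) / (1 - q ^ i))"
    unfolding k_def by (simp only: prod.nat_ivl_Suc' mult.commute)
  have "summable (\<lambda>n. norm (of_nat (bounded_count (Suc N) n) * q ^ n))"
    using sg unfolding g_def k_def .
  moreover have "(\<lambda>n. of_nat (bounded_count (Suc N) n) * q ^ n) sums (\<Prod>i=1..Suc N. (1 + q ^ i) / (1 - q ^ i))"
    using gs unfolding val unfolding g_def[abs_def] k_def .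
  ultimately show ?case ..
qed

section \<open>Gauss's identity for the theta series\<close>

lemma sum_alternating_telescope:
  fixes U :: "nat \<Rightarrow> 'a::comm_ring_1"
  shows "(\<Sum>s\<le>n. (-1) ^ s * (U s + U (Suc s))) = U 0 + (-1) ^ n * U (Suc n)"
  by (induction n) (auto simp: algebra_simps)

text \<open>Shanks' finite form of Gauss's identity: all summands but \<open>s = 0\<close> vanish in the limit, which gives \<open>gauss_limit\<close> below.\<close>

lemma shanks_identity:
  fixes q :: complex
  assumes q: "norm q < 1"
  shows "(\<Sum>s\<le>n. (-1) ^ s * (\<Prod>i\<in>{s<..n}. (1 - q ^ i) / (1 + q ^ i)) * (2 / (1 + q ^ s)) * q ^ (s * Suc n))
    = 1 + 2 * (\<Sum>k=1..n. (-1) ^ k * q ^ (k ^ 2))"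
proof (induction n)
  case 0
  then show ?case by simp
next
  case (Suc n)
  have nz: "1 + q ^ i \<noteq> 0" if "i > 0" for i
  proof
    assume "1 + q ^ i = 0"
    then have "q ^ i = -1" by (simp add: add_eq_0_iff)
    then have "norm q ^ i = 1" by (metis norm_minus_cancel norm_one norm_power)
    with q that power_decreasing[of 1 i "norm q"] show False by auto
  qed
  have nz': "1 + q ^ i \<noteq> 0" for i using nz[of i] by (cases "i = 0") auto
  define A where "A n s = (\<Prod>i\<in>{s<..n}. (1 - q ^ i) / (1 + q ^ i))" for n s :: nat
  define N where "N = Suc n"
  \<comment> \<open>Chosen so that passing from \<open>n\<close> to \<open>N\<close> changes the
    summand \<open>s\<close> by a multiple of U s + U (s+1), whose alternating sum telescopes. The
    value at \<open>N\<close> is set separately, since the general formula would carry an extra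
    factor (1 - q^N) / (1 + q^N) there; U 0 = 0 because 1 - q^0 = 0.\<close>
  define U where "U s = (if s = N then q ^ (N * N) else A n s * (1 - q ^ s) / (1 + q ^ s) * q ^ (s * N))" for s
  have ASuc: "A N s = A n s * ((1 - q ^ N) / (1 + q ^ N))" if "s \<le> n" for s
  proof -
    have "{s<..N} = insert N {s<..n}" using that by (auto simp: N_def)
    then show ?thesis by (simp add: A_def N_def mult.commute)
  qed
  have USuc: "U (Suc s) = A n s * q ^ (Suc s * N)" if "s \<le> n" for s
  proof (cases "s = n")
    case True then show ?thesis by (simp add: U_def A_def N_def)
  next
    case False
    with that have "{s<..n} = insert (Suc s) {Suc s<..n}" by auto
    with False show ?thesis by (simp add: U_def A_def N_def)
  qed
  have summand: "(-1) ^ s * A N s * (2 / (1 + q ^ s)) * q ^ (s * Suc N) =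
      (-1) ^ s * A n s * (2 / (1 + q ^ s)) * q ^ (s * N) - 2 / (1 + q ^ N) * ((-1) ^ s * (U s + U (Suc s)))"
    if "s \<le> n" for s
  proof -
    have Us: "U s = A n s * (1 - q ^ s) / (1 + q ^ s) * q ^ (s * N)"
      using that by (simp add: U_def N_def)
    have e: "q ^ (Suc s * N) = q ^ N * q ^ (s * N)" "q ^ (s * Suc N) = q ^ s * q ^ (s * N)"
      by (simp_all add: power_add)
    have alg: "g * (P * ((1 - y) / (1 + y))) * (2 / (1 + x)) * (x * w) =
       g * P * (2 / (1 + x)) * w - 2 / (1 + y) * (g * (P * (1 - x) / (1 + x) * w + P * (y * w)))"
      if "1 + x \<noteq> 0" "1 + y \<noteq> 0" for g P x y w :: complex
    proof -
      define a where "a = inverse (1 + x)"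
      define b where "b = inverse (1 + y)"
      have "a * (1 + x) = 1" "b * (1 + y) = 1" using that by (simp_all add: a_def b_def)
      then have "g * (P * ((1 - y) * b)) * (2 * a) * (x * w) =
         g * P * (2 * a) * w - 2 * b * (g * (P * (1 - x) * a * w + P * (y * w)))"
        by algebra
      then show ?thesis by (simp only: a_def b_def divide_inverse)
    qed
    show ?thesis
      unfolding USuc[OF that] ASuc[OF that] Us e by (rule alg[OF nz' nz'])
  qed
  have U0: "U 0 = 0" "U N = q ^ (N * N)" by (simp_all add: U_def N_def)
  have "(\<Sum>s\<le>N. (-1) ^ s * A N s * (2 / (1 + q ^ s)) * q ^ (s * Suc N)) =
     (\<Sum>s\<le>n. (-1) ^ s * A n s * (2 / (1 + q ^ s)) * q ^ (s * N))
     - 2 / (1 + q ^ N) * (\<Sum>s\<le>n. (-1) ^ s * (U s + U (Suc s)))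
     + (-1) ^ N * (2 / (1 + q ^ N)) * q ^ (N * Suc N)"
  proof -
    have "(\<Sum>s\<le>N. X s) = (\<Sum>s\<le>n. X s) + X N" for X :: "nat \<Rightarrow> complex"
      by (simp add: N_def)
    moreover have "A N N = 1" by (simp add: A_def)
    moreover have "(\<Sum>s\<le>n. (-1) ^ s * A N s * (2 / (1 + q ^ s)) * q ^ (s * Suc N)) =
       (\<Sum>s\<le>n. (-1) ^ s * A n s * (2 / (1 + q ^ s)) * q ^ (s * N) - 2 / (1 + q ^ N) * ((-1) ^ s * (U s + U (Suc s))))"
      by (intro sum.cong refl summand) auto
    ultimately show ?thesis
      unfolding sum_subtractf sum_distrib_left[symmetric] by simp
  qed
  also have "(\<Sum>s\<le>n. (-1) ^ s * (U s + U (Suc s))) = (-1) ^ n * q ^ (N * N)"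
    unfolding sum_alternating_telescope using U0 by (simp add: N_def)
  also have "(\<Sum>s\<le>n. (-1) ^ s * A n s * (2 / (1 + q ^ s)) * q ^ (s * N)) - 2 / (1 + q ^ N) * ((-1) ^ n * q ^ (N * N))
     + (-1) ^ N * (2 / (1 + q ^ N)) * q ^ (N * Suc N) =
     (\<Sum>s\<le>n. (-1) ^ s * A n s * (2 / (1 + q ^ s)) * q ^ (s * N)) + 2 * (-1) ^ N * q ^ (N * N)"
  proof -
    have "(-1) ^ n = - ((-1) ^ N :: complex)" by (simp add: N_def)
    moreover have "q ^ (N * Suc N) = q ^ N * q ^ (N * N)" by (simp add: power_add)
    ultimately show ?thesis using nz'[of N] by (simp add: divide_simps) (simp add: algebra_simps)
  qed
  also have "\<dots> = 1 + 2 * (\<Sum>k=1..N. (-1) ^ k * q ^ (k ^ 2))"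
    using Suc by (simp add: A_def N_def power2_eq_square algebra_simps)
  finally show ?case by (simp add: A_def N_def)
qed

text \<open>(1 + x) / (1 - x) = 1 + 2x / (1 - x) is at most exp (2x / (1 - r)), and the powers of r
  add up geometrically. The bound is independent of \<open>A\<close>, so it controls the products in
  Shanks' sum as well as all partial products of the generating function.\<close>

lemma prod_le_exp:
  fixes r :: real
  assumes r: "0 \<le> r" "r < 1" and A: "finite A" "0 \<notin> A"
  shows "(\<Prod>i\<in>A. (1 + r ^ i) / (1 - r ^ i)) \<le> exp (2 / (1 - r) ^ 2)"
proof -
  have pow: "r ^ i \<le> r" if "i \<in> A" for i
    using r A that power_decreasing[of 1 i r] by (cases i) auto
  have "(\<Prod>i\<in>A. (1 + r ^ i) / (1 - r ^ i)) \<le> (\<Prod>i\<in>A. exp (2 / (1 - r) * r ^ i))"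
  proof (intro prod_mono conjI)
    fix i assume i: "i \<in> A"
    have "1 - r ^ i > 0" using pow[OF i] r by linarith
    then show "0 \<le> (1 + r ^ i) / (1 - r ^ i)" using r by simp
    have "(1 + r ^ i) / (1 - r ^ i) = 1 + 2 * r ^ i / (1 - r ^ i)"
      using \<open>1 - r ^ i > 0\<close> by (simp add: field_simps)
    also have "\<dots> \<le> 1 + 2 * r ^ i / (1 - r)"
      using pow[OF i] r by (intro add_left_mono divide_left_mono mult_pos_pos) auto
    also have "\<dots> \<le> exp (2 / (1 - r) * r ^ i)"
      using exp_ge_add_one_self[of "2 / (1 - r) * r ^ i"] by simp
    finally show "(1 + r ^ i) / (1 - r ^ i) \<le> exp (2 / (1 - r) * r ^ i)" .
  qed
  also have "\<dots> = exp (2 / (1 - r) * (\<Sum>i\<in>A. r ^ i))"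
    using A by (simp add: exp_sum sum_distrib_left)
  also have "\<dots> \<le> exp (2 / (1 - r) ^ 2)"
  proof -
    have "(\<Sum>i\<in>A. r ^ i) \<le> (\<Sum>i. r ^ i)"
      by (rule sum_le_suminf) (use r A in auto)
    also have "\<dots> = 1 / (1 - r)" using r by (simp add: suminf_geometric)
    finally have "2 / (1 - r) * (\<Sum>i\<in>A. r ^ i) \<le> 2 / (1 - r) * (1 / (1 - r))"
      using r by (intro mult_left_mono) auto
    then show ?thesis by (simp add: power2_eq_square)
  qed
  finally show ?thesis .
qed

text \<open>As k^2 and k have the same parity, the sign (-1)^k can be read off \<open>n\<close>
  itself.\<close>

definition theta4_coeff :: "nat \<Rightarrow> int" where
  "theta4_coeff n = (if n = 0 then 1 else if \<exists>k. n = k ^ 2 then 2 * (-1) ^ n else 0)"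

definition theta4 :: "complex \<Rightarrow> complex" where
  "theta4 q = (\<Sum>n. of_int (theta4_coeff n) * q ^ n)"

lemma theta4_coeff_bound: "\<bar>theta4_coeff n\<bar> \<le> 2"
  by (simp add: theta4_coeff_def abs_mult)

lemma theta4_summable:
  fixes q :: complex
  assumes "norm q < 1"
  shows "summable (\<lambda>n. of_int (theta4_coeff n) * q ^ n)"
proof (rule summable_comparison_test')
  show "summable (\<lambda>n. 2 * norm q ^ n)" using assms by (intro summable_mult) auto
  fix n :: nat
  have "norm (of_int (theta4_coeff n) :: complex) \<le> 2"
    unfolding norm_of_int using theta4_coeff_bound[of n] by linarith
  then show "norm (of_int (theta4_coeff n) * q ^ n) \<le> 2 * norm q ^ n"
    by (simp only: norm_mult norm_power mult_right_mono[OF _ zero_le_power[OF norm_ge_zero]])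
qed

lemma theta4_sums_squares:
  fixes q :: complex
  assumes "norm q < 1"
  shows "(\<lambda>k. if k = 0 then 1 else 2 * (-1) ^ k * q ^ (k ^ 2)) sums theta4 q"
proof -
  have "(\<lambda>n. of_int (theta4_coeff n) * q ^ n) sums theta4 q"
    unfolding theta4_def using theta4_summable[OF assms] by (rule summable_sums)
  also have "?this \<longleftrightarrow> (\<lambda>k. of_int (theta4_coeff (k ^ 2)) * q ^ (k ^ 2)) sums theta4 q"
    by (rule sums_mono_reindex[symmetric]) (auto simp: theta4_coeff_def strict_mono_def intro: power_strict_mono)
  also have "(\<lambda>k. of_int (theta4_coeff (k ^ 2)) * q ^ (k ^ 2)) =
     (\<lambda>k. if k = 0 then 1 else 2 * (-1) ^ k * q ^ (k ^ 2))"
    by (auto simp: theta4_coeff_def fun_eq_iff minus_one_power_iff)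
  finally show ?thesis .
qed

lemma gauss_limit:
  fixes q :: complex
  assumes q: "norm q < 1"
  shows "(\<lambda>n. \<Prod>i=1..n. (1 - q ^ i) / (1 + q ^ i)) \<longlonglongrightarrow> theta4 q"
proof -
  define r where "r = norm q"
  have r: "0 \<le> r" "r < 1" using q by (auto simp: r_def)
  define K where "K = exp (2 / (1 - r) ^ 2)"
  define S where "S n = 1 + 2 * (\<Sum>k=1..n. (-1) ^ k * q ^ (k ^ 2))" for n :: nat
  define P where "P n = (\<Prod>i=1..n. (1 - q ^ i) / (1 + q ^ i))" for n :: nat
  have S: "S \<longlonglongrightarrow> theta4 q"
  proof -
    have "(\<Sum>k<Suc n. if k = 0 then 1 else 2 * (-1) ^ k * q ^ (k ^ 2)) = S n" for n
      unfolding S_def by (induction n) (auto simp: algebra_simps)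
    with theta4_sums_squares[OF q] show ?thesis
      unfolding sums_def by (auto dest: LIMSEQ_Suc)
  qed
  have lb: "norm (1 + q ^ i) \<ge> 1 - r" if "i > 0" for i
  proof -
    have "norm (1 + q ^ i) \<ge> 1 - norm (q ^ i)" by (metis norm_diff_ineq norm_one)
    moreover have "norm (q ^ i) \<le> r" using that r power_decreasing[of 1 i r] by (simp add: norm_power r_def)
    ultimately show ?thesis by linarith
  qed
  have rp: "r ^ i < 1" if "i > 0" for i
    using that r power_decreasing[of 1 i r] by auto
  have prodK: "norm (\<Prod>i\<in>{s<..n}. (1 - q ^ i) / (1 + q ^ i)) \<le> K" for s n
  proof -
    have "norm (\<Prod>i\<in>{s<..n}. (1 - q ^ i) / (1 + q ^ i)) \<le> (\<Prod>i\<in>{s<..n}. (1 + r ^ i) / (1 - r ^ i))"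
      unfolding prod_norm[symmetric]
    proof (rule prod_mono, intro conjI)
      fix i assume i: "i \<in> {s<..n}"
      have "norm (1 - q ^ i) \<le> 1 + r ^ i" by (metis norm_one norm_power norm_triangle_ineq4 r_def)
      moreover have "norm (1 + q ^ i) \<ge> 1 - r ^ i" by (metis norm_diff_ineq norm_one norm_power r_def)
      ultimately show "norm ((1 - q ^ i) / (1 + q ^ i)) \<le> (1 + r ^ i) / (1 - r ^ i)"
        using rp[of i] i r unfolding norm_divide by (intro frac_le) auto
    qed auto
    also have "\<dots> \<le> K" unfolding K_def using r by (intro prod_le_exp) auto
    finally show ?thesis .
  qed
  have K0: "K \<ge> 0" by (simp add: K_def)
  \<comment> \<open>For s \<ge> 1 the remaining product is bounded by \<open>K\<close> uniformly in
    \<open>s\<close> and \<open>n\<close>, while the power of q contributes r^(s (n+1)).\<close>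
  have diff: "norm (S n - P n) \<le> K * (2 / (1 - r)) * (r ^ Suc n / (1 - r))" for n
  proof -
    define t where "t s = (-1) ^ s * (\<Prod>i\<in>{s<..n}. (1 - q ^ i) / (1 + q ^ i)) * (2 / (1 + q ^ s)) * q ^ (s * Suc n)" for s
    have "S n = (\<Sum>s\<le>n. t s)" using shanks_identity[OF q, of n] by (simp add: S_def t_def)
    also have "\<dots> = t 0 + (\<Sum>s=1..n. t s)"
      by (simp add: sum.atMost_shift atLeast0AtMost[symmetric] sum.atLeast_Suc_atMost)
    also have "t 0 = P n"
      by (simp add: t_def P_def atLeastSucAtMost_greaterThanAtMost)
    finally have "norm (S n - P n) = norm (\<Sum>s=1..n. t s)" by simp
    also have "\<dots> \<le> (\<Sum>s=1..n. K * (2 / (1 - r)) * r ^ (s * Suc n))"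
    proof (rule sum_norm_le)
      fix s assume s: "s \<in> {1..n}"
      have "norm (2 / (1 + q ^ s)) \<le> 2 / (1 - r)"
        using lb[of s] s r unfolding norm_divide by (intro frac_le) auto
      moreover have "norm (t s) = norm (\<Prod>i\<in>{s<..n}. (1 - q ^ i) / (1 + q ^ i)) * norm (2 / (1 + q ^ s)) * r ^ (s * Suc n)"
        by (simp only: t_def norm_mult norm_power norm_minus_cancel norm_one power_one mult_1 r_def)
      ultimately show "norm (t s) \<le> K * (2 / (1 - r)) * r ^ (s * Suc n)"
        using prodK[of s n] K0 r by (simp only:) (intro mult_right_mono mult_mono, auto)
    qed
    also have "\<dots> = K * (2 / (1 - r)) * (\<Sum>s=1..n. (r ^ Suc n) ^ s)"
      by (simp only: sum_distrib_left power_mult[symmetric] mult.commute[of "Suc n"])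
    also have "\<dots> \<le> K * (2 / (1 - r)) * (r ^ Suc n / (1 - r))"
    proof (intro mult_left_mono)
      have r1: "r ^ Suc n \<le> r" "0 \<le> r ^ Suc n" using r power_decreasing[of 1 "Suc n" r] by auto
      have "(\<Sum>s=1..n. (r ^ Suc n) ^ s) = r ^ Suc n * (\<Sum>s<n. (r ^ Suc n) ^ s)"
        by (simp add: sum_distrib_left sum.atLeast1_atMost_eq)
      also have "(\<Sum>s<n. (r ^ Suc n) ^ s) \<le> (\<Sum>s. (r ^ Suc n) ^ s)"
        by (rule sum_le_suminf) (use r1 r in \<open>auto simp del: power_Suc\<close>)
      also have "(\<Sum>s. (r ^ Suc n) ^ s) = 1 / (1 - r ^ Suc n)"
        using r1 r by (intro suminf_geometric) (auto simp del: power_Suc)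
      also have "r ^ Suc n * (1 / (1 - r ^ Suc n)) \<le> r ^ Suc n * (1 / (1 - r))"
        using r1 r by (intro mult_left_mono divide_left_mono mult_pos_pos) auto
      finally show "(\<Sum>s=1..n. (r ^ Suc n) ^ s) \<le> r ^ Suc n / (1 - r)" 
        using r1 by (simp add: mult_left_mono)
    qed (use r K0 in auto)
    finally show ?thesis .
  qed
  have "(\<lambda>n. K * (2 / (1 - r)) * (r ^ Suc n / (1 - r))) \<longlonglongrightarrow> K * (2 / (1 - r)) * (0 / (1 - r))"
    using r by (intro tendsto_intros LIMSEQ_Suc LIMSEQ_power_zero) auto
  then have "(\<lambda>n. S n - P n) \<longlonglongrightarrow> 0"
    by (intro Lim_null_comparison[OF always_eventually[OF allI[OF diff]]]) simp
  from tendsto_diff[OF S this] show ?thesis by (simp add: P_def)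
qed

section \<open>The generating function as an infinite product, and the recurrence over
  squares\<close>

definition overpartition_gf :: "complex \<Rightarrow> complex" where
  "overpartition_gf q = (\<Sum>n. of_nat (overpartition_count n) * q ^ n)"

text \<open>Up to index \<open>n\<close> the coefficients are those of the product over parts at
  most \<open>n\<close>, and \<open>prod_le_exp\<close> bounds all these products at once.\<close>

lemma overpartition_summable_real:
  fixes r :: real
  assumes r: "0 \<le> r" "r < 1"
  shows "summable (\<lambda>n. real (overpartition_count n) * r ^ n)"
proof (rule bounded_imp_summable)
  fix n
  have nn: "norm (complex_of_real r) < 1" using r by simp
  have "(\<Sum>k\<le>n. real (overpartition_count k) * r ^ k) = (\<Sum>k\<le>n. norm (of_nat (bounded_count n k) * complex_of_real r ^ k))"
    using r by (intro sum.cong refl) (auto simp: norm_mult norm_power overpartition_count_eq_bounded_count)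
  also have "\<dots> \<le> (\<Sum>k. norm (of_nat (bounded_count n k) * complex_of_real r ^ k))"
    using bounded_count_sums[OF nn] by (intro sum_le_suminf) auto
  also have "\<dots> = (\<Sum>k. real (bounded_count n k) * r ^ k)"
    using r by (simp add: norm_mult norm_power)
  also have "\<dots> = (\<Prod>i=1..n. (1 + r ^ i) / (1 - r ^ i))"
  proof (rule sums_unique[symmetric])
    have "(\<lambda>k. complex_of_real (real (bounded_count n k) * r ^ k)) sums complex_of_real (\<Prod>i=1..n. (1 + r ^ i) / (1 - r ^ i))"
      using bounded_count_sums[OF nn, of n] by simp
    then show "(\<lambda>k. real (bounded_count n k) * r ^ k) sums (\<Prod>i=1..n. (1 + r ^ i) / (1 - r ^ i))"
      by (simp only: sums_of_real_iff)
  qed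
  also have "\<dots> \<le> exp (2 / (1 - r) ^ 2)" by (rule prod_le_exp) (use r in auto)
  finally show "(\<Sum>k\<le>n. real (overpartition_count k) * r ^ k) \<le> exp (2 / (1 - r) ^ 2)" .
qed (use r in auto)

lemma overpartition_summable:
  fixes q :: complex
  assumes "norm q < 1"
  shows "summable (\<lambda>n. norm (of_nat (overpartition_count n) * q ^ n))"
  using overpartition_summable_real[of "norm q"] assms by (simp add: norm_mult norm_power)

text \<open>Dominated convergence: each coefficient of the partial products is eventually constant
  and never exceeds its final value.\<close>

lemma overpartition_gf_limit:
  fixes q :: complex
  assumes q: "norm q < 1"
  shows "(\<lambda>N. \<Prod>i=1..N. (1 + q ^ i) / (1 - q ^ i)) \<longlonglongrightarrow> overpartition_gf q"
proof -
  have "(\<lambda>N. \<Sum>k. of_nat (bounded_count N k) * q ^ k) \<longlonglongrightarrow> overpartition_gf q"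
    unfolding overpartition_gf_def
  proof (rule tannerys_theorem[THEN conjunct2, THEN conjunct2])
    show "(\<lambda>N. of_nat (bounded_count N k) * q ^ k) \<longlonglongrightarrow> of_nat (overpartition_count k) * q ^ k" for k
      by (rule tendsto_eventually)
         (auto simp: overpartition_count_eq_bounded_count intro!: eventually_mono[OF eventually_ge_at_top[of k]])
    show "\<forall>\<^sub>F (k, N) in sequentially \<times>\<^sub>F sequentially.
       norm (of_nat (bounded_count N k) * q ^ k) \<le> norm (of_nat (overpartition_count k) * q ^ k)"
      by (intro always_eventually) (auto simp: norm_mult bounded_count_le intro!: mult_right_mono)
  qed (use overpartition_summable[OF q] in auto)
  also have "(\<lambda>N. \<Sum>k. of_nat (bounded_count N k) * q ^ k) = (\<lambda>N. \<Prod>i=1..N. (1 + q ^ i) / (1 - q ^ i))"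
    using bounded_count_sums[OF q] by (auto simp: sums_iff)
  finally show ?thesis .
qed

lemma overpartition_gf_theta4:
  fixes q :: complex
  assumes q: "norm q < 1"
  shows "overpartition_gf q * theta4 q = 1"
proof -
  have nz: "q ^ i \<noteq> 1" "q ^ i \<noteq> -1" if "i > 0" for i
  proof -
    have "norm q ^ i \<noteq> 1" using q that power_decreasing[of 1 i "norm q"] by auto
    then show "q ^ i \<noteq> 1" "q ^ i \<noteq> -1" by (metis norm_power norm_one, metis norm_power norm_minus_cancel norm_one)
  qed
  have "(\<Prod>i=1..N. (1 + q ^ i) / (1 - q ^ i)) * (\<Prod>i=1..N. (1 - q ^ i) / (1 + q ^ i)) = 1" for N
  proof -
    have "(1 + q ^ i) / (1 - q ^ i) * ((1 - q ^ i) / (1 + q ^ i)) = 1" if "i > 0" for i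
      using nz[OF that] by (simp add: add_eq_0_iff)
    then show ?thesis unfolding prod.distrib[symmetric] by (intro prod.neutral) auto
  qed
  with tendsto_mult[OF overpartition_gf_limit[OF q] gauss_limit[OF q]] show ?thesis
    by (simp add: LIMSEQ_const_iff)
qed

lemma conv_radius_ge_1:
  fixes f :: "nat \<Rightarrow> complex"
  assumes "\<And>z. norm z < 1 \<Longrightarrow> summable (\<lambda>n. f n * z ^ n)"
  shows "conv_radius f \<ge> 1"
proof (rule conv_radius_geI_ex)
  fix r :: real assume "0 < r" "ereal r < 1"
  then show "\<exists>z. norm z = r \<and> summable (\<lambda>n. f n * z ^ n)"
    by (intro exI[of _ "complex_of_real r"] conjI assms) auto
qed

text \<open>The product of the two functions is 1 near 0, hence also the product of the formal power
  series; compare coefficients. All computed values rest on this recurrence.\<close>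

lemma overpartition_recurrence:
  "(\<Sum>i\<le>n. theta4_coeff i * int (overpartition_count (n - i))) = (if n = 0 then 1 else 0)"
proof -
  define A where "A = Abs_fps (\<lambda>n. of_int (theta4_coeff n) :: complex)"
  define B where "B = Abs_fps (\<lambda>n. of_nat (overpartition_count n) :: complex)"
  have rA: "fps_conv_radius A \<ge> 1"
    unfolding fps_conv_radius_def A_def
    by (rule conv_radius_ge_1) (simp add: theta4_summable)
  have rB: "fps_conv_radius B \<ge> 1"
    unfolding fps_conv_radius_def B_def
    by (rule conv_radius_ge_1) (simp add: summable_norm_cancel[OF overpartition_summable])
  have "A * B = 1"
  proof (rule eval_fps_eqD)
    have "1 \<le> min (fps_conv_radius A) (fps_conv_radius B)" using rA rB by simp
    also have "\<dots> \<le> fps_conv_radius (A * B)" by (rule fps_conv_radius_mult)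
    finally show "fps_conv_radius (A * B) > 0" by (rule less_le_trans[rotated]) simp
    have "eventually (\<lambda>z::complex. z \<in> ball 0 1) (nhds 0)"
      by (intro eventually_nhds_in_open) auto
    then show "eventually (\<lambda>z. eval_fps (A * B) z = eval_fps 1 z) (nhds 0)"
    proof eventually_elim
      case (elim z)
      then have z: "norm z < 1" by simp
      have "ereal (norm z) < 1" using z by simp
      then have "eval_fps (A * B) z = eval_fps A z * eval_fps B z"
        by (intro eval_fps_mult less_le_trans[OF \<open>ereal (norm z) < 1\<close> rA] less_le_trans[OF \<open>ereal (norm z) < 1\<close> rB])
      also have "\<dots> = theta4 z * overpartition_gf z"
        by (simp add: eval_fps_def theta4_def overpartition_gf_def A_def B_def)
      finally show ?case using overpartition_gf_theta4[OF z] by (simp add: mult.commute)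
    qed
  qed auto
  then have "fps_nth (A * B) n = (if n = 0 then 1 else 0)" by simp
  then have "complex_of_int (\<Sum>i\<le>n. theta4_coeff i * int (overpartition_count (n - i))) = complex_of_int (if n = 0 then 1 else 0)"
    by (simp add: fps_mult_nth A_def B_def atLeast0AtMost)
  then show ?thesis by (simp only: of_int_eq_iff)
qed

text \<open>The power series of \<open>ln ((1 + x) / (1 - x))\<close> has nonnegative coefficients; only its linear term is compared exactly.\<close>

lemma norm_one_plus_div_one_minus_le:
  fixes x :: complex
  assumes x: "norm x < 1"
  shows "norm ((1 + x) / (1 - x)) \<le> (1 + norm x) / (1 - norm x) * exp (- 2 * (norm x - Re x))"
proof -
  \<comment> \<open>Coefficients of ln ((1 + x) / (1 - x)) - 2 x: zero for even n and for n = 1,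
    otherwise 2 / n. For n = 0 the division by zero gives 0, as it should.\<close>
  define a where "a n = (if n = 1 then 0 else ((-1) ^ Suc n + 1) / real n)" for n
  have a0: "a n \<ge> 0" for n
    unfolding a_def by (cases "even n") auto
  have ser: "(\<lambda>n. complex_of_real (a n) * z ^ n) sums (Ln (1 + z) - Ln (1 - z) - 2 * z)" if "norm z < 1" for z
  proof -
    have "(\<lambda>n. (-1) ^ Suc n / of_nat n * z ^ n - (-1) ^ Suc n / of_nat n * (-z) ^ n - (if n = 1 then 2 * z else 0))
       sums (Ln (1 + z) - Ln (1 + (- z)) - 2 * z)"
      using that by (intro sums_diff Ln_series sums_single) auto
    moreover have "(-1) ^ Suc n / of_nat n * z ^ n - (-1) ^ Suc n / of_nat n * (-z) ^ n - (if n = 1 then 2 * z else 0) =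
        complex_of_real (a n) * z ^ n" for n
      by (cases "even n") (auto simp: a_def power_minus' field_simps)
    ultimately show ?thesis by simp
  qed
  define \<rho> where "\<rho> = norm x"
  have \<rho>: "0 \<le> \<rho>" "\<rho> < 1" using x by (auto simp: \<rho>_def)
  have serx: "(\<lambda>n. complex_of_real (a n) * x ^ n) sums (Ln (1 + x) - Ln (1 - x) - 2 * x)"
    using ser x by blast
  have "(\<lambda>n. complex_of_real (a n * \<rho> ^ n)) sums (Ln (1 + complex_of_real \<rho>) - Ln (1 - complex_of_real \<rho>) - 2 * complex_of_real \<rho>)"
    using ser[of "complex_of_real \<rho>"] \<rho> by simp
  also have "Ln (1 + complex_of_real \<rho>) - Ln (1 - complex_of_real \<rho>) - 2 * complex_of_real \<rho> =
     complex_of_real (ln (1 + \<rho>) - ln (1 - \<rho>) - 2 * \<rho>)"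
    using Ln_of_real[of "1 + \<rho>"] Ln_of_real[of "1 - \<rho>"] \<rho> by simp
  finally have ser\<rho>: "(\<lambda>n. a n * \<rho> ^ n) sums (ln (1 + \<rho>) - ln (1 - \<rho>) - 2 * \<rho>)"
    by (simp only: sums_of_real_iff)
  have W: "Ln (1 + x) - Ln (1 - x) - 2 * x = (\<Sum>n. complex_of_real (a n) * x ^ n)"
    using serx by (simp add: sums_iff)
  have "norm (\<Sum>n. complex_of_real (a n) * x ^ n) \<le> (\<Sum>n. a n * \<rho> ^ n)"
    using ser\<rho> a0 by (intro norm_suminf_le) (auto simp: norm_mult norm_power \<rho>_def sums_iff)
  also have "\<dots> = ln (1 + \<rho>) - ln (1 - \<rho>) - 2 * \<rho>"
    using ser\<rho> by (simp add: sums_iff)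
  finally have "Re (Ln (1 + x) - Ln (1 - x) - 2 * x) \<le> ln (1 + \<rho>) - ln (1 - \<rho>) - 2 * \<rho>"
    unfolding W using complex_Re_le_cmod order_trans by blast
  then have le: "Re (Ln (1 + x) - Ln (1 - x)) \<le> ln (1 + \<rho>) - ln (1 - \<rho>) - 2 * (\<rho> - Re x)"
    by simp
  have "1 + x \<noteq> 0" "1 - x \<noteq> 0" using x by (auto simp: add_eq_0_iff)
  then have "(1 + x) / (1 - x) = exp (Ln (1 + x) - Ln (1 - x))" by (simp add: exp_diff)
  then have "norm ((1 + x) / (1 - x)) = exp (Re (Ln (1 + x) - Ln (1 - x)))" by simp
  also have "\<dots> \<le> exp (ln (1 + \<rho>) - ln (1 - \<rho>) - 2 * (\<rho> - Re x))" using le by simp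
  also have "\<dots> = (1 + \<rho>) / (1 - \<rho>) * exp (- 2 * (\<rho> - Re x))"
  proof -
    have "ln (1 + \<rho>) - ln (1 - \<rho>) - 2 * (\<rho> - Re x) = ln ((1 + \<rho>) / (1 - \<rho>)) + (- 2 * (\<rho> - Re x))"
      using \<rho> by (simp add: ln_div)
    then show ?thesis using \<rho> by (simp only: exp_add exp_ln_iff) simp
  qed
  finally show ?thesis by (simp add: \<rho>_def)
qed

text \<open>Applying the factorwise bound to x = q^i and multiplying turns the savings |q|^i - Re
  (q^i) into geometric series. The loss against the value at |q| is therefore explicit in 1 / (1 -
  q), with no information on q near other roots of unity.\<close>

lemma norm_overpartition_gf_le:
  fixes q :: complex
  assumes q: "norm q < 1"
  shows "norm (overpartition_gf q) \<le> norm (overpartition_gf (of_real (norm q))) *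
     exp (- 2 * (norm q / (1 - norm q) - Re (q / (1 - q))))"
proof -
  define r where "r = norm q"
  have r: "0 \<le> r" "r < 1" using q by (auto simp: r_def)
  have sumr: "(\<lambda>N. \<Sum>i=1..N. z ^ i) \<longlonglongrightarrow> z / (1 - z)" if "norm z < 1" for z :: complex
  proof -
    have "(\<lambda>i. z ^ Suc i) sums (z * (1 / (1 - z)))"
      using sums_mult[OF geometric_sums[OF that], of z] by simp
    then have "(\<lambda>N. \<Sum>i<N. z ^ Suc i) \<longlonglongrightarrow> z * (1 / (1 - z))" by (simp add: sums_def)
    then show ?thesis by (simp add: sum.atLeast1_atMost_eq lessThan_Suc_atMost)
  qed
  have nr: "norm (complex_of_real r) < 1" using r by simp
  have "(\<lambda>N. Re (\<Sum>i=1..N. complex_of_real r ^ i)) \<longlonglongrightarrow> Re (complex_of_real r / (1 - complex_of_real r))"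
    by (intro tendsto_Re sumr nr)
  also have "complex_of_real r / (1 - complex_of_real r) = complex_of_real (r / (1 - r))" by simp
  finally have sr: "(\<lambda>N. \<Sum>i=1..N. r ^ i) \<longlonglongrightarrow> r / (1 - r)"
    by (simp flip: of_real_power of_real_sum)
  have sq: "(\<lambda>N. Re (\<Sum>i=1..N. q ^ i)) \<longlonglongrightarrow> Re (q / (1 - q))"
    by (intro tendsto_Re sumr q)
  show ?thesis unfolding r_def[symmetric]
  proof (rule LIMSEQ_le)
    show "(\<lambda>N. norm (\<Prod>i=1..N. (1 + q ^ i) / (1 - q ^ i))) \<longlonglongrightarrow> norm (overpartition_gf q)"
      by (intro tendsto_norm overpartition_gf_limit q)
    show "(\<lambda>N. norm (\<Prod>i=1..N. (1 + complex_of_real r ^ i) / (1 - complex_of_real r ^ i)) *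
        exp (- 2 * ((\<Sum>i=1..N. r ^ i) - Re (\<Sum>i=1..N. q ^ i))))
      \<longlonglongrightarrow> norm (overpartition_gf (of_real r)) * exp (- 2 * (r / (1 - r) - Re (q / (1 - q))))"
      by (intro tendsto_intros overpartition_gf_limit nr sr sq)
    have "norm (\<Prod>i=1..N. (1 + q ^ i) / (1 - q ^ i)) \<le> norm (\<Prod>i=1..N. (1 + complex_of_real r ^ i) / (1 - complex_of_real r ^ i)) *
        exp (- 2 * ((\<Sum>i=1..N. r ^ i) - Re (\<Sum>i=1..N. q ^ i)))" for N
    proof -
      have rp: "r ^ i < 1" if "i > 0" for i using that r power_decreasing[of 1 i r] by auto
      have "norm (\<Prod>i=1..N. (1 + q ^ i) / (1 - q ^ i)) = (\<Prod>i=1..N. norm ((1 + q ^ i) / (1 - q ^ i)))"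
        by (simp add: prod_norm)
      also have "\<dots> \<le> (\<Prod>i=1..N. (1 + r ^ i) / (1 - r ^ i) * exp (- 2 * (r ^ i - Re (q ^ i))))"
      proof (intro prod_mono conjI norm_ge_zero)
        fix i assume "i \<in> {1..N}"
        then show "norm ((1 + q ^ i) / (1 - q ^ i)) \<le> (1 + r ^ i) / (1 - r ^ i) * exp (- 2 * (r ^ i - Re (q ^ i)))"
          using norm_one_plus_div_one_minus_le[of "q ^ i"] rp[of i] by (simp add: norm_power r_def)
      qed
      also have "\<dots> = (\<Prod>i=1..N. (1 + r ^ i) / (1 - r ^ i)) * exp (- 2 * ((\<Sum>i=1..N. r ^ i) - Re (\<Sum>i=1..N. q ^ i)))"
      proof -
        have "(\<Prod>i=1..N. exp (- 2 * (r ^ i - Re (q ^ i)))) = exp (\<Sum>i=1..N. - 2 * (r ^ i - Re (q ^ i)))"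
          by (simp only: exp_sum[OF finite_atLeastAtMost])
        also have "(\<Sum>i=1..N. - 2 * (r ^ i - Re (q ^ i))) = - 2 * ((\<Sum>i=1..N. r ^ i) - Re (\<Sum>i=1..N. q ^ i))"
          by (simp only: sum_distrib_left[symmetric] sum_subtractf Re_sum)
        finally show ?thesis by (simp only: prod.distrib)
      qed
      also have "(\<Prod>i=1..N. (1 + r ^ i) / (1 - r ^ i)) = norm (\<Prod>i=1..N. (1 + complex_of_real r ^ i) / (1 - complex_of_real r ^ i))"
      proof -
        have "norm (\<Prod>i=1..N. (1 + complex_of_real r ^ i) / (1 - complex_of_real r ^ i)) = norm (complex_of_real (\<Prod>i=1..N. (1 + r ^ i) / (1 - r ^ i)))"
          by simp
        also have "\<dots> = \<bar>\<Prod>i=1..N. (1 + r ^ i) / (1 - r ^ i)\<bar>" by (rule norm_of_real)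
        also have "\<dots> = (\<Prod>i=1..N. (1 + r ^ i) / (1 - r ^ i))"
        proof -
          have "0 \<le> (1 + r ^ i) / (1 - r ^ i)" if "i \<in> {1..N}" for i
            using rp[of i] r that by (intro divide_nonneg_nonneg) auto
          then show ?thesis by (intro abs_of_nonneg prod_nonneg) auto
        qed
        finally show ?thesis ..
      qed
      finally show ?thesis .
    qed
    then show "\<exists>N. \<forall>n\<ge>N. norm (\<Prod>i=1..n. (1 + q ^ i) / (1 - q ^ i)) \<le> norm (\<Prod>i=1..n. (1 + complex_of_real r ^ i) / (1 - complex_of_real r ^ i)) *
        exp (- 2 * ((\<Sum>i=1..n. r ^ i) - Re (\<Sum>i=1..n. q ^ i)))" by blast
  qed
qed

section \<open>The transformation of the theta function\<close>

lemma binomial_central_step: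
  "real ((2 * m) choose (m + Suc k)) = real ((2 * m) choose (m + k)) * ((real m - real k) / (real m + real k + 1))" if "k \<le> m"
proof -
  have "(m + Suc k) * ((2 * m) choose (m + Suc k)) = (2 * m - (m + k)) * ((2 * m) choose (m + k))"
    using binomial_absorb_comp[of "2 * m" "m + k"] Suc_times_binomial_eq[of "2 * m - 1" "m + k"]
    by (cases m) (auto simp: algebra_simps)
  then have "real ((m + Suc k) * ((2 * m) choose (m + Suc k))) = real ((2 * m - (m + k)) * ((2 * m) choose (m + k)))"
    by simp
  then have "(real m + real k + 1) * real ((2 * m) choose (m + Suc k)) = (real m - real k) * real ((2 * m) choose (m + k))"
    using that by (simp add: of_nat_diff algebra_simps)
  then show ?thesis by (simp add: field_simps)
qed

text \<open>Close to exp (- k^2 / m) when k is small against m; this is how the Gaussian summands of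
  the theta series arise.\<close>

definition central_ratio :: "nat \<Rightarrow> nat \<Rightarrow> real" where
  "central_ratio m k = real ((2 * m) choose (m + k)) / real ((2 * m) choose m)"

lemma central_ratio_0 [simp]: "central_ratio m 0 = 1"
  by (simp add: central_ratio_def)

lemma central_ratio_nonneg: "central_ratio m k \<ge> 0"
  by (simp add: central_ratio_def)

lemma central_ratio_eq_0: "k > m \<Longrightarrow> central_ratio m k = 0"
  by (simp add: central_ratio_def)

lemma central_ratio_Suc:
  "k \<le> m \<Longrightarrow> central_ratio m (Suc k) = central_ratio m k * ((real m - real k) / (real m + real k + 1))"
  using binomial_central_step[of k m] by (simp add: central_ratio_def)

text \<open>Each step multiplies by 1 - (2k + 1) / (m + k + 1), which is at most exp (- (2k + 1) /
  (m + K)), and the odd numbers add up to k^2. The parameter \<open>K\<close> is free because the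
  limit needs \<open>K = k\<close>, while a majorant valid for all k comes from
  \<open>K = m\<close>.\<close>

lemma central_ratio_upper:
  assumes "k \<le> K" "K \<le> m" "m > 0"
  shows "central_ratio m k \<le> exp (- real (k ^ 2) / (real m + real K))"
  using assms(1)
proof (induction k)
  case (Suc k)
  let ?D = "real m + real K"
  have D: "?D > 0" using assms by simp
  have km: "k \<le> m" "real k + 1 \<le> real K" using Suc assms by auto
  have "(real m - real k) / (real m + real k + 1) = 1 + - (2 * real k + 1) / (real m + real k + 1)"
    using assms by (simp add: field_simps)
  also have "\<dots> \<le> exp (- (2 * real k + 1) / (real m + real k + 1))"
    by (rule exp_ge_add_one_self)
  also have "\<dots> \<le> exp (- (2 * real k + 1) / ?D)"
  proof -
    have "(2 * real k + 1) / ?D \<le> (2 * real k + 1) / (real m + real k + 1)"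
      using km D by (intro divide_left_mono) auto
    then show ?thesis by (simp only: minus_divide_left[symmetric] exp_le_cancel_iff neg_le_iff_le)
  qed
  finally have "central_ratio m (Suc k) \<le> exp (- real (k ^ 2) / ?D) * exp (- (2 * real k + 1) / ?D)"
    unfolding central_ratio_Suc[OF km(1)] using Suc km by (intro mult_mono) auto
  also have "\<dots> = exp (- real (Suc k ^ 2) / ?D)"
    unfolding exp_add[symmetric] add_divide_distrib[symmetric] by (simp add: power2_eq_square algebra_simps)
  finally show ?case .
qed simp

lemma central_ratio_lower:
  assumes "k \<le> K" "K < m"
  shows "central_ratio m k \<ge> exp (- real (k ^ 2) / (real m - real K))"
  using assms(1)
proof (induction k)
  case (Suc k)
  let ?D = "real m - real K"
  have D: "?D > 0" using assms by simp
  have km: "k \<le> m" "real k + 1 \<le> real K" "real k < real m" using Suc assms by auto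
  have "exp (- (2 * real k + 1) / ?D) \<le> exp (- (2 * real k + 1) / (real m - real k))"
  proof -
    have "(2 * real k + 1) / (real m - real k) \<le> (2 * real k + 1) / ?D"
      using km D by (intro divide_left_mono) auto
    then show ?thesis by (simp only: minus_divide_left[symmetric] exp_le_cancel_iff neg_le_iff_le)
  qed
  also have "\<dots> = 1 / exp ((2 * real k + 1) / (real m - real k))"
    by (simp only: minus_divide_left[symmetric] exp_minus inverse_eq_divide)
  also have "\<dots> \<le> 1 / (1 + (2 * real k + 1) / (real m - real k))"
    using km by (intro divide_left_mono exp_ge_add_one_self mult_pos_pos add_pos_nonneg) auto
  also have "\<dots> = (real m - real k) / (real m + real k + 1)"
    using km by (simp add: field_simps)
  finally have "exp (- real (k ^ 2) / ?D) * exp (- (2 * real k + 1) / ?D) \<le> central_ratio m (Suc k)"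
    unfolding central_ratio_Suc[OF km(1)] using Suc km by (intro mult_mono central_ratio_nonneg) auto
  also have "exp (- real (k ^ 2) / ?D) * exp (- (2 * real k + 1) / ?D) = exp (- real (Suc k ^ 2) / ?D)"
    unfolding exp_add[symmetric] add_divide_distrib[symmetric] by (simp add: power2_eq_square algebra_simps)
  finally show ?case .
qed simp

lemma cos_power_sum:
  fixes \<alpha> :: real
  shows "(2 * cos \<alpha>) ^ n = (\<Sum>i\<le>n. real (n choose i) * cos ((2 * real i - real n) * \<alpha>))"
proof -
  have "complex_of_real ((2 * cos \<alpha>) ^ n) = (cis \<alpha> + cis (- \<alpha>)) ^ n"
    by (simp add: complex_eq_iff cis.code flip: of_real_power)
  also have "\<dots> = (\<Sum>i\<le>n. of_nat (n choose i) * cis \<alpha> ^ i * cis (- \<alpha>) ^ (n - i))"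
    by (rule binomial_ring)
  also have "\<dots> = (\<Sum>i\<le>n. complex_of_real (real (n choose i)) * cis ((2 * real i - real n) * \<alpha>))"
  proof (intro sum.cong refl)
    fix i assume "i \<in> {..n}"
    then have "real (n - i) = real n - real i" by (simp add: of_nat_diff)
    then have "real i * \<alpha> + real (n - i) * (- \<alpha>) = (2 * real i - real n) * \<alpha>"
      by (simp add: algebra_simps)
    then show "of_nat (n choose i) * cis \<alpha> ^ i * cis (- \<alpha>) ^ (n - i) = complex_of_real (real (n choose i)) * cis ((2 * real i - real n) * \<alpha>)"
      by (simp add: Complex.DeMoivre mult.assoc cis_mult del: of_nat_diff)
  qed
  finally have "Re (complex_of_real ((2 * cos \<alpha>) ^ n)) = Re (\<Sum>i\<le>n. complex_of_real (real (n choose i)) * cis ((2 * real i - real n) * \<alpha>))"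
    by (rule arg_cong)
  then show ?thesis by simp
qed

lemma sum_central_split:
  fixes g :: "nat \<Rightarrow> 'a::comm_monoid_add"
  shows "(\<Sum>i\<le>2 * m. g i) = g m + (\<Sum>k=1..m. g (m + k) + g (m - k))"
proof -
  have "{..2 * m} = {m} \<union> ((\<lambda>k. m + k) ` {1..m} \<union> (\<lambda>k. m - k) ` {1..m})"
  proof (intro equalityI subsetI)
    fix i assume "i \<in> {..2 * m}"
    then show "i \<in> {m} \<union> ((\<lambda>k. m + k) ` {1..m} \<union> (\<lambda>k. m - k) ` {1..m})"
    proof (cases i m rule: linorder_cases)
      case less
      then have "i = m - (m - i)" "m - i \<in> {1..m}" by auto
      then show ?thesis by blast
    next
      case greater
      with \<open>i \<in> _\<close> have "i = m + (i - m)" "i - m \<in> {1..m}" by auto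
      then show ?thesis by blast
    qed auto
  qed auto
  then have "(\<Sum>i\<le>2 * m. g i) = (\<Sum>i\<in>{m} \<union> ((\<lambda>k. m + k) ` {1..m} \<union> (\<lambda>k. m - k) ` {1..m}). g i)"
    by simp
  also have "\<dots> = g m + (\<Sum>i\<in>(\<lambda>k. m + k) ` {1..m} \<union> (\<lambda>k. m - k) ` {1..m}. g i)"
    by (subst sum.union_disjoint) auto
  also have "(\<Sum>i\<in>(\<lambda>k. m + k) ` {1..m} \<union> (\<lambda>k. m - k) ` {1..m}. g i) =
      (\<Sum>i\<in>(\<lambda>k. m + k) ` {1..m}. g i) + (\<Sum>i\<in>(\<lambda>k. m - k) ` {1..m}. g i)"
    by (rule sum.union_disjoint) auto
  also have "(\<Sum>i\<in>(\<lambda>k. m + k) ` {1..m}. g i) = (\<Sum>k=1..m. g (m + k))"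
    by (subst sum.reindex) (auto simp: inj_on_def)
  also have "(\<Sum>i\<in>(\<lambda>k. m - k) ` {1..m}. g i) = (\<Sum>k=1..m. g (m - k))"
    by (subst sum.reindex) (auto simp: inj_on_def)
  finally show ?thesis by (simp add: sum.distrib)
qed

text \<open>The filter runs over the 2p-th roots of unity whose p-th power is -1 instead of the p-th
  roots of unity; this produces the alternating sign of \<open>theta4\<close>.\<close>

lemma sum_cos_odd_multiples:
  assumes "p > 0"
  shows "(\<Sum>l<p. cos (pi * real k * (2 * real l + 1) / real p)) = (if p dvd k then real p * (-1) ^ (k div p) else 0)"
proof (cases "p dvd k")
  case True
  then obtain v where v: "k = p * v" by blast
  have "cos (pi * real k * (2 * real l + 1) / real p) = (-1) ^ v" for l
  proof -
    have "pi * real k * (2 * real l + 1) / real p = pi * real (v * (2 * l + 1))"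
      using assms v by (simp add: field_simps)
    also have "cos \<dots> = (-1) ^ (v * (2 * l + 1))" by (rule cos_npi2)
    finally show ?thesis by (auto simp: minus_one_power_iff)
  qed
  then show ?thesis using assms v by simp
next
  case False
  define x where "x = pi * real k / real p"
  have sx: "sin x \<noteq> 0"
  proof
    assume "sin x = 0"
    then obtain i :: int where "x = of_int i * pi" by (auto simp: sin_zero_iff_int2)
    then have "real k = of_int i * real p" using assms by (simp add: x_def field_simps)
    then have "int k = i * int p" by (metis of_int_eq_iff of_int_mult of_int_of_nat_eq)
    then have "int p dvd int k" by simp
    then have "p dvd k" by presburger
    with False show False by simp
  qed
  \<comment> \<open>Multiplied by 2 sin x, the sum of cosines telescopes.\<close>
  have "2 * sin x * (\<Sum>l<n. cos ((2 * real l + 1) * x)) = sin (2 * real n * x)" for n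
  proof (induction n)
    case (Suc n)
    have "2 * sin x * cos ((2 * real n + 1) * x) = sin (2 * real (Suc n) * x) - sin (2 * real n * x)"
      using sin_diff[of "(2 * real n + 1) * x" x] sin_add[of "(2 * real n + 1) * x" x]
      by (simp add: algebra_simps)
    with Suc show ?case by (simp add: distrib_left)
  qed simp
  from this[of p] have "2 * sin x * (\<Sum>l<p. cos ((2 * real l + 1) * x)) = sin (2 * real p * x)" .
  also have "2 * real p * x = real (2 * k) * pi" using assms by (simp add: x_def)
  also have "sin \<dots> = 0" by (rule sin_npi)
  finally have "(\<Sum>l<p. cos ((2 * real l + 1) * x)) = 0" using sx by simp
  moreover have "(2 * real l + 1) * x = pi * real k * (2 * real l + 1) / real p" for l
    by (simp add: x_def)
  ultimately show ?thesis using False by simp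
qed

text \<open>Polya's proof of the theta transformation: apply the root of unity filter to \<open>(z + 1 / z) ^ (2 * m)\<close> and let \<open>m\<close> grow like \<open>p^2 / (\<pi> t)\<close>. The sum over binomial coefficients tends to the theta series at \<open>exp (- \<pi> t)\<close>, the sum over roots of unity to its dual.\<close>

lemma polya_identity:
  assumes p: "p > 0"
  shows "(\<lambda>v. (if v = 0 then 1 else 2) * (-1) ^ v * real ((2 * m) choose (m + v * p)))
    sums (1 / real p * (\<Sum>l<p. (2 * cos (pi * (2 * real l + 1) / (2 * real p))) ^ (2 * m)))"
proof -
  define c where "c k = (\<Sum>l<p. cos (pi * real k * (2 * real l + 1) / real p))" for k :: nat
  have "(\<Sum>l<p. (2 * cos (pi * (2 * real l + 1) / (2 * real p))) ^ (2 * m)) =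
    (\<Sum>l<p. \<Sum>i\<le>2 * m. real (2 * m choose i) * cos ((2 * real i - 2 * real m) * (pi * (2 * real l + 1) / (2 * real p))))"
    by (simp only: cos_power_sum of_nat_mult of_nat_numeral)
  also have "\<dots> = (\<Sum>i\<le>2 * m. real (2 * m choose i) * (\<Sum>l<p. cos ((2 * real i - 2 * real m) * (pi * (2 * real l + 1) / (2 * real p)))))"
    by (subst sum.swap) (simp add: sum_distrib_left)
  also have "\<dots> = real (2 * m choose m) * c 0 + (\<Sum>k=1..m. real (2 * m choose (m + k)) * c k + real (2 * m choose (m - k)) * c k)"
    unfolding sum_central_split
  proof (intro arg_cong2[of _ _ _ _ "(+)"] sum.cong arg_cong2[of _ _ _ _ "(*)"] refl)
    fix k assume k: "k \<in> {1..m}"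
    show "(\<Sum>l<p. cos ((2 * real (m + k) - 2 * real m) * (pi * (2 * real l + 1) / (2 * real p)))) = c k"
      unfolding c_def by (intro sum.cong refl arg_cong[of _ _ cos]) (use p in \<open>simp add: field_simps\<close>)
    have "cos ((2 * real (m - k) - 2 * real m) * (pi * (2 * real l + 1) / (2 * real p))) = cos (pi * real k * (2 * real l + 1) / real p)" for l
    proof -
      have "(2 * real (m - k) - 2 * real m) * (pi * (2 * real l + 1) / (2 * real p)) = - (pi * real k * (2 * real l + 1) / real p)"
        using k p by (simp add: of_nat_diff field_simps)
      then show ?thesis by (simp only: cos_minus)
    qed
    then show "(\<Sum>l<p. cos ((2 * real (m - k) - 2 * real m) * (pi * (2 * real l + 1) / (2 * real p)))) = c k"
      unfolding c_def by simp
  qed (simp add: c_def)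
  also have "(\<Sum>k=1..m. real (2 * m choose (m + k)) * c k + real (2 * m choose (m - k)) * c k) =
     (\<Sum>k=1..m. 2 * real (2 * m choose (m + k)) * c k)"
  proof (intro sum.cong refl)
    fix k assume "k \<in> {1..m}"
    then have "2 * m choose (m - k) = 2 * m choose (m + k)"
      using binomial_symmetric[of "m + k" "2 * m"] by simp
    then show "real (2 * m choose (m + k)) * c k + real (2 * m choose (m - k)) * c k = 2 * real (2 * m choose (m + k)) * c k"
      by simp
  qed
  also have "c 0 = real p" by (simp add: c_def)
  finally have total: "(\<Sum>l<p. (2 * cos (pi * (2 * real l + 1) / (2 * real p))) ^ (2 * m)) =
      real (2 * m choose m) * real p + (\<Sum>k=1..m. 2 * real (2 * m choose (m + k)) * c k)" .
  \<comment> \<open>Summands for all k, vanishing for k > m (binomial coefficient) and for k not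
    divisible by p (filter), so the finite sum may be rewritten as a series over the multiples of
    p.\<close>
  define a where "a k = (if k = 0 then 1 else 2) * real (2 * m choose (m + k)) * (c k / real p)" for k
  have "1 / real p * (\<Sum>l<p. (2 * cos (pi * (2 * real l + 1) / (2 * real p))) ^ (2 * m)) = (\<Sum>k\<in>{..m}. a k)"
  proof -
    have "(\<Sum>k\<in>{..m}. a k) = a 0 + (\<Sum>k=1..m. a k)"
      by (simp add: atLeast0AtMost[symmetric] sum.atLeast_Suc_atMost)
    also have "a 0 = real (2 * m choose m)" using p by (simp add: a_def c_def)
    also have "(\<Sum>k=1..m. a k) = (\<Sum>k=1..m. 1 / real p * (2 * real (2 * m choose (m + k)) * c k))"
      by (intro sum.cong refl) (auto simp: a_def)
    finally show ?thesis unfolding total using p by (simp add: sum_distrib_left distrib_left)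
  qed
  moreover have "a sums (\<Sum>k\<in>{..m}. a k)"
    by (rule sums_finite) (auto simp: a_def)
  then have "(\<lambda>v. a (v * p)) sums (\<Sum>k\<in>{..m}. a k)"
  proof (subst sums_mono_reindex)
    show "strict_mono (\<lambda>v. v * p)" using p by (simp add: strict_mono_def)
    show "a n = 0" if "n \<notin> range (\<lambda>v. v * p)" for n
    proof -
      have "\<not> p dvd n" using that by (auto simp: dvd_def mult.commute)
      then show ?thesis using sum_cos_odd_multiples[OF p, of n] by (simp add: a_def c_def)
    qed
  qed
  moreover have "a (v * p) = (if v = 0 then 1 else 2) * (-1) ^ v * real ((2 * m) choose (m + v * p))" for v
    using sum_cos_odd_multiples[OF p, of "v * p"] p by (simp add: a_def c_def)
  ultimately show ?thesis by simp
qed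

text \<open>The derivative of exp (x^2 / 2) cos x has the sign of x cos x - sin x. The Gaussian
  majorant is needed for dominated convergence of the sum over roots of unity.\<close>

lemma cos_le_exp:
  fixes x :: real
  assumes "0 \<le> x" "x \<le> pi / 2"
  shows "cos x \<le> exp (- (x ^ 2 / 2))"
proof -
  have h: "y * cos y \<le> sin y" if "0 \<le> y" "y \<le> pi / 2" for y :: real
  proof -
    have "sin 0 - 0 * cos 0 \<le> sin y - y * cos y"
    proof (rule DERIV_nonneg_imp_nondecreasing[OF that(1)])
      fix z assume "0 \<le> z" "z \<le> y"
      then show "\<exists>d. ((\<lambda>y. sin y - y * cos y) has_real_derivative d) (at z) \<and> 0 \<le> d"
        using that by (intro exI[of _ "z * sin z"] conjI mult_nonneg_nonneg sin_ge_zero)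
          (auto intro!: derivative_eq_intros)
    qed
    then show ?thesis by simp
  qed
  have "exp (x ^ 2 / 2) * cos x \<le> exp (0 ^ 2 / 2) * cos 0"
  proof (rule DERIV_nonpos_imp_nonincreasing[OF assms(1)])
    fix z assume "0 \<le> z" "z \<le> x"
    then show "\<exists>d. ((\<lambda>x. exp (x ^ 2 / 2) * cos x) has_real_derivative d) (at z) \<and> d \<le> 0"
      using h[of z] assms
      by (intro exI[of _ "exp (z ^ 2 / 2) * (z * cos z - sin z)"] conjI)
        (auto intro!: derivative_eq_intros mult_nonneg_nonpos simp: algebra_simps)
  qed
  then show ?thesis by (simp add: exp_minus field_simps)
qed

text \<open>For W = 4^n / C(2n, n) the partial Wallis product is exactly W^2 / (2n + 1).\<close>

lemma central_binomial_limit: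
  "(\<lambda>m. 4 ^ m / (real (2 * m choose m) * sqrt (pi * real m))) \<longlonglongrightarrow> 1"
proof -
  define W where "W m = 4 ^ m / real (2 * m choose m)" for m :: nat
  have eq: "(\<Prod>k=1..n. (4 * real k ^ 2) / (4 * real k ^ 2 - 1)) = W n ^ 2 / (2 * real n + 1)" for n
  proof (induction n)
    case (Suc n)
    have "Suc n * (2 * Suc n choose Suc n) = 2 * (2 * n + 1) * (2 * n choose n)"
    proof -
      have "Suc n * (2 * Suc n choose Suc n) = (2 * n + 2) * (2 * n + 1 choose n)"
        using Suc_times_binomial_eq[of "2 * n + 1" n] by (simp add: mult.commute)
      moreover have "Suc n * (2 * n + 1 choose n) = (2 * n + 1) * (2 * n choose n)"
        using Suc_times_binomial_eq[of "2 * n" n] binomial_symmetric[of n "2 * n + 1"] by (simp add: mult.commute)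
      ultimately have "Suc n * (Suc n * (2 * Suc n choose Suc n)) = Suc n * (2 * (2 * n + 1) * (2 * n choose n))"
        by (simp add: algebra_simps)
      then show ?thesis using mult_left_cancel[of "Suc n"] by blast
    qed
    then have "real (Suc n * (2 * Suc n choose Suc n)) = real (2 * (2 * n + 1) * (2 * n choose n))" by (rule arg_cong)
    then have CS: "real (2 * Suc n choose Suc n) = 2 * (2 * real n + 1) * real (2 * n choose n) / (real n + 1)"
      by (simp add: field_simps del: binomial_Suc_Suc)
    have WS: "W (Suc n) = W n * (2 * (real n + 1) / (2 * real n + 1))"
    proof -
      have "4 * X / (2 * (2 * a + 1) * C / (a + 1)) = X / C * (2 * (a + 1) / (2 * a + 1))"
        if "C > 0" "a \<ge> 0" for X C a :: real
      proof -
        have "2 * a + 1 > 0" "a + 1 > 0" using that by linarith+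
        with that show ?thesis by (simp add: divide_simps) (simp add: algebra_simps)
      qed
      then show ?thesis unfolding W_def CS power_Suc by simp
    qed
    then have "W (Suc n) ^ 2 / (2 * real (Suc n) + 1) = W n ^ 2 / (2 * real n + 1) * ((2 * (real n + 1)) ^ 2 / ((2 * real n + 1) * (2 * real n + 3)))"
    proof -
      have "(w * (x / y)) ^ 2 / z = w ^ 2 / y * (x ^ 2 / (y * z))" for w x y z :: real
        by (simp add: power_mult_distrib power_divide power2_eq_square mult_ac)
      moreover have "2 * real (Suc n) + 1 = 2 * real n + 3" by simp
      ultimately show ?thesis unfolding WS by simp
    qed
    moreover have "(4 * real (Suc n) ^ 2) / (4 * real (Suc n) ^ 2 - 1) = (2 * (real n + 1)) ^ 2 / ((2 * real n + 1) * (2 * real n + 3))"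
      by (intro arg_cong2[of _ _ _ _ "(/)"]) (simp_all add: power2_eq_square algebra_simps)
    ultimately show ?case using Suc by simp
  qed (simp add: W_def)
  have "(\<lambda>n. W n ^ 2 / (2 * real n + 1)) \<longlonglongrightarrow> pi / 2"
    using wallis by (simp only: eq)
  moreover have "(\<lambda>n. (2 * real n + 1) / (pi * real n)) \<longlonglongrightarrow> 2 * inverse pi"
    by real_asymp
  ultimately have "(\<lambda>n. W n ^ 2 / (2 * real n + 1) * ((2 * real n + 1) / (pi * real n))) \<longlonglongrightarrow> pi / 2 * (2 * inverse pi)"
    by (rule tendsto_mult)
  then have "(\<lambda>n. sqrt (W n ^ 2 / (2 * real n + 1) * ((2 * real n + 1) / (pi * real n)))) \<longlonglongrightarrow> sqrt (pi / 2 * (2 * inverse pi))"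
    by (rule tendsto_real_sqrt)
  moreover have "sqrt (W n ^ 2 / (2 * real n + 1) * ((2 * real n + 1) / (pi * real n))) = 4 ^ n / (real (2 * n choose n) * sqrt (pi * real n))" for n
  proof -
    have "W n ^ 2 / (2 * real n + 1) * ((2 * real n + 1) / (pi * real n)) = W n ^ 2 / (pi * real n)"
      by (simp add: add_nonneg_eq_0_iff)
    moreover have "W n \<ge> 0" by (simp add: W_def)
    ultimately show ?thesis by (simp add: real_sqrt_divide W_def)
  qed
  ultimately show ?thesis by simp
qed


text \<open>Both sides of \<open>polya_identity\<close> are divided by the central binomial
  coefficient and passed to the limit, each by Tannery's theorem with a geometric majorant; the two
  limits must agree.\<close>

lemma theta4_real_transform:
  fixes t :: real
  assumes t: "t > 0"
  shows "theta4 (of_real (exp (- pi * t))) =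
     of_real (2 / sqrt t * (\<Sum>l. exp (- pi * (real l + 1 / 2) ^ 2 / t)))"
proof -
  \<comment> \<open>Even, so that the p cosines fall into p / 2 mirrored pairs without a middle
    term.\<close>
  define p where "p n = 2 * Suc n" for n
  \<comment> \<open>With m close to p^2 / (pi t), the exponent (v p)^2 / m tends to pi t
    v^2.\<close>
  define m where "m n = nat \<lfloor>real (p n) ^ 2 / (pi * t)\<rfloor>" for n
  define M where "M n = real (m n)" for n
  define P where "P n = real (p n)" for n
  have P: "P n > 0" "p n > 0" for n by (simp_all add: P_def p_def)
  have M_le: "M n \<le> P n ^ 2 / (pi * t)" and M_ge: "M n \<ge> P n ^ 2 / (pi * t) - 1" for n
  proof -
    have "P n ^ 2 / (pi * t) \<ge> 0" using t by simp
    then have "M n = of_int \<lfloor>P n ^ 2 / (pi * t)\<rfloor>" by (simp add: M_def m_def P_def)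
    then show "M n \<le> P n ^ 2 / (pi * t)" "M n \<ge> P n ^ 2 / (pi * t) - 1" by linarith+
  qed
  have Pinf: "filterlim P at_top sequentially"
    unfolding P_def p_def by real_asymp
  have invP: "(\<lambda>n. inverse (P n)) \<longlonglongrightarrow> 0"
    by (rule tendsto_inverse_0_at_top[OF Pinf])
  have MP: "(\<lambda>n. M n / P n ^ 2) \<longlonglongrightarrow> 1 / (pi * t)"
  proof (rule tendsto_sandwich)
    show "(\<lambda>n. 1 / (pi * t) - inverse (P n) ^ 2) \<longlonglongrightarrow> 1 / (pi * t)"
      using tendsto_diff[OF tendsto_const[of "1 / (pi * t)"] tendsto_power[OF invP, of 2]] by simp
    show "\<forall>\<^sub>F n in sequentially. 1 / (pi * t) - inverse (P n) ^ 2 \<le> M n / P n ^ 2"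
    proof (rule always_eventually, rule allI)
      fix n
      have "(P n ^ 2 / (pi * t) - 1) / P n ^ 2 \<le> M n / P n ^ 2"
        by (intro divide_right_mono M_ge) simp
      moreover have "(P n ^ 2 / (pi * t) - 1) / P n ^ 2 = 1 / (pi * t) - inverse (P n) ^ 2"
        using P[of n] by (simp add: diff_divide_distrib power_divide inverse_eq_divide)
      ultimately show "1 / (pi * t) - inverse (P n) ^ 2 \<le> M n / P n ^ 2" by simp
    qed
    show "\<forall>\<^sub>F n in sequentially. M n / P n ^ 2 \<le> 1 / (pi * t)"
    proof (rule always_eventually, rule allI)
      fix n
      have "M n / P n ^ 2 \<le> (P n ^ 2 / (pi * t)) / P n ^ 2"
        by (intro divide_right_mono M_le) simp
      then show "M n / P n ^ 2 \<le> 1 / (pi * t)" using P[of n] by simp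
    qed
  qed simp
  have P2inf: "filterlim (\<lambda>n. P n ^ 2 / (pi * t) - 1) at_top sequentially"
    unfolding P_def p_def using t by real_asymp
  have Minf: "filterlim M at_top sequentially"
    by (rule filterlim_at_top_mono[OF P2inf always_eventually[OF allI[OF M_ge]]])
  have minf: "filterlim m at_top sequentially"
    unfolding filterlim_at_top
  proof
    fix Z
    show "eventually (\<lambda>n. Z \<le> m n) sequentially"
      using Minf[unfolded filterlim_at_top, rule_format, of "real Z"] by (simp add: M_def)
  qed
  have mev: "eventually (\<lambda>n. m n > K) sequentially" for K
    using minf[unfolded filterlim_at_top, rule_format, of "Suc K"] by (simp add: Suc_le_eq)
  define c :: "nat \<Rightarrow> real" where "c v = (if v = 0 then 1 else 2) * (-1) ^ v" for v
  have cb: "\<bar>c v\<bar> \<le> (2 :: real)" for v by (simp add: c_def abs_mult)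

  have lim1: "(\<lambda>n. c v * central_ratio (m n) (v * p n)) \<longlonglongrightarrow> c v * exp (- pi * t * real v ^ 2)" for v
  proof (intro tendsto_mult tendsto_const)
    have lim: "(\<lambda>n. - (real v ^ 2 / (M n / P n ^ 2 + s * (real v * inverse (P n))))) \<longlonglongrightarrow> - (real v ^ 2 / (1 / (pi * t) + s * (real v * 0)))" for s
      using t by (intro tendsto_intros MP invP) auto
    have conv: "- real ((v * p n) ^ 2) / (M n + s * real (v * p n)) = - (real v ^ 2 / (M n / P n ^ 2 + s * (real v * inverse (P n))))" for n s
    proof -
      have "M n / P n ^ 2 + s * (real v * inverse (P n)) = (M n + s * real (v * p n)) / P n ^ 2"
        using P[of n] by (simp add: field_simps power2_eq_square P_def)
      then show ?thesis using P[of n] by (simp add: power_mult_distrib P_def)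
    qed
    have small: "eventually (\<lambda>n. v * p n < m n) sequentially"
    proof -
      have "(\<lambda>n. M n / P n ^ 2 - real v * inverse (P n)) \<longlonglongrightarrow> 1 / (pi * t) - real v * 0"
        by (intro tendsto_intros MP invP)
      then have "eventually (\<lambda>n. M n / P n ^ 2 - real v * inverse (P n) > 0) sequentially"
        by (rule order_tendstoD) (use t in simp)
      then show ?thesis
      proof eventually_elim
        case (elim n)
        then have "0 < (M n / P n ^ 2 - real v * inverse (P n)) * P n ^ 2" using P[of n] by (intro mult_pos_pos) auto
        also have "\<dots> = M n - real v * P n" using P[of n] by (simp add: field_simps power2_eq_square)
        finally have "real (v * p n) < real (m n)" by (simp add: M_def P_def)
        then show ?case by (simp only: of_nat_less_iff)
      qed
    qed
    show "(\<lambda>n. central_ratio (m n) (v * p n)) \<longlonglongrightarrow> exp (- pi * t * real v ^ 2)"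
    proof (rule tendsto_sandwich)
      show "\<forall>\<^sub>F n in sequentially. exp (- real ((v * p n) ^ 2) / (M n + (-1) * real (v * p n))) \<le> central_ratio (m n) (v * p n)"
        using small
      proof eventually_elim
        case (elim n)
        then show ?case using central_ratio_lower[of "v * p n" "v * p n" "m n"] by (simp add: M_def)
      qed
      show "\<forall>\<^sub>F n in sequentially. central_ratio (m n) (v * p n) \<le> exp (- real ((v * p n) ^ 2) / (M n + 1 * real (v * p n)))"
        using small
      proof eventually_elim
        case (elim n)
        then show ?case using central_ratio_upper[of "v * p n" "v * p n" "m n"] by (simp add: M_def)
      qed
      show "(\<lambda>n. exp (- real ((v * p n) ^ 2) / (M n + (-1) * real (v * p n)))) \<longlonglongrightarrow> exp (- pi * t * real v ^ 2)"
        unfolding conv using tendsto_exp[OF lim[of "-1"]] by (simp add: mult.commute mult.left_commute)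
      show "(\<lambda>n. exp (- real ((v * p n) ^ 2) / (M n + 1 * real (v * p n)))) \<longlonglongrightarrow> exp (- pi * t * real v ^ 2)"
        unfolding conv using tendsto_exp[OF lim[of "1"]] by (simp add: mult.commute mult.left_commute)
    qed
  qed
  \<comment> \<open>With \<open>K = m n\<close> the denominator is at most 2 m, which halves the
    exponent; v \<le> v^2 turns the Gaussian into a geometric majorant. For v p > m the ratio
    vanishes.\<close>
  have bound1: "norm (c v * central_ratio (m n) (v * p n)) \<le> 2 * exp (- (pi * t / 2)) ^ v" if "m n > 0" for v n
  proof -
    have "central_ratio (m n) (v * p n) \<le> exp (- (pi * t / 2)) ^ v"
    proof (cases "v * p n \<le> m n")
      case True
      have "real v \<le> real v ^ 2" by (cases v) (auto simp: power2_eq_square)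
      have "M n > 0" using that by (simp add: M_def)
      have "pi * t / 2 * real v * (2 * M n) \<le> real v ^ 2 * (pi * t * M n)"
        using \<open>real v \<le> _\<close> t \<open>M n > 0\<close> by (simp add: mult_right_mono)
      also have "\<dots> \<le> real v ^ 2 * P n ^ 2"
        using M_le[of n] t by (intro mult_left_mono) (auto simp: field_simps)
      finally have "pi * t / 2 * real v \<le> real ((v * p n) ^ 2) / (M n + M n)"
        using \<open>M n > 0\<close> by (simp add: pos_le_divide_eq P_def power_mult_distrib)
      then have "exp (- real ((v * p n) ^ 2) / (real (m n) + real (m n))) \<le> exp (real v * (- (pi * t / 2)))"
        by (simp add: M_def mult.commute)
      with central_ratio_upper[OF True order_refl that] show ?thesis
        by (simp only: exp_of_nat_mult)
    qed (simp add: central_ratio_eq_0)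
    then show ?thesis using cb[of v] central_ratio_nonneg[of "m n" "v * p n"]
      by (simp add: abs_mult mult_mono)
  qed
  have "(\<lambda>n. \<Sum>v. c v * central_ratio (m n) (v * p n)) \<longlonglongrightarrow> (\<Sum>v. c v * exp (- pi * t * real v ^ 2))"
  proof (rule tannerys_theorem[THEN conjunct2, THEN conjunct2])
    show "\<forall>\<^sub>F (v, n) in sequentially \<times>\<^sub>F sequentially. norm (c v * central_ratio (m n) (v * p n)) \<le> 2 * exp (- (pi * t / 2)) ^ v"
      unfolding case_prod_beta
      by (rule eventually_prodI[OF eventually_True mev[of 0], THEN eventually_mono]) (erule conjE, rule bound1)
    show "summable (\<lambda>v. 2 * exp (- (pi * t / 2)) ^ v)"
      using t by (intro summable_mult summable_geometric) auto
  qed (use lim1 in auto)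
  moreover
  \<comment> \<open>Padded with zeros to a full series, so that Tannery's theorem applies although
    the number of summands grows.\<close>
  define d where "d l n = (if l < Suc n then cos (pi * (2 * real l + 1) / (2 * P n)) ^ (2 * m n) else 0)" for l n
  have ssum: "(\<Sum>v. c v * central_ratio (m n) (v * p n)) =
     (4 ^ m n / (real (2 * m n choose m n) * sqrt (pi * M n))) * (2 * (sqrt (pi * M n) / P n)) * (\<Sum>l. d l n)" if "m n > 0" for n
  proof -
    let ?C = "real (2 * m n choose m n)"
    have C: "?C > 0" by simp
    have "(\<lambda>v. (c v * real (2 * m n choose (m n + v * p n))) / ?C) sums
      (1 / real (p n) * (\<Sum>l<p n. (2 * cos (pi * (2 * real l + 1) / (2 * real (p n)))) ^ (2 * m n)) / ?C)"
      unfolding c_def by (intro sums_divide polya_identity P)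
    then have "(\<Sum>v. c v * central_ratio (m n) (v * p n)) = 1 / P n * (\<Sum>l<p n. (2 * cos (pi * (2 * real l + 1) / (2 * P n))) ^ (2 * m n)) / ?C"
      unfolding P_def by (simp add: sums_iff central_ratio_def)
    also have "(\<Sum>l<p n. (2 * cos (pi * (2 * real l + 1) / (2 * P n))) ^ (2 * m n)) =
       4 ^ m n * (\<Sum>l<p n. cos (pi * (2 * real l + 1) / (2 * P n)) ^ (2 * m n))"
      unfolding power_mult_distrib sum_distrib_left by (simp add: power_mult)
    also have "(\<Sum>l<p n. cos (pi * (2 * real l + 1) / (2 * P n)) ^ (2 * m n)) = 2 * (\<Sum>l<Suc n. cos (pi * (2 * real l + 1) / (2 * P n)) ^ (2 * m n))"
    proof -
      let ?f = "\<lambda>l. cos (pi * (2 * real l + 1) / (2 * P n)) ^ (2 * m n)"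
      \<comment> \<open>Replacing l by p - 1 - l reflects the angle at pi / 2 and changes only the
        sign of the cosine, which the even exponent removes.\<close>
      have mirror: "?f (p n - Suc l) = ?f l" if "l < p n" for l
      proof -
        have r: "real (p n - Suc l) = P n - (real l + 1)" using that by (simp add: P_def of_nat_diff)
        then have "pi * (2 * real (p n - Suc l) + 1) / (2 * P n) = pi - pi * (2 * real l + 1) / (2 * P n)"
          unfolding r using P[of n] by (simp add: field_simps)
        then have "cos (pi * (2 * real (p n - Suc l) + 1) / (2 * P n)) = - cos (pi * (2 * real l + 1) / (2 * P n))"
          by (simp only: cos_pi_minus)
        then show ?thesis by simp
      qed
      have "{..<p n} = {..<Suc n} \<union> (\<lambda>l. p n - Suc l) ` {..<Suc n}"
      proof (intro equalityI subsetI)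
        fix l assume l: "l \<in> {..<p n}"
        show "l \<in> {..<Suc n} \<union> (\<lambda>l. p n - Suc l) ` {..<Suc n}"
        proof (cases "l < Suc n")
          case False
          with l have "l = p n - Suc (p n - Suc l)" "p n - Suc l \<in> {..<Suc n}" by (auto simp: p_def)
          then show ?thesis by blast
        qed auto
      qed (auto simp: p_def)
      then have "(\<Sum>l<p n. ?f l) = (\<Sum>l<Suc n. ?f l) + (\<Sum>l\<in>(\<lambda>l. p n - Suc l) ` {..<Suc n}. ?f l)"
        by (simp only:) (subst sum.union_disjoint, auto simp: p_def)
      also have "(\<Sum>l\<in>(\<lambda>l. p n - Suc l) ` {..<Suc n}. ?f l) = (\<Sum>l<Suc n. ?f (p n - Suc l))"
        by (rule sum.reindex[unfolded o_def]) (auto simp: inj_on_def p_def)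
      also have "\<dots> = (\<Sum>l<Suc n. ?f l)"
        by (intro sum.cong refl mirror) (auto simp: p_def)
      finally show ?thesis by simp
    qed
    also have "(\<Sum>l<Suc n. cos (pi * (2 * real l + 1) / (2 * P n)) ^ (2 * m n)) = (\<Sum>l. d l n)"
    proof -
      have "(\<Sum>l. d l n) = (\<Sum>l<Suc n. d l n)" by (rule suminf_finite) (auto simp: d_def)
      then show ?thesis by (simp add: d_def)
    qed
    also have "1 / P n * (4 ^ m n * (2 * (\<Sum>l. d l n))) / ?C =
      (4 ^ m n / (?C * sqrt (pi * M n))) * (2 * (sqrt (pi * M n) / P n)) * (\<Sum>l. d l n)"
      using that P[of n] C by (simp add: M_def mult_ac)
    finally show ?thesis .
  qed
  have lim2: "(\<lambda>n. d l n) \<longlonglongrightarrow> exp (- pi * (real l + 1 / 2) ^ 2 / t)" for l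
  proof -
    define a where "a = pi * (2 * real l + 1) / 2"
    have a: "a > 0" by (simp add: a_def add_nonneg_pos)
    have L: "(\<lambda>n. P n ^ 2 * ln (cos (a / P n))) \<longlonglongrightarrow> - (a ^ 2) / 2"
    proof -
      have "((\<lambda>x::real. x ^ 2 * ln (cos (a / x))) \<longlongrightarrow> - (a * a / 2)) at_top"
        using a by real_asymp
      then have "(\<lambda>n. P n ^ 2 * ln (cos (a / P n))) \<longlonglongrightarrow> - (a * a / 2)"
        by (rule filterlim_compose[OF _ Pinf])
      then show ?thesis by (simp add: power2_eq_square)
    qed
    have A: "(\<lambda>n. M n / P n ^ 2 * (2 * (P n ^ 2 * ln (cos (a / P n))))) \<longlonglongrightarrow> 1 / (pi * t) * (2 * (- (a ^ 2) / 2))"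
      by (rule tendsto_mult[OF MP tendsto_mult[OF tendsto_const L]])
    have e: "1 / (pi * t) * (2 * (- (a ^ 2) / 2)) = - pi * (real l + 1 / 2) ^ 2 / t"
      using t by (simp add: a_def field_simps power2_eq_square)
    have "(\<lambda>n. exp (M n / P n ^ 2 * (2 * (P n ^ 2 * ln (cos (a / P n)))))) \<longlonglongrightarrow> exp (- pi * (real l + 1 / 2) ^ 2 / t)"
      using tendsto_exp[OF A] unfolding e .
    then show ?thesis
    proof (rule Lim_transform_eventually)
      have "((\<lambda>x::real. cos (a / x)) \<longlongrightarrow> 1) at_top" by real_asymp
      then have "(\<lambda>n. cos (a / P n)) \<longlonglongrightarrow> 1" by (rule filterlim_compose[OF _ Pinf])
      then have "eventually (\<lambda>n. cos (a / P n) > 0) sequentially" by (rule order_tendstoD) simp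
      then show "\<forall>\<^sub>F n in sequentially. exp (M n / P n ^ 2 * (2 * (P n ^ 2 * ln (cos (a / P n))))) = d l n"
        using eventually_gt_at_top[of l]
      proof eventually_elim
        case (elim n)
        have "M n / P n ^ 2 * (2 * (P n ^ 2 * ln (cos (a / P n)))) = real (2 * m n) * ln (cos (a / P n))"
          using P[of n] by (simp add: M_def)
        moreover have "a / P n = pi * (2 * real l + 1) / (2 * P n)" by (simp add: a_def)
        ultimately show ?case using elim by (simp only: exp_of_nat_mult exp_ln d_def if_True less_SucI)
      qed
    qed
  qed
  \<comment> \<open>Half of the limit of M / P^2 is a lower bound from some point on; this makes the
    majorant in \<open>bound2\<close> independent of n.\<close>
  have ev2: "eventually (\<lambda>n. M n / P n ^ 2 \<ge> 1 / (2 * (pi * t))) sequentially"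
  proof -
    have "1 / (2 * (pi * t)) < 1 / (pi * t)" using t by (simp add: divide_strict_left_mono)
    from order_tendstoD(1)[OF MP this] show ?thesis by (rule eventually_mono) simp
  qed
  have bound2: "norm (d l n) \<le> exp (- (pi / (2 * t))) ^ l" if "M n / P n ^ 2 \<ge> 1 / (2 * (pi * t))" for l n
  proof (cases "l < Suc n")
    case True
    define x where "x = pi * (2 * real l + 1) / (2 * P n)"
    have "2 * real l + 1 \<le> P n" using True by (simp add: P_def p_def)
    then have "x \<le> pi * P n / (2 * P n)"
      unfolding x_def using P[of n] by (intro divide_right_mono mult_left_mono) auto
    then have x: "0 \<le> x" "x \<le> pi / 2" using P[of n] by (auto simp: x_def)
    then have "cos x \<ge> 0" by (intro cos_ge_zero) auto
    have "norm (d l n) = cos x ^ (2 * m n)" using True by (simp add: d_def x_def)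
    also have "\<dots> \<le> exp (- (x ^ 2 / 2)) ^ (2 * m n)"
      using \<open>cos x \<ge> 0\<close> cos_le_exp[OF x] by (intro power_mono)
    also have "\<dots> = exp (- (M n * x ^ 2))"
      unfolding exp_of_nat_mult[symmetric] by (simp add: M_def)
    also have "M n * x ^ 2 = M n / P n ^ 2 * (pi ^ 2 * (2 * real l + 1) ^ 2 / 4)"
      using P[of n] by (simp add: x_def power_divide power_mult_distrib)
    also have "exp (- \<dots>) \<le> exp (- (1 / (2 * (pi * t)) * (pi ^ 2 * (4 * real l) / 4)))"
    proof -
      have "1 / (2 * (pi * t)) * (pi ^ 2 * (4 * real l) / 4) \<le> M n / P n ^ 2 * (pi ^ 2 * (2 * real l + 1) ^ 2 / 4)"
      proof (intro mult_mono divide_right_mono mult_left_mono that)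
        show "4 * real l \<le> (2 * real l + 1) ^ 2" by (simp add: power2_eq_square algebra_simps)
        show "0 \<le> M n / P n ^ 2" by (simp add: M_def)
      qed auto
      then show ?thesis by simp
    qed
    also have "1 / (2 * (pi * t)) * (pi ^ 2 * (4 * real l) / 4) = real l * (pi / (2 * t))"
      by (simp add: power2_eq_square)
    also have "exp (- (real l * (pi / (2 * t)))) = exp (- (pi / (2 * t))) ^ l"
      by (simp only: mult_minus_right[symmetric] exp_of_nat_mult)
    finally show ?thesis .
  qed (simp add: d_def)
  have tan2: "(\<lambda>n. \<Sum>l. d l n) \<longlonglongrightarrow> (\<Sum>l. exp (- pi * (real l + 1 / 2) ^ 2 / t))"
  proof (rule tannerys_theorem[THEN conjunct2, THEN conjunct2])
    show "\<forall>\<^sub>F (l, n) in sequentially \<times>\<^sub>F sequentially. norm (d l n) \<le> exp (- (pi / (2 * t))) ^ l"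
      unfolding case_prod_beta
      by (rule eventually_prodI[OF eventually_True ev2, THEN eventually_mono]) (erule conjE, rule bound2)
    show "summable (\<lambda>l. exp (- (pi / (2 * t))) ^ l)"
      using t by (intro summable_geometric) auto
  qed (use lim2 in auto)
  have sq: "(\<lambda>n. sqrt (pi * M n) / P n) \<longlonglongrightarrow> 1 / sqrt t"
  proof -
    have "(\<lambda>n. sqrt (pi * (M n / P n ^ 2))) \<longlonglongrightarrow> sqrt (pi * (1 / (pi * t)))"
      by (intro tendsto_intros MP)
    moreover have "sqrt (pi * (M n / P n ^ 2)) = sqrt (pi * M n) / P n" for n
      using P[of n] by (simp add: real_sqrt_mult real_sqrt_divide abs_of_pos)
    ultimately show ?thesis using t by (simp only:) (simp add: real_sqrt_divide)
  qed
  have "(\<lambda>n. (4 ^ m n / (real (2 * m n choose m n) * sqrt (pi * M n))) * (2 * (sqrt (pi * M n) / P n)) * (\<Sum>l. d l n))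
     \<longlonglongrightarrow> 1 * (2 * (1 / sqrt t)) * (\<Sum>l. exp (- pi * (real l + 1 / 2) ^ 2 / t))"
    unfolding M_def
    by (intro tendsto_mult tendsto_const tan2 sq[unfolded M_def] filterlim_compose[OF central_binomial_limit minf])
  then have "(\<lambda>n. \<Sum>v. c v * central_ratio (m n) (v * p n)) \<longlonglongrightarrow> 1 * (2 * (1 / sqrt t)) * (\<Sum>l. exp (- pi * (real l + 1 / 2) ^ 2 / t))"
    by (rule Lim_transform_eventually) (use mev[of 0] in \<open>eventually_elim, simp add: ssum\<close>)
  ultimately have eq: "(\<Sum>v. c v * exp (- pi * t * real v ^ 2)) = 2 / sqrt t * (\<Sum>l. exp (- pi * (real l + 1 / 2) ^ 2 / t))"
    using LIMSEQ_unique by fastforce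
  have q: "norm (complex_of_real (exp (- pi * t))) < 1" using t by simp
  have cs: "(\<lambda>v. complex_of_real (c v * exp (- pi * t * real v ^ 2))) sums theta4 (of_real (exp (- pi * t)))"
  proof -
    have "complex_of_real (c v * exp (- pi * t * real v ^ 2)) =
       (if v = 0 then 1 else 2 * (-1) ^ v * complex_of_real (exp (- pi * t)) ^ (v ^ 2))" for v
    proof -
      have "exp (- pi * t * real v ^ 2) = exp (- pi * t) ^ (v ^ 2)"
        unfolding exp_of_nat_mult[symmetric] by (simp add: algebra_simps)
      then show ?thesis by (simp add: c_def)
    qed
    then show ?thesis using theta4_sums_squares[OF q] by simp
  qed
  then have "theta4 (of_real (exp (- pi * t))) = (\<Sum>v. complex_of_real (c v * exp (- pi * t * real v ^ 2)))"
    by (simp add: sums_iff)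
  also have "\<dots> = complex_of_real (\<Sum>v. c v * exp (- pi * t * real v ^ 2))"
    using summable_Re[OF sums_summable[OF cs]] by (intro suminf_of_real[symmetric]) simp
  finally show ?thesis unfolding eq .
qed

section \<open>Continuation of the transformation to the right half plane\<close>

lemma theta4_holomorphic: "theta4 holomorphic_on ball 0 1"
proof -
  define A where "A = Abs_fps (\<lambda>n. of_int (theta4_coeff n) :: complex)"
  have "fps_conv_radius A \<ge> 1"
    unfolding fps_conv_radius_def A_def by (rule conv_radius_ge_1) (simp add: theta4_summable)
  then have "eval_fps A holomorphic_on ball 0 1"
    by (intro holomorphic_on_eval_fps) (simp add: ball_eball_mono one_ereal_def)
  then show ?thesis by (simp add: eval_fps_def[abs_def] A_def theta4_def[abs_def])
qed

text \<open>Since (l + 1/2)^2 = l (l + 1) + 1/4, the dual theta series is exp (-x/4) times this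
  series at w = exp (-2 x). The exponents grow, so for small w it is 1 + O(w).\<close>

definition triangular_series :: "complex \<Rightarrow> complex" where
  "triangular_series w = (\<Sum>k. w ^ (k * (k + 1) div 2))"

lemma strict_mono_triangular: "strict_mono (\<lambda>k::nat. k * (k + 1) div 2)"
  unfolding strict_mono_Suc_iff by auto

lemma triangular_ge: "k \<le> k * (k + 1) div (2 :: nat)"
  by (rule strict_mono_imp_increasing[OF strict_mono_triangular])

lemma triangular_summable:
  fixes w :: complex
  assumes "norm w < 1"
  shows "summable (\<lambda>k. w ^ (k * (k + 1) div 2))"
proof (rule summable_comparison_test')
  show "summable (\<lambda>k. norm w ^ k)" using assms by simp
  show "norm (w ^ (k * (k + 1) div 2)) \<le> norm w ^ k" for k
    unfolding norm_power by (rule power_decreasing) (use assms triangular_ge in auto)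
qed

lemma triangular_series_holomorphic: "triangular_series holomorphic_on ball 0 1"
proof -
  define t :: "nat \<Rightarrow> complex" where "t n = (if n \<in> range (\<lambda>k. k * (k + 1) div 2) then 1 else 0)" for n
  have sums: "(\<lambda>n. t n * z ^ n) sums triangular_series z" if "norm z < 1" for z
  proof -
    have "(\<lambda>k. t (k * (k + 1) div 2) * z ^ (k * (k + 1) div 2)) sums triangular_series z"
      using summable_sums[OF triangular_summable[OF that]] by (simp add: t_def triangular_series_def)
    then show ?thesis
      by (subst (asm) sums_mono_reindex[OF strict_mono_triangular]) (auto simp: t_def)
  qed
  have "fps_conv_radius (Abs_fps t) \<ge> 1"
    unfolding fps_conv_radius_def
    by (rule conv_radius_ge_1) (use sums in \<open>simp add: sums_iff\<close>)
  then have "eval_fps (Abs_fps t) holomorphic_on ball 0 1"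
    by (intro holomorphic_on_eval_fps) (simp add: ball_eball_mono one_ereal_def)
  then show ?thesis
    by (rule holomorphic_transform) (use sums in \<open>auto simp: eval_fps_def sums_iff\<close>)
qed

lemma triangular_series_near_1:
  fixes w :: complex
  assumes "norm w < 1"
  shows "norm (triangular_series w - 1) \<le> norm w / (1 - norm w)"
proof -
  have s: "summable (\<lambda>k. w ^ (k * (k + 1) div 2))" by (rule triangular_summable[OF assms])
  have g: "summable (\<lambda>k. norm w ^ Suc k)" using assms by (simp add: summable_mult)
  have "triangular_series w = 1 + (\<Sum>k. w ^ (Suc k * (Suc k + 1) div 2))"
    unfolding triangular_series_def using suminf_split_head[OF s] by simp
  then have "norm (triangular_series w - 1) = norm (\<Sum>k. w ^ (Suc k * (Suc k + 1) div 2))" by simp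
  also have "\<dots> \<le> (\<Sum>k. norm w ^ Suc k)"
  proof (rule norm_suminf_le[OF _ g])
    show "norm (w ^ (Suc k * (Suc k + 1) div 2)) \<le> norm w ^ Suc k" for k
      unfolding norm_power by (rule power_decreasing) (use assms triangular_ge[of "Suc k"] in auto)
  qed
  also have "\<dots> = norm w / (1 - norm w)"
    using assms by (simp add: suminf_mult suminf_geometric)
  finally show ?thesis .
qed

text \<open>For q = exp (-s) the variable is x = pi^2 / s, in which the dominant factor of the
  reciprocal is exp (x / 4). Both sides are holomorphic for Re x > 0 and agree on the positive reals
  by the real transformation with t = pi / x.\<close>

lemma theta4_transform:
  fixes x :: complex
  assumes x: "Re x > 0"
  shows "theta4 (exp (- complex_of_real (pi ^ 2) / x)) = 2 * csqrt x / complex_of_real (sqrt pi) * exp (- x / 4) * triangular_series (exp (- 2 * x))"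
proof -
  define S where "S = {z. Re z > 0}"
  define f where "f z = theta4 (exp (- complex_of_real (pi ^ 2) / z)) - 2 * csqrt z / complex_of_real (sqrt pi) * exp (- z / 4) * triangular_series (exp (- 2 * z))" for z
  have nz: "z \<noteq> 0" if "z \<in> S" for z using that by (auto simp: S_def)
  have Re_inv: "Re (- complex_of_real (pi ^ 2) / z) < 0" if "z \<in> S" for z
  proof -
    have "Re (- complex_of_real (pi ^ 2) / z) = - (pi ^ 2 * Re z / (cmod z) ^ 2)"
      by (simp add: Re_divide cmod_power2)
    also have "\<dots> < 0" using that nz[OF that] by (simp add: S_def)
    finally show ?thesis by simp
  qed
  have hol: "f holomorphic_on S"
  proof -
    have 1: "(\<lambda>z. exp (- complex_of_real (pi ^ 2) / z)) holomorphic_on S" 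
      by (intro holomorphic_intros nz)
    have 2: "(\<lambda>z. exp (- complex_of_real (pi ^ 2) / z)) ` S \<subseteq> ball 0 1"
      using Re_inv by (auto simp: dist_norm)
    have 3: "(\<lambda>z. exp (- 2 * z)) ` S \<subseteq> ball 0 1"
      by (auto simp: dist_norm S_def)
    have 4: "(\<lambda>z. theta4 (exp (- complex_of_real (pi ^ 2) / z))) holomorphic_on S"
      using holomorphic_on_compose_gen[OF 1 theta4_holomorphic 2] by (simp add: o_def)
    have "(\<lambda>z. exp (- 2 * z)) holomorphic_on S" by (intro holomorphic_intros)
    then have 5: "(\<lambda>z. triangular_series (exp (- 2 * z))) holomorphic_on S"
      using holomorphic_on_compose_gen[OF _ triangular_series_holomorphic 3] by (simp add: o_def)
    have 6: "csqrt holomorphic_on S"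
      by (rule holomorphic_on_subset[OF holomorphic_on_csqrt]) (auto simp: S_def complex_nonpos_Reals_iff)
    show ?thesis unfolding f_def
      by (intro holomorphic_intros 4 5 6) auto
  qed
  have "f x = 0"
  proof (rule analytic_continuation[OF hol])
    show "open S" unfolding S_def by (rule open_halfspace_Re_gt)
    show "connected S" unfolding S_def by (intro convex_connected convex_halfspace_Re_gt)
    show "of_real ` {0<..} \<subseteq> S" "1 \<in> S" "x \<in> S" using x by (auto simp: S_def)
    show "(1::complex) islimpt (of_real ` {0<..})"
      unfolding islimpt_approachable
    proof (intro allI impI)
      fix e :: real assume "e > 0"
      then show "\<exists>x'\<in>complex_of_real ` {0<..}. x' \<noteq> 1 \<and> dist x' 1 < e"
      proof (intro bexI conjI)
        have "complex_of_real (1 + e / 2) \<noteq> complex_of_real 1"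
          using \<open>e > 0\<close> by (subst of_real_eq_iff) simp
        then show "complex_of_real (1 + e / 2) \<noteq> 1" unfolding of_real_1 .
        have "dist (complex_of_real (1 + e / 2)) (complex_of_real 1) < e"
          using \<open>e > 0\<close> by (subst dist_of_real) (simp add: dist_norm)
        then show "dist (complex_of_real (1 + e / 2)) 1 < e" unfolding of_real_1 .
        show "complex_of_real (1 + e / 2) \<in> complex_of_real ` {0<..}"
          using \<open>e > 0\<close> by (intro imageI) simp
      qed
    qed
    fix z :: complex assume "z \<in> of_real ` {0<..}"
    then obtain y where y: "z = of_real y" "y > 0" by auto
    have T1: "theta4 (of_real (exp (- pi * (pi / y)))) = of_real (2 / sqrt (pi / y) * (\<Sum>l. exp (- pi * (real l + 1 / 2) ^ 2 / (pi / y))))"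
      by (rule theta4_real_transform) (use y in simp)
    have T2: "complex_of_real (exp (- pi * (pi / y))) = exp (- complex_of_real (pi ^ 2) / z)"
      unfolding y(1) exp_of_real[symmetric] by (simp add: power2_eq_square)
    have T3: "complex_of_real (\<Sum>l. exp (- pi * (real l + 1 / 2) ^ 2 / (pi / y))) = exp (- z / 4) * triangular_series (exp (- 2 * z))"
    proof -
      have w: "norm (exp (- 2 * z)) < 1" using y by simp
      have sums: "(\<lambda>l. exp (- z / 4) * exp (- 2 * z) ^ (l * (l + 1) div 2)) sums (exp (- z / 4) * triangular_series (exp (- 2 * z)))"
        unfolding triangular_series_def by (intro sums_mult summable_sums triangular_summable w)
      have summand: "exp (- z / 4) * exp (- 2 * z) ^ (l * (l + 1) div 2) = of_real (exp (- pi * (real l + 1 / 2) ^ 2 / (pi / y)))" for l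
      proof -
        have "real (l * (l + 1) div 2) = real l * (real l + 1) / 2"
        proof -
          have "2 * (l * (l + 1) div 2) = l * (l + 1)" by simp
          then have "real (2 * (l * (l + 1) div 2)) = real (l * (l + 1))" by (rule arg_cong)
          then have "2 * real (l * (l + 1) div 2) = real l * (real l + 1)"
            by (simp only: of_nat_mult of_nat_add of_nat_1 of_nat_numeral)
          then show ?thesis by linarith
        qed
        then have "- y / 4 + real (l * (l + 1) div 2) * (- 2 * y) = - pi * (real l + 1 / 2) ^ 2 / (pi / y)"
          using y by (simp add: power2_eq_square field_simps)
        then have "exp (- pi * (real l + 1 / 2) ^ 2 / (pi / y)) = exp (- y / 4) * exp (- 2 * y) ^ (l * (l + 1) div 2)"
          by (simp only: exp_add[symmetric] exp_of_nat_mult[symmetric])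
        moreover have "exp (- z / 4) = complex_of_real (exp (- y / 4))" "exp (- 2 * z) = complex_of_real (exp (- 2 * y))"
          by (simp_all add: y(1) exp_of_real[symmetric])
        ultimately show ?thesis by (simp only: of_real_mult of_real_power)
      qed
      have sums': "(\<lambda>l. complex_of_real (exp (- pi * (real l + 1 / 2) ^ 2 / (pi / y)))) sums (exp (- z / 4) * triangular_series (exp (- 2 * z)))"
        using sums unfolding summand .
      have "summable (\<lambda>l. exp (- pi * (real l + 1 / 2) ^ 2 / (pi / y)))"
        using summable_Re[OF sums_summable[OF sums']] by simp
      then show ?thesis using sums' by (simp add: suminf_of_real sums_iff)
    qed
    have T4: "complex_of_real (2 / sqrt (pi / y)) = 2 * csqrt z / complex_of_real (sqrt pi)"
      using y by (simp add: real_sqrt_divide csqrt_of_real_nonneg)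
    show "f z = 0" unfolding f_def T2[symmetric] T1 of_real_mult T3 T4 by simp
  qed
  then show ?thesis by (simp add: f_def)
qed

section \<open>Main terms\<close>

text \<open>Taylor coefficients in w^2 of exp (w^2 / 4) / w times the integral of exp (- t^2 / 4)
  from 0 to w, a relative of Dawson's function.\<close>

definition dawson_coef :: "nat \<Rightarrow> real" where
  "dawson_coef k = fact k / fact (2 * k + 1)"

lemma dawson_coef_Suc: "dawson_coef (Suc k) = dawson_coef k / (2 * (2 * real k + 3))"
proof -
  have "fact (2 * Suc k + 1) = (2 * real k + 3) * (2 * real k + 2) * fact (2 * k + 1)"
    by (simp add: algebra_simps)
  then have "dawson_coef (Suc k) = ((real k + 1) * fact k) / ((2 * real k + 3) * (2 * (real k + 1)) * fact (2 * k + 1))"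
    by (simp add: dawson_coef_def algebra_simps)
  also have "\<dots> = dawson_coef k / (2 * (2 * real k + 3))"
  proof -
    have "(a * F) / (c * (2 * a) * G) = F / G / (2 * c)" if "a \<noteq> 0" for a F c G :: real
      using that by simp
    moreover have "real k + 1 \<noteq> 0" by linarith
    ultimately show ?thesis by (simp only: dawson_coef_def not_False_eq_True)
  qed
  finally show ?thesis .
qed

lemma dawson_coef_0 [simp]: "dawson_coef 0 = 1" by (simp add: dawson_coef_def)

lemma dawson_coef_pos: "dawson_coef k > 0" by (simp add: dawson_coef_def)

lemma dawson_coef_le: "dawson_coef k \<le> (1 / 4) ^ k / fact k"
proof (induction k)
  case (Suc k)
  have "dawson_coef (Suc k) \<le> dawson_coef k / (4 * (real k + 1))"
    unfolding dawson_coef_Suc using dawson_coef_pos[of k] by (intro divide_left_mono) auto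
  also have "\<dots> \<le> ((1 / 4) ^ k / fact k) / (4 * (real k + 1))"
    by (intro divide_right_mono Suc) auto
  finally show ?case by (simp add: algebra_simps)
qed simp

lemma dawson_coef_norm_le: "norm (complex_of_real (dawson_coef k) * x ^ k) \<le> (norm x / 4) ^ k / fact k"
  using mult_right_mono[OF dawson_coef_le[of k], of "norm x ^ k"] dawson_coef_pos[of k]
  by (simp add: norm_mult norm_power power_divide)

lemma exp_sums_real: "(\<lambda>k. y ^ k / fact k) sums exp (y :: real)"
  using exp_converges[of y] by (simp add: scaleR_conv_of_real divide_inverse mult.commute)

lemma dawson_coef_summable: "summable (\<lambda>k. complex_of_real (dawson_coef k) * x ^ k)"
  by (rule summable_comparison_test'[OF sums_summable[OF exp_sums_real] dawson_coef_norm_le])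

text \<open>An entire function that differs from \<open>exp (x / 4) * sqrt (\<pi> / x)\<close> only by \<open>O(1 / x)\<close> in the right half plane, so that the principal part of the generating function at \<open>q = 1\<close> becomes a power series in \<open>1 / s\<close>, where \<open>q = exp (- s)\<close>.\<close>

definition dawson_series :: "complex \<Rightarrow> complex" where
  "dawson_series x = (\<Sum>k. complex_of_real (dawson_coef k) * x ^ k)"

text \<open>The coefficient recursion in analytic form: F + 2 x F' = 1 + x F / 2 says exactly that w
  F(w^2) exp (- w^2 / 4) has the derivative exp (- w^2 / 4).\<close>

lemma dawson_series_ode:
  obtains d' where "(dawson_series has_field_derivative d') (at x)" "dawson_series x + 2 * x * d' = 1 + x / 2 * dawson_series x"
proof -
  define A where "A = Abs_fps (\<lambda>k. complex_of_real (dawson_coef k))"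
  have rad: "fps_conv_radius A = \<infinity>"
    unfolding fps_conv_radius_def A_def by (rule conv_radius_inftyI'') (simp add: dawson_coef_summable)
  have rad': "fps_conv_radius (fps_deriv A) = \<infinity>"
    using fps_conv_radius_deriv[of A] rad by simp
  have ev: "eval_fps A = dawson_series"
    by (simp add: fun_eq_iff eval_fps_def dawson_series_def A_def)
  have ode: "A + fps_const 2 * fps_X * fps_deriv A = 1 + fps_const (1/2) * fps_X * A"
  proof (rule fps_ext)
    fix n
    show "fps_nth (A + fps_const 2 * fps_X * fps_deriv A) n = fps_nth (1 + fps_const (1/2) * fps_X * A) n"
    proof (cases n)
      case 0 then show ?thesis by (simp add: A_def mult.assoc)
    next
      case (Suc k)
      have "dawson_coef (Suc k) * (2 * real k + 3) = dawson_coef k / 2"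
      proof -
        have "d / (2 * c) * c = d / 2" if "c \<noteq> 0" for c d :: real using that by simp
        moreover have "2 * real k + 3 \<noteq> 0" by linarith
        ultimately show ?thesis by (simp only: dawson_coef_Suc not_False_eq_True)
      qed
      then have "complex_of_real (dawson_coef (Suc k) * (2 * real k + 3)) = complex_of_real (dawson_coef k / 2)" by (rule arg_cong)
      then have "complex_of_real (dawson_coef (Suc k)) * (2 * of_nat k + 3) = complex_of_real (dawson_coef k) / 2"
        by (simp only: of_real_mult of_real_add of_real_divide of_real_numeral of_real_of_nat_eq)
      then show ?thesis using Suc by (simp add: A_def mult.assoc algebra_simps)
    qed
  qed
  have rad2: "fps_conv_radius (fps_const c * fps_X * B) = \<infinity>" if "fps_conv_radius B = \<infinity>" for c and B :: "complex fps"
  proof -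
    have "\<infinity> \<le> min (fps_conv_radius (fps_const c * fps_X)) (fps_conv_radius B)"
      using that fps_conv_radius_mult[of "fps_const c" "fps_X :: complex fps"] by simp
    also have "\<dots> \<le> fps_conv_radius (fps_const c * fps_X * B)" by (rule fps_conv_radius_mult)
    finally show ?thesis by simp
  qed
  have evm: "eval_fps (fps_const c * fps_X * B) x = c * x * eval_fps B x" if "fps_conv_radius B = \<infinity>" for c and B :: "complex fps"
    using that fps_conv_radius_mult[of "fps_const c" "fps_X :: complex fps"]
    by (subst eval_fps_mult) (auto simp: eval_fps_mult)
  have "eval_fps (A + fps_const 2 * fps_X * fps_deriv A) x = eval_fps (1 + fps_const (1/2) * fps_X * A) x"
    by (simp only: ode)
  then have "eval_fps A x + 2 * x * eval_fps (fps_deriv A) x = 1 + 1 / 2 * x * eval_fps A x"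
    using rad rad' rad2[OF rad] rad2[OF rad'] by (simp add: eval_fps_add evm)
  moreover have "(eval_fps A has_field_derivative eval_fps (fps_deriv A) x) (at x)"
    by (rule has_field_derivative_eval_fps) (simp add: rad)
  ultimately show ?thesis by (intro that[of "eval_fps (fps_deriv A) x"]) (auto simp: ev)
qed

text \<open>Equal to the integral of \<open>exp (- t^2 / 4)\<close> from \<open>0\<close> to \<open>w\<close>.\<close>

definition gauss_int :: "complex \<Rightarrow> complex" where
  "gauss_int w = exp (- (w ^ 2) / 4) * (w * dawson_series (w ^ 2))"

lemma gauss_int_deriv: "(gauss_int has_field_derivative exp (- (w ^ 2) / 4)) (at w)"
proof -
  obtain d' where d': "(dawson_series has_field_derivative d') (at (w ^ 2))"
    "dawson_series (w ^ 2) + 2 * w ^ 2 * d' = 1 + w ^ 2 / 2 * dawson_series (w ^ 2)"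
    by (rule dawson_series_ode)
  have comp: "((\<lambda>w. dawson_series (w ^ 2)) has_field_derivative d' * (2 * w)) (at w)"
    by (rule DERIV_chain2[where f = dawson_series and g = "\<lambda>w. w ^ 2", OF d'(1)]) (auto intro!: derivative_eq_intros)
  have "(gauss_int has_field_derivative (exp (- (w ^ 2) / 4) * (- (2 * w) / 4) * (w * dawson_series (w ^ 2)) +
      exp (- (w ^ 2) / 4) * (dawson_series (w ^ 2) + w * (d' * (2 * w))))) (at w)"
    unfolding gauss_int_def[abs_def]
    by (rule derivative_eq_intros comp refl | simp)+
  moreover have "exp (- (w ^ 2) / 4) * (- (2 * w) / 4) * (w * dawson_series (w ^ 2)) +
      exp (- (w ^ 2) / 4) * (dawson_series (w ^ 2) + w * (d' * (2 * w))) =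
    exp (- (w ^ 2) / 4) * ((dawson_series (w ^ 2) + 2 * w ^ 2 * d') - w ^ 2 / 2 * dawson_series (w ^ 2))"
    by (simp add: algebra_simps power2_eq_square)
  ultimately show ?thesis unfolding d'(2) by simp
qed

lemma gauss_int_real_limit: "((\<lambda>R. gauss_int (of_real R)) \<longlongrightarrow> of_real (sqrt pi)) at_top"
proof -
  define G where "G R = Re (gauss_int (of_real R))" for R
  have real: "gauss_int (of_real R) = of_real (G R)" for R
  proof -
    have s: "summable (\<lambda>k. dawson_coef k * (R ^ 2) ^ k)"
      using summable_Re[OF dawson_coef_summable[of "of_real (R ^ 2)"]] by (simp flip: of_real_power of_real_mult)
    have "dawson_series (of_real (R ^ 2)) = of_real (\<Sum>k. dawson_coef k * (R ^ 2) ^ k)"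
      unfolding dawson_series_def suminf_of_real[OF s] by simp
    then have "gauss_int (of_real R) = of_real (exp (- (R ^ 2) / 4) * (R * (\<Sum>k. dawson_coef k * (R ^ 2) ^ k)))"
      unfolding gauss_int_def by (simp add: exp_of_real[symmetric])
    then show ?thesis by (simp add: G_def)
  qed
  have dG: "(G has_real_derivative exp (- (R ^ 2) / 4)) (at R)" for R
  proof -
    have "((\<lambda>R. gauss_int (of_real R)) has_vector_derivative 1 * exp (- (complex_of_real R ^ 2) / 4)) (at R)"
    proof -
      have "(complex_of_real has_vector_derivative 1) (at R)"
        by (auto intro!: derivative_eq_intros)
      from field_vector_diff_chain_at[OF this gauss_int_deriv] show ?thesis by (simp only: o_def)
    qed
    then have "((\<lambda>R. Re (gauss_int (of_real R))) has_vector_derivative Re (exp (- (complex_of_real R ^ 2) / 4))) (at R)"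
      by (intro bounded_linear.has_vector_derivative[OF bounded_linear_Re]) simp
    moreover have "exp (- (complex_of_real R ^ 2) / 4) = of_real (exp (- (R ^ 2) / 4))"
      by (simp add: exp_of_real[symmetric])
    ultimately show ?thesis
      by (simp add: G_def[abs_def] has_real_derivative_iff_has_vector_derivative)
  qed
  \<comment> \<open>The substitution t = 2 x brings exp (- t^2 / 4) to the standard Gaussian, whose
    half line integral is known.\<close>
  define F where "F x = G (2 * x) / 2" for x
  have dF: "(F has_real_derivative exp (- (x ^ 2))) (at x)" for x
  proof -
    have "((\<lambda>x. G (2 * x)) has_real_derivative exp (- ((2 * x) ^ 2) / 4) * 2) (at x)"
      by (rule DERIV_chain2[OF dG]) (auto intro!: derivative_eq_intros)
    from DERIV_cdivide[OF this, of 2] show ?thesis by (simp add: F_def[abs_def] power_mult_distrib)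
  qed
  have F0: "F 0 = 0" by (simp add: F_def G_def gauss_int_def)
  have "((\<lambda>y. \<integral>x. indicator {..y} x *\<^sub>R (indicator {0..} x *\<^sub>R exp (- (x::real)\<^sup>2)) \<partial>lborel) \<longlongrightarrow> (\<integral>x. indicator {0..} x *\<^sub>R exp (- (x::real)\<^sup>2) \<partial>lborel)) at_top"
  proof -
    have "integrable lborel (\<lambda>x. indicator {0..} x *\<^sub>R exp (- x\<^sup>2) :: real)"
      using gaussian_moment_0 by (simp only: has_bochner_integral_iff)
    from tendsto_integral_at_top[OF sets_lborel this] show ?thesis .
  qed
  also have "(\<integral>x. indicator {0..} x *\<^sub>R exp (- (x::real)\<^sup>2) \<partial>lborel) = sqrt pi / 2"
    using gaussian_moment_0 by (simp add: has_bochner_integral_iff)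
  finally have Flim: "(F \<longlongrightarrow> sqrt pi / 2) at_top"
  proof (rule Lim_transform_eventually)
    show "\<forall>\<^sub>F y in at_top. (\<integral>x. indicator {..y} x *\<^sub>R (indicator {0..} x *\<^sub>R exp (- (x::real)\<^sup>2)) \<partial>lborel) = F y"
      using eventually_ge_at_top[of 0]
    proof eventually_elim
      case (elim y)
      have "(\<integral>x. exp (- (x::real)\<^sup>2) * indicator {0..y} x \<partial>lborel) = F y - F 0"
        by (rule integral_FTC_Icc_real) (use elim dF in \<open>auto intro!: continuous_intros\<close>)
      moreover have "indicator {..y} x *\<^sub>R (indicator {0..} x *\<^sub>R exp (- x\<^sup>2)) = exp (- x\<^sup>2) * indicator {0..y} x" for x :: real
        by (auto simp: indicator_def)
      ultimately show ?case using F0 by (simp only: diff_0_right)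
    qed
  qed
  have "filterlim (\<lambda>R::real. R / 2) at_top at_top" by real_asymp
  from tendsto_mult[OF tendsto_const[of 2] filterlim_compose[OF Flim this]]
  have "((\<lambda>R. 2 * F (R / 2)) \<longlongrightarrow> 2 * (sqrt pi / 2)) at_top" .
  then have "(G \<longlongrightarrow> sqrt pi) at_top" by (simp add: F_def)
  then show ?thesis unfolding real by (rule tendsto_of_real)
qed

text \<open>The ray through sqrt x is compared with the real ray through sqrt (Re x). Along the
  vertical segment \<open>S\<close> from x to Re x the real part is constant, so the derivative in z
  of \<open>gauss_int (csqrt z * R)\<close> is of size R exp (- a R^2 / 4) on all of it, and the two
  limits coincide.\<close>

lemma gauss_int_ray_limit:
  assumes x: "Re x > 0"
  shows "((\<lambda>R. gauss_int (csqrt x * of_real R)) \<longlongrightarrow> of_real (sqrt pi)) at_top"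
proof -
  define a where "a = Re x"
  have a: "a > 0" using x by (simp add: a_def)
  define S where "S = closed_segment x (of_real a)"
  have ReS: "Re z = a" if zS: "z \<in> S" for z
  proof -
    obtain u where "z = (1 - u) *\<^sub>R x + u *\<^sub>R of_real a"
      using zS unfolding S_def closed_segment_def by auto
    then have "Re z = (1 - u) * a + u * a" by (simp add: a_def)
    then show ?thesis by (simp add: algebra_simps)
  qed
  have bound: "norm (gauss_int (csqrt x * of_real R) - gauss_int (csqrt (of_real a) * of_real R)) \<le>
      exp (- a * R ^ 2 / 4) * (R / (2 * sqrt a)) * norm (x - of_real a)" if R: "R > 0" for R
  proof (rule field_differentiable_bound[where S = S and f = "\<lambda>z. gauss_int (csqrt z * of_real R)"
        and f' = "\<lambda>z. exp (- ((csqrt z * of_real R) ^ 2) / 4) * (inverse (2 * csqrt z) * of_real R)"])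
    fix z assume z: "z \<in> S"
    have Rez: "Re z = a" by (rule ReS[OF z])
    then have "z \<notin> \<real>\<^sub>\<le>\<^sub>0" using a by (auto simp: complex_nonpos_Reals_iff)
    then have "(csqrt has_field_derivative inverse (2 * csqrt z)) (at z)"
      by (rule has_field_derivative_csqrt)
    from DERIV_cmult_right[OF this, of "of_real R"]
    have "((\<lambda>z. csqrt z * of_real R) has_field_derivative inverse (2 * csqrt z) * of_real R) (at z)" .
    from DERIV_chain2[OF gauss_int_deriv this]
    show "((\<lambda>z. gauss_int (csqrt z * of_real R)) has_field_derivative
       exp (- ((csqrt z * of_real R) ^ 2) / 4) * (inverse (2 * csqrt z) * of_real R)) (at z within S)"
      by (rule has_field_derivative_at_within)
    have "norm (exp (- ((csqrt z * of_real R) ^ 2) / 4)) = exp (- a * R ^ 2 / 4)"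
      using Rez by (simp add: power_mult_distrib flip: of_real_power)
    moreover have "norm (inverse (2 * csqrt z) * of_real R) \<le> R / (2 * sqrt a)"
    proof -
      have az: "0 < sqrt a" "sqrt a \<le> sqrt (norm z)" using complex_Re_le_cmod[of z] Rez a by simp_all
      have "norm (inverse (2 * csqrt z) * of_real R) = R / (2 * sqrt (norm z))"
        by (simp only: norm_mult norm_inverse norm_of_real norm_numeral abs_of_pos[OF R] norm_csqrt divide_inverse mult.commute[of R])
      also have "\<dots> \<le> R / (2 * sqrt a)"
        using R az by (intro divide_left_mono mult_pos_pos) auto
      finally show ?thesis .
    qed
    ultimately show "norm (exp (- ((csqrt z * of_real R) ^ 2) / 4) * (inverse (2 * csqrt z) * of_real R)) \<le> exp (- a * R ^ 2 / 4) * (R / (2 * sqrt a))"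
      unfolding norm_mult[of "exp _"] by (intro mult_mono) auto
  qed (auto simp: S_def)
  have "((\<lambda>R. exp (- a * R ^ 2 / 4) * (R / (2 * sqrt a)) * norm (x - of_real a)) \<longlongrightarrow> 0) at_top"
    using a by real_asymp
  then have "((\<lambda>R. gauss_int (csqrt x * of_real R) - gauss_int (csqrt (of_real a) * of_real R)) \<longlongrightarrow> 0) at_top"
    by (rule Lim_null_comparison[rotated]) (use bound in \<open>auto intro: eventually_mono[OF eventually_gt_at_top[of 0]]\<close>)
  moreover have "((\<lambda>R. gauss_int (csqrt (of_real a) * of_real R)) \<longlongrightarrow> of_real (sqrt pi)) at_top"
  proof -
    have "filterlim (\<lambda>R. sqrt a * R) at_top at_top" using a by real_asymp
    from filterlim_compose[OF gauss_int_real_limit this] show ?thesis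
      using a by (simp add: csqrt_of_real_nonneg)
  qed
  ultimately show ?thesis using tendsto_add by fastforce
qed

text \<open>The missing part is the integral over w t for t \<ge> 1. There |exp (- w^2 t^2 / 4)| =
  exp (- a t^2 / 4) with a = Re x, and t^2 \<ge> 1 + 2 (t - 1) gives an exponential with an
  elementary primitive.\<close>

lemma gauss_int_tail:
  assumes x: "Re x > 0"
  shows "norm (gauss_int (csqrt x) - of_real (sqrt pi)) \<le> norm (csqrt x) * exp (- Re x / 4) * (2 / Re x)"
proof -
  define a where "a = Re x"
  have a: "a > 0" using x by (simp add: a_def)
  define w where "w = csqrt x"
  have w2: "w ^ 2 = x" by (simp add: w_def)
  define g where "g t = - (norm w * exp (- a / 4) * (2 / a)) * exp (- (a / 2) * (t - 1))" for t
  have bound: "norm (gauss_int (w * of_real R) - gauss_int w) \<le> norm w * exp (- a / 4) * (2 / a)" if R: "R \<ge> 1" for R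
  proof -
    have f: "((\<lambda>t. w * exp (- ((w * of_real t) ^ 2) / 4)) has_integral (gauss_int (w * of_real R) - gauss_int (w * of_real 1))) {1..R}"
    proof (rule fundamental_theorem_of_calculus[OF R])
      fix t assume "t \<in> {1..R}"
      have "((\<lambda>t. w * complex_of_real t) has_vector_derivative w) (at t)"
        by (auto intro!: derivative_eq_intros)
      from field_vector_diff_chain_at[OF this gauss_int_deriv]
      show "((\<lambda>t. gauss_int (w * of_real t)) has_vector_derivative w * exp (- ((w * of_real t) ^ 2) / 4)) (at t within {1..R})"
        by (simp add: o_def has_vector_derivative_at_within)
    qed
    have gi: "((\<lambda>t. norm w * exp (- a / 4) * exp (- (a / 2) * (t - 1))) has_integral (g R - g 1)) {1..R}"
    proof (rule fundamental_theorem_of_calculus[OF R])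
      fix t :: real
      have "(g has_real_derivative norm w * exp (- a / 4) * exp (- (a / 2) * (t - 1))) (at t)"
        unfolding g_def[abs_def] using a by (auto intro!: derivative_eq_intros)
      then show "(g has_vector_derivative norm w * exp (- a / 4) * exp (- (a / 2) * (t - 1))) (at t within {1..R})"
        by (simp add: has_real_derivative_iff_has_vector_derivative has_vector_derivative_at_within)
    qed
    have "norm (gauss_int (w * of_real R) - gauss_int (w * of_real 1)) \<le> g R - g 1"
      unfolding integral_unique[OF f, symmetric] integral_unique[OF gi, symmetric]
    proof (rule integral_norm_bound_integral)
      fix t assume t: "t \<in> {1..R}"
      have "norm (exp (- ((w * of_real t) ^ 2) / 4)) = exp (- (a * t ^ 2) / 4)"
        by (simp add: power_mult_distrib w2 a_def flip: of_real_power)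
      also have "\<dots> \<le> exp (- a / 4 + - (a / 2) * (t - 1))"
      proof -
        have "a * (t ^ 2 - 1 - 2 * (t - 1)) \<ge> 0"
        proof -
          have "t ^ 2 - 1 - 2 * (t - 1) = (t - 1) ^ 2" by (simp add: power2_eq_square algebra_simps)
          then show ?thesis using a by simp
        qed
        then have "(a + 2 * a * (t - 1)) / 4 \<le> a * t ^ 2 / 4" by (simp add: algebra_simps)
        moreover have "(a + 2 * a * (t - 1)) / 4 = a / 4 + a / 2 * (t - 1)" by (simp add: field_simps)
        ultimately show ?thesis by simp
      qed
      finally show "norm (w * exp (- ((w * of_real t) ^ 2) / 4)) \<le> norm w * exp (- a / 4) * exp (- (a / 2) * (t - 1))"
        unfolding exp_add norm_mult[of w] by (simp add: mult_left_mono mult.assoc)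
    qed (use f gi in \<open>auto simp: has_integral_integrable\<close>)
    also have "\<dots> \<le> norm w * exp (- a / 4) * (2 / a)"
      using a by (simp add: g_def)
    finally show ?thesis by simp
  qed
  have "((\<lambda>R. norm (gauss_int (w * of_real R) - gauss_int w)) \<longlongrightarrow> norm (of_real (sqrt pi) - gauss_int w)) at_top"
    unfolding w_def by (intro tendsto_intros gauss_int_ray_limit x)
  then have "norm (of_real (sqrt pi) - gauss_int w) \<le> norm w * exp (- a / 4) * (2 / a)"
    by (rule tendsto_upperbound) (use bound in \<open>auto intro: eventually_mono[OF eventually_ge_at_top[of 1]]\<close>)
  then show ?thesis by (simp add: w_def a_def norm_minus_commute)
qed

text \<open>Multiplying the tail bound by |exp (x / 4) / w| cancels both the exponential and |w|: an
  exponentially large function is replaced at bounded cost once Re x \<ge> 1.\<close>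

lemma dawson_series_approx:
  assumes x: "Re x > 0"
  shows "norm (dawson_series x - exp (x / 4) * complex_of_real (sqrt pi) / csqrt x) \<le> 2 / Re x"
proof -
  define w where "w = csqrt x"
  have w: "w ^ 2 = x" "w \<noteq> 0" using x by (auto simp: w_def)
  have "gauss_int w = exp (- x / 4) * (w * dawson_series x)" by (simp add: gauss_int_def w)
  then have "dawson_series x = exp (x / 4) * gauss_int w / w"
    using w by (simp add: exp_minus field_simps)
  then have "dawson_series x - exp (x / 4) * complex_of_real (sqrt pi) / w = exp (x / 4) * (gauss_int w - of_real (sqrt pi)) / w"
    by (simp add: algebra_simps diff_divide_distrib)
  then have "norm (dawson_series x - exp (x / 4) * complex_of_real (sqrt pi) / w) = exp (Re x / 4) * norm (gauss_int w - of_real (sqrt pi)) / norm w"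
    by (simp add: norm_mult norm_divide)
  also have "\<dots> \<le> exp (Re x / 4) * (norm w * exp (- Re x / 4) * (2 / Re x)) / norm w"
    using gauss_int_tail[OF x] by (intro divide_right_mono mult_left_mono) (auto simp: w_def)
  also have "\<dots> = 2 / Re x" using w by (simp add: exp_minus)
  finally show ?thesis by (simp add: w_def)
qed

section \<open>The series with coefficients n^j\<close>

definition polylog_fps :: "nat \<Rightarrow> complex fps" where
  "polylog_fps j = Abs_fps (\<lambda>n. of_nat (n ^ j))"

text \<open>The polylogarithm of order -j. As 0^0 = 1, for j = 0 the constant term is included and
  the sum is 1 / (1 - q).\<close>

definition polylog :: "nat \<Rightarrow> complex \<Rightarrow> complex" where
  "polylog j q = (\<Sum>n. of_nat (n ^ j) * q ^ n)"

lemma polylog_fps_Suc: "polylog_fps (Suc j) = fps_X * fps_deriv (polylog_fps j)"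
proof (rule fps_ext)
  fix n show "fps_nth (polylog_fps (Suc j)) n = fps_nth (fps_X * fps_deriv (polylog_fps j)) n"
    by (cases n) (simp_all add: polylog_fps_def)
qed

lemma polylog_fps_radius: "fps_conv_radius (polylog_fps j) \<ge> 1"
proof (induction j)
  case 0
  show ?case unfolding fps_conv_radius_def polylog_fps_def
    by (rule conv_radius_ge_1) simp
next
  case (Suc j)
  have "1 \<le> min (fps_conv_radius (fps_X :: complex fps)) (fps_conv_radius (fps_deriv (polylog_fps j)))"
    using Suc fps_conv_radius_deriv[of "polylog_fps j"] by (auto intro: order_trans)
  also have "\<dots> \<le> fps_conv_radius (polylog_fps (Suc j))"
    unfolding polylog_fps_Suc by (rule fps_conv_radius_mult)
  finally show ?case .
qed

lemma polylog_eval: "polylog j = eval_fps (polylog_fps j)"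
  by (simp add: fun_eq_iff polylog_def eval_fps_def polylog_fps_def)

lemma norm_less_polylog_fps_radius:
  assumes "norm q < 1" shows "ereal (norm q) < fps_conv_radius (polylog_fps j)"
proof -
  have "ereal (norm q) < 1" using assms by simp
  then show ?thesis by (rule less_le_trans[OF _ polylog_fps_radius])
qed

lemma polylog_summable: "norm q < 1 \<Longrightarrow> summable (\<lambda>n. of_nat (n ^ j) * q ^ n :: complex)"
  using summable_fps[OF norm_less_polylog_fps_radius, of q j] by (simp add: polylog_fps_def)

lemma polylog_0: "norm q < 1 \<Longrightarrow> polylog 0 q = 1 / (1 - q)"
  by (simp add: polylog_def suminf_geometric)

lemma polylog_deriv:
  assumes q: "norm q < 1"
  obtains d where "(polylog j has_field_derivative d) (at q)" "q * d = polylog (Suc j) q"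
proof -
  have r: "ereal (norm q) < fps_conv_radius (polylog_fps j)" by (rule norm_less_polylog_fps_radius[OF q])
  have r': "ereal (norm q) < fps_conv_radius (fps_deriv (polylog_fps j))"
    by (rule less_le_trans[OF r fps_conv_radius_deriv])
  have "(polylog j has_field_derivative eval_fps (fps_deriv (polylog_fps j)) q) (at q)"
    unfolding polylog_eval by (rule has_field_derivative_eval_fps[OF r])
  moreover have "q * eval_fps (fps_deriv (polylog_fps j)) q = polylog (Suc j) q"
    unfolding polylog_eval polylog_fps_Suc using r' by (subst eval_fps_mult) auto
  ultimately show ?thesis by (rule that)
qed

text \<open>The operator q d/dq takes the numerator A of order j to q (1 - q) A' + (j + 1) q A. The
  coefficient a_k is thereby distributed to k a_k at q^k and (j + 1 - k) a_k at q^(k+1):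
  nonnegativity persists and the sum is multiplied by j + 1.\<close>

lemma eulerian_numbers:
  "\<exists>a. (\<forall>k. a k \<ge> (0::real)) \<and> (\<Sum>k\<le>j. a k) = fact j \<and>
     (\<forall>q. norm q < 1 \<longrightarrow> polylog j q * (1 - q) ^ Suc j = (\<Sum>k\<le>j. of_real (a k) * q ^ k))"
proof (induction j)
  case 0
  have "1 - q \<noteq> 0" if "norm q < 1" for q :: complex using that by auto
  then show ?case by (intro exI[of _ "\<lambda>_. 1"]) (auto simp: polylog_0)
next
  case (Suc j)
  then obtain a where a: "\<And>k. a k \<ge> (0::real)" "(\<Sum>k\<le>j. a k) = fact j"
    "\<And>q. norm q < 1 \<Longrightarrow> polylog j q * (1 - q) ^ Suc j = (\<Sum>k\<le>j. of_real (a k) * q ^ k)"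
    by blast
  define b where "b k = (if k \<le> j then real k * a k else 0) + (case k of 0 \<Rightarrow> 0 | Suc i \<Rightarrow> if i \<le> j then real (Suc j - i) * a i else 0)" for k
  have split: "(\<Sum>k\<le>Suc j. of_real (b k) * u k) = (\<Sum>k\<le>j. of_real (a k) * (of_nat k * u k + of_nat (Suc j - k) * u (Suc k)))"
    for u :: "nat \<Rightarrow> 'b :: {real_algebra_1, comm_ring_1}"
  proof -
    have "(\<Sum>k\<le>Suc j. of_real (b k) * u k) = (\<Sum>k\<le>Suc j. of_real (if k \<le> j then real k * a k else 0) * u k)
        + (\<Sum>k\<le>Suc j. of_real (case k of 0 \<Rightarrow> 0 | Suc i \<Rightarrow> if i \<le> j then real (Suc j - i) * a i else 0) * u k)"
      by (simp only: b_def of_real_add distrib_right sum.distrib)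
    also have "(\<Sum>k\<le>Suc j. of_real (if k \<le> j then real k * a k else 0) * u k) = (\<Sum>k\<le>j. of_real (a k) * (of_nat k * u k))"
      by (simp add: algebra_simps)
    also have "(\<Sum>k\<le>Suc j. of_real (case k of 0 \<Rightarrow> 0 | Suc i \<Rightarrow> if i \<le> j then real (Suc j - i) * a i else 0) * u k)
        = (\<Sum>k\<le>j. of_real (a k) * (of_nat (Suc j - k) * u (Suc k)))"
      by (subst sum.atMost_Suc_shift) (auto intro!: sum.cong simp: algebra_simps simp del: of_nat_diff)
    finally show ?thesis by (simp add: sum.distrib distrib_left)
  qed
  show ?case
  proof (intro exI[of _ b] conjI allI impI)
    show "b k \<ge> 0" for k using a(1) by (auto simp: b_def split: nat.split)
    have "(\<Sum>k\<le>Suc j. b k) = (\<Sum>k\<le>j. a k * (real k * 1 + real (Suc j - k) * 1))"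
      using split[of "\<lambda>_. 1 :: real"] by simp
    also have "\<dots> = (\<Sum>k\<le>j. a k * real (Suc j))"
      by (intro sum.cong refl) (simp add: of_nat_diff)
    also have "\<dots> = fact (Suc j)" using a(2) by (simp add: sum_distrib_right[symmetric] mult.commute)
    finally show "(\<Sum>k\<le>Suc j. b k) = fact (Suc j)" .
    fix q :: complex assume q: "norm q < 1"
    obtain d where d: "(polylog j has_field_derivative d) (at q)" "q * d = polylog (Suc j) q"
      by (rule polylog_deriv[OF q])
    define A' where "A' = (\<Sum>k\<le>j. of_real (a k) * (of_nat k * q ^ (k - 1)))"
    have 1: "((\<lambda>q. polylog j q * (1 - q) ^ Suc j) has_field_derivative
        (d * (1 - q) ^ Suc j + polylog j q * (- (of_nat (Suc j) * (1 - q) ^ j)))) (at q)"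
      by (rule derivative_eq_intros d(1) refl | simp)+
    have "((\<lambda>q. \<Sum>k\<le>j. of_real (a k) * q ^ k) has_field_derivative A') (at q)"
      unfolding A'_def by (auto intro!: derivative_eq_intros sum.cong)
    then have 2: "((\<lambda>q. polylog j q * (1 - q) ^ Suc j) has_field_derivative A') (at q)"
      by (rule has_field_derivative_transform_within_open[of _ _ _ "ball 0 1"]) (use q a(3) in auto)
    have dA: "d * (1 - q) ^ Suc j + polylog j q * (- (of_nat (Suc j) * (1 - q) ^ j)) = A'"
      by (rule DERIV_unique[OF 1 2])
    have qA: "q * A' = (\<Sum>k\<le>j. of_real (a k) * (of_nat k * q ^ k))"
      unfolding A'_def sum_distrib_left
    proof (intro sum.cong refl)
      fix k show "q * (of_real (a k) * (of_nat k * q ^ (k - 1))) = of_real (a k) * (of_nat k * q ^ k)"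
        by (cases k) auto
    qed
    have "polylog (Suc j) q * (1 - q) ^ Suc (Suc j) = (1 - q) * q * (d * (1 - q) ^ Suc j)"
      by (simp add: d(2)[symmetric] algebra_simps)
    also have "\<dots> = (1 - q) * (q * A') + of_nat (Suc j) * q * (polylog j q * (1 - q) ^ Suc j)"
      unfolding dA[symmetric] by (simp add: algebra_simps)
    also have "\<dots> = (\<Sum>k\<le>j. of_real (a k) * (of_nat k * q ^ k + of_nat (Suc j - k) * q ^ Suc k))"
      unfolding qA a(3)[OF q] sum_distrib_left sum.distrib[symmetric]
    proof (intro sum.cong refl)
      fix k assume "k \<in> {..j}"
      then have "of_nat (Suc j - k) = (of_nat (Suc j) - of_nat k :: complex)" by (simp add: of_nat_diff)
      then show "(1 - q) * (of_real (a k) * (of_nat k * q ^ k)) + of_nat (Suc j) * q * (of_real (a k) * q ^ k) =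
          of_real (a k) * (of_nat k * q ^ k + of_nat (Suc j - k) * q ^ Suc k)"
        by (simp only:) (simp add: algebra_simps)
    qed
    also have "\<dots> = (\<Sum>k\<le>Suc j. of_real (b k) * q ^ k)" by (simp only: split)
    finally show "polylog (Suc j) q * (1 - q) ^ Suc (Suc j) = (\<Sum>k\<le>Suc j. of_real (b k) * q ^ k)" .
  qed
qed

text \<open>As the numerator has nonnegative coefficients with sum j!, it is at most j! on the unit
  disc. Unlike \<open>polylog_near_1\<close>, this also holds far from q = 1.\<close>

lemma norm_polylog_le:
  assumes q: "norm q < 1"
  shows "norm (polylog j q) \<le> fact j / norm (1 - q) ^ Suc j"
proof -
  obtain a where a: "\<And>k. a k \<ge> (0::real)" "(\<Sum>k\<le>j. a k) = fact j"
    "polylog j q * (1 - q) ^ Suc j = (\<Sum>k\<le>j. of_real (a k) * q ^ k)"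
    using eulerian_numbers[of j] q by blast
  have "norm (1 - q) > 0" using q by auto
  have "norm (polylog j q) * norm (1 - q) ^ Suc j = norm (\<Sum>k\<le>j. of_real (a k) * q ^ k)"
    unfolding a(3)[symmetric] norm_mult norm_power ..
  also have "\<dots> \<le> (\<Sum>k\<le>j. a k)"
  proof (rule sum_norm_le)
    fix k
    have "norm (q ^ k) \<le> 1" using q by (simp add: norm_power power_le_one)
    then show "norm (of_real (a k) * q ^ k) \<le> a k"
      using a(1)[of k] by (simp add: norm_mult mult_left_le)
  qed
  finally show ?thesis using a(2) \<open>norm (1 - q) > 0\<close> by (simp add: pos_le_divide_eq)
qed

text \<open>In the variable s with q = exp (-s), the operator q d/dq is -d/ds. All orders thus
  follow from the case j = 0 by Cauchy's estimate for derivatives.\<close>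

lemma higher_deriv_polylog_exp:
  assumes "Re s > 0"
  shows "(deriv ^^ j) (\<lambda>s. polylog 0 (exp (- s))) s = (-1) ^ j * polylog j (exp (- s))"
  using assms
proof (induction j arbitrary: s)
  case (Suc j)
  have n: "norm (exp (- s)) < 1" using Suc.prems by simp
  obtain d where d: "(polylog j has_field_derivative d) (at (exp (- s)))"
    "exp (- s) * d = polylog (Suc j) (exp (- s))"
    by (rule polylog_deriv[OF n])
  have e: "((\<lambda>s. exp (- s)) has_field_derivative - exp (- s)) (at s)"
    by (auto intro!: derivative_eq_intros)
  have "((\<lambda>s. polylog j (exp (- s))) has_field_derivative (d * - exp (- s))) (at s)"
    by (rule DERIV_chain2[where f = "polylog j" and g = "\<lambda>s. exp (- s)", OF d(1) e])
  from DERIV_cmult[OF this, of "(-1) ^ j"]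
  have der: "((\<lambda>s. (-1) ^ j * polylog j (exp (- s))) has_field_derivative ((-1) ^ j * (d * - exp (- s)))) (at s)" .
  have "(deriv ^^ Suc j) (\<lambda>s. polylog 0 (exp (- s))) s = deriv ((deriv ^^ j) (\<lambda>s. polylog 0 (exp (- s)))) s"
    by simp
  also have "\<dots> = deriv (\<lambda>s. (-1) ^ j * polylog j (exp (- s))) s"
  proof (rule deriv_cong_ev[OF _ refl])
    have "eventually (\<lambda>w. w \<in> {w. Re w > 0}) (nhds s)"
      by (rule eventually_nhds_in_open) (use Suc.prems open_halfspace_Re_gt in auto)
    then show "\<forall>\<^sub>F w in nhds s. (deriv ^^ j) (\<lambda>s. polylog 0 (exp (- s))) w = (-1) ^ j * polylog j (exp (- w))"
      by (rule eventually_mono) (use Suc.IH in auto)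
  qed
  also have "\<dots> = (-1) ^ j * (d * - exp (- s))" by (rule DERIV_imp_deriv[OF der])
  also have "\<dots> = (-1) ^ Suc j * polylog (Suc j) (exp (- s))"
    unfolding d(2)[symmetric] by (simp add: mult.commute)
  finally show ?case .
qed simp

lemma higher_deriv_inverse':
  assumes "Re s > 0"
  shows "(deriv ^^ j) (\<lambda>s. 1 / s) s = (-1) ^ j * (fact j / s ^ Suc j)"
  using assms
proof (induction j arbitrary: s)
  case (Suc j)
  have s: "s \<noteq> 0" using Suc.prems by auto
  have der: "((\<lambda>s. (-1) ^ j * (fact j / s ^ Suc j)) has_field_derivative ((-1) ^ Suc j * (fact (Suc j) / s ^ Suc (Suc j)))) (at s)"
  proof -
    have p: "((\<lambda>s. s ^ Suc j) has_field_derivative of_nat (Suc j) * s ^ j) (at s)"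
      by (rule derivative_eq_intros refl | simp)+
    have "((\<lambda>s. (-1) ^ j * (fact j / s ^ Suc j)) has_field_derivative (-1) ^ j * ((0 * s ^ Suc j - fact j * (of_nat (Suc j) * s ^ j)) / (s ^ Suc j * s ^ Suc j))) (at s)"
      by (intro DERIV_cmult DERIV_divide DERIV_const p) (use s in simp)
    also have "(-1) ^ j * ((0 * s ^ Suc j - fact j * (of_nat (Suc j) * s ^ j)) / (s ^ Suc j * s ^ Suc j)) = (-1) ^ Suc j * (fact (Suc j) / s ^ Suc (Suc j))"
      using s by (simp add: field_simps)
    finally show ?thesis .
  qed
  have "(deriv ^^ Suc j) (\<lambda>s. 1 / s) s = deriv ((deriv ^^ j) (\<lambda>s. 1 / s)) s"
    by simp
  also have "\<dots> = deriv (\<lambda>s. (-1) ^ j * (fact j / s ^ Suc j)) s"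
  proof (rule deriv_cong_ev[OF _ refl])
    have "eventually (\<lambda>w. w \<in> {w. Re w > 0}) (nhds s)"
      by (rule eventually_nhds_in_open) (use Suc.prems open_halfspace_Re_gt in auto)
    then show "\<forall>\<^sub>F w in nhds s. (deriv ^^ j) (\<lambda>s. 1 / s) w = (-1) ^ j * (fact j / w ^ Suc j)"
      by (rule eventually_mono) (use Suc.IH in auto)
  qed
  also have "\<dots> = (-1) ^ Suc j * (fact (Suc j) / s ^ Suc (Suc j))" by (rule DERIV_imp_deriv[OF der])
  finally show ?case .
qed simp

lemma norm_exp_minus_1_minus_le:
  fixes w :: complex
  shows "norm (exp w - 1 - w) \<le> exp (norm w) - 1 - norm w"
proof -
  have c: "(\<lambda>k. z ^ k / fact k) sums exp z" for z :: complex
    using exp_converges[of z] by (simp add: scaleR_conv_of_real divide_inverse mult.commute)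
  have s: "(\<lambda>k. w ^ (k + 2) / fact (k + 2)) sums (exp w - 1 - w)"
    using sums_split_initial_segment[OF c[of w], of 2] by (simp add: numeral_2_eq_2 diff_diff_eq)
  have r: "(\<lambda>k. norm w ^ (k + 2) / fact (k + 2)) sums (exp (norm w) - 1 - norm w)"
    using sums_split_initial_segment[OF exp_sums_real[of "norm w"], of 2] by (simp add: numeral_2_eq_2 diff_diff_eq)
  have "norm (\<Sum>k. w ^ (k + 2) / fact (k + 2)) \<le> (\<Sum>k. norm w ^ (k + 2) / fact (k + 2))"
    by (rule norm_suminf_le[OF _ sums_summable[OF r]]) (simp only: norm_divide norm_power norm_fact order_refl)
  then show ?thesis unfolding sums_unique[OF s, symmetric] sums_unique[OF r, symmetric] .
qed

lemma exp_fraction_bound: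
  fixes w :: complex
  assumes w: "w \<noteq> 0" "norm w \<le> 9 / 10"
  shows "exp (- w) \<noteq> 1" "norm (1 / (1 - exp (- w)) - 1 / w) \<le> 10"
proof -
  have w0: "norm w > 0" using w by simp
  have "exp (norm w) \<le> 1 + norm w + norm w ^ 2" using w by (intro exp_bound) auto
  with norm_exp_minus_1_minus_le[of "- w"] have le: "norm (exp (- w) - 1 + w) \<le> norm w ^ 2" by simp
  have "norm w - norm (1 - exp (- w)) \<le> norm (w - (1 - exp (- w)))" by (rule norm_triangle_ineq2)
  also have "w - (1 - exp (- w)) = exp (- w) - 1 + w" by simp
  finally have "norm (1 - exp (- w)) \<ge> norm w - norm w ^ 2" using le by simp
  \<comment> \<open>The radius 9/10 is what makes 1 - |w| at least 1/10, the source of the final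
    constant 10.\<close>
  moreover have "norm w - norm w ^ 2 \<ge> norm w / 10"
  proof -
    have "norm w * norm w \<le> norm w * (9 / 10)" using w by (intro mult_left_mono) auto
    then show ?thesis by (simp add: power2_eq_square)
  qed
  ultimately have lb: "norm (1 - exp (- w)) \<ge> norm w / 10" by linarith
  then show ne: "exp (- w) \<noteq> 1" using w0 by auto
  have "1 / (1 - exp (- w)) - 1 / w = (exp (- w) - 1 + w) / ((1 - exp (- w)) * w)"
    using ne w by (simp add: field_simps)
  then have "norm (1 / (1 - exp (- w)) - 1 / w) = norm (exp (- w) - 1 + w) / (norm (1 - exp (- w)) * norm w)"
    by (simp add: norm_divide norm_mult)
  also have "\<dots> \<le> norm w ^ 2 / (norm w / 10 * norm w)"
    using le lb w0 by (intro frac_le mult_right_mono) auto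
  also have "\<dots> = 10" using w0 by (simp add: power2_eq_square)
  finally show "norm (1 / (1 - exp (- w)) - 1 / w) \<le> 10" .
qed

text \<open>1 / (1 - exp (-s)) - 1 / s has a removable singularity at 0 and is bounded by 10 for |s|
  \<le> 9/10. Cauchy's inequality on the disc of radius 1/2 about \<open>s\<close>, which fits since
  2/5 + 1/2 = 9/10, bounds its j-th derivative; the factor 2^j comes from this radius. The disc may
  contain 0, hence the extension \<open>g\<close>.\<close>

lemma polylog_near_1:
  assumes s: "Re s > 0" "norm s < 2 / 5"
  shows "norm (polylog j (exp (- s)) - fact j / s ^ Suc j) \<le> 10 * fact j * 2 ^ j"
proof -
  define h where "h w = 1 / (1 - exp (- w)) - 1 / w" for w :: complex
  define B where "B = cball (0 :: complex) (9 / 10)"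
  have ne: "1 - exp (- w) \<noteq> 0" if "w \<in> B - {0}" for w
    using exp_fraction_bound(1)[of w] that by (auto simp: B_def)
  have "h holomorphic_on B - {0}"
    unfolding h_def by (intro holomorphic_intros ne) auto
  then have hol: "h holomorphic_on ball 0 (9 / 10) - {0}"
    by (rule holomorphic_on_subset) (auto simp: B_def)
  have int: "0 \<in> interior (ball (0 :: complex) (9 / 10))" by simp
  have "\<exists>C. eventually (\<lambda>w. norm (h w) \<le> C) (at 0)"
  proof (intro exI[of _ 10])
    have "eventually (\<lambda>w::complex. w \<in> ball 0 (9 / 10)) (at 0)"
      by (rule eventually_at_in_open') auto
    then show "eventually (\<lambda>w. norm (h w) \<le> 10) (at 0)"
      using eventually_neq_at_within[of 0 0 UNIV]
      by eventually_elim (auto simp: h_def intro!: exp_fraction_bound(2))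
  qed
  then obtain g where g: "g holomorphic_on ball 0 (9 / 10)" "\<And>w. w \<in> ball 0 (9 / 10) - {0} \<Longrightarrow> g w = h w"
    using holomorphic_on_extend_bounded[OF hol int] by blast
  have sub: "cball s (1 / 2) \<subseteq> ball 0 (9 / 10)"
  proof
    fix w assume "w \<in> cball s (1 / 2)"
    then have "norm (s - w) \<le> 1 / 2" by (simp add: dist_norm)
    moreover have "norm w \<le> norm s + norm (s - w)" by (metis norm_minus_commute norm_triangle_sub)
    ultimately show "w \<in> ball 0 (9 / 10)" using s by simp
  qed
  \<comment> \<open>The series of \<open>polylog\<close> is only available for Re w > 0, so the
    derivatives at \<open>s\<close> are identified on this part of the disc.\<close>
  define U where "U = ball (0 :: complex) (9 / 10) \<inter> {w. Re w > 0}"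
  have neU: "1 - exp (- w) \<noteq> 0" "w \<noteq> 0" if "w \<in> U" for w
  proof -
    show "w \<noteq> 0" using that by (auto simp: U_def)
    with that show "1 - exp (- w) \<noteq> 0" by (intro ne) (auto simp: U_def B_def)
  qed
  have hU: "(\<lambda>w. polylog 0 (exp (- w))) holomorphic_on U" "(\<lambda>w. 1 / w) holomorphic_on U"
  proof -
    have "(\<lambda>w. 1 / (1 - exp (- w))) holomorphic_on U" by (intro holomorphic_intros neU)
    then show "(\<lambda>w. polylog 0 (exp (- w))) holomorphic_on U"
      by (rule holomorphic_transform) (auto simp: U_def polylog_0)
    show "(\<lambda>w. 1 / w) holomorphic_on U" by (intro holomorphic_intros neU)
  qed
  have "norm ((deriv ^^ j) g s) \<le> fact j * 10 / (1 / 2) ^ j"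
  proof (rule Cauchy_inequality)
    show "g holomorphic_on ball s (1 / 2)"
      by (rule holomorphic_on_subset[OF g(1)]) (use sub in \<open>auto simp: subset_iff\<close>)
    show "continuous_on (cball s (1 / 2)) g"
      by (rule continuous_on_subset[OF holomorphic_on_imp_continuous_on[OF g(1)] sub])
    fix w assume w: "norm (s - w) = 1 / 2"
    then have "w \<noteq> 0" using s by auto
    moreover have "w \<in> ball 0 (9 / 10)" by (rule subsetD[OF sub]) (use w in \<open>simp add: dist_norm\<close>)
    ultimately show "norm (g w) \<le> 10"
      using g(2)[of w] exp_fraction_bound(2)[of w] by (simp add: h_def)
  qed simp
  also have "(deriv ^^ j) g s = (deriv ^^ j) (\<lambda>w. polylog 0 (exp (- w)) - 1 / w) s"
  proof (rule higher_deriv_transform_within_open)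
    show "open U" by (simp add: U_def open_Int open_halfspace_Re_gt)
    show "s \<in> U" using s by (simp add: U_def)
    show "g holomorphic_on U" by (rule holomorphic_on_subset[OF g(1)]) (auto simp: U_def)
    show "(\<lambda>w. polylog 0 (exp (- w)) - 1 / w) holomorphic_on U"
      by (intro holomorphic_on_diff hU)
    show "g w = polylog 0 (exp (- w)) - 1 / w" if "w \<in> U" for w
      using that g(2)[of w] neU(2)[OF that] by (auto simp: U_def h_def polylog_0)
  qed
  also have "\<dots> = (deriv ^^ j) (\<lambda>w. polylog 0 (exp (- w))) s - (deriv ^^ j) (\<lambda>w. 1 / w) s"
    by (rule higher_deriv_diff[OF hU]) (use s in \<open>auto simp: U_def open_Int open_halfspace_Re_gt\<close>)
  also have "\<dots> = (-1) ^ j * (polylog j (exp (- s)) - fact j / s ^ Suc j)"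
    using s by (simp add: higher_deriv_polylog_exp higher_deriv_inverse' right_diff_distrib)
  also have "norm \<dots> = norm (polylog j (exp (- s)) - fact j / s ^ Suc j)"
    by (simp add: norm_mult norm_power)
  finally show ?thesis by (simp add: power_divide mult_ac)
qed

section \<open>Comparison on a circle\<close>

text \<open>The transformed theta function gives G / T, where T = 1 + O(exp (-2 Re x)). Against the
  growth exp (Re x / 4) of G this correction is negligible, so replacing T by 1 costs only a bounded
  amount.\<close>

lemma overpartition_gf_via_triangular:
  assumes s: "Re s > 0"
  defines "x \<equiv> complex_of_real (pi ^ 2) / s"
  assumes x: "Re x \<ge> 1"
  shows "norm (overpartition_gf (exp (- s)) - exp (x / 4) * complex_of_real (sqrt pi) / csqrt x / 2) \<le> 2"
    and "norm (overpartition_gf (exp (- s))) \<le> 2 * exp (Re x / 4)"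
proof -
  define a where "a = Re x"
  define T where "T = triangular_series (exp (- 2 * x))"
  define G where "G = exp (x / 4) * complex_of_real (sqrt pi) / csqrt x / 2"
  have sx: "s \<noteq> 0" "x \<noteq> 0" using s x by auto
  have w: "norm (exp (- 2 * x)) = exp (- 2 * a)" by (simp add: a_def)
  have e2: "exp (- 2 * a) \<le> 1 / 4"
  proof -
    have "exp (- 2 * a) \<le> exp (- 2)" using x by (simp add: a_def)
    also have "exp (- 2 :: real) = 1 / (exp 1 * exp 1)" by (simp add: exp_minus inverse_eq_divide flip: exp_add)
    also have "\<dots> \<le> 1 / (2 * 2)"
      using exp_ge_add_one_self[of 1] by (intro divide_left_mono mult_mono) auto
    finally show ?thesis by simp
  qed
  have "norm (T - 1) \<le> exp (- 2 * a) / (1 - exp (- 2 * a))"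
    unfolding T_def w[symmetric] by (rule triangular_series_near_1) (use w e2 in linarith)
  also have "\<dots> \<le> exp (- 2 * a) / (3 / 4)"
    using e2 x by (intro divide_left_mono mult_pos_pos) (auto simp: a_def)
  finally have T1: "norm (T - 1) \<le> 4 / 3 * exp (- 2 * a)" by simp
  have Tlb: "norm T \<ge> 2 / 3"
  proof -
    have "1 - norm (T - 1) \<le> norm T" using norm_triangle_ineq2[of 1 "1 - T"] by (simp add: norm_minus_commute)
    then show ?thesis using T1 e2 by linarith
  qed
  then have T0: "T \<noteq> 0" by auto
  have n: "norm (exp (- s)) < 1" using s by simp
  have "- complex_of_real (pi ^ 2) / x = - s" using sx by (simp add: x_def)
  then have "theta4 (exp (- s)) = 2 * csqrt x / complex_of_real (sqrt pi) * exp (- x / 4) * T"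
    using theta4_transform[of x] x by (simp add: T_def)
  also have "\<dots> = T / G" using sx by (simp add: G_def exp_minus field_simps)
  finally have "overpartition_gf (exp (- s)) * (T / G) = 1"
    using overpartition_gf_theta4[OF n] by simp
  moreover have "G \<noteq> 0" using sx by (simp add: G_def)
  ultimately have "overpartition_gf (exp (- s)) * T = G" by (simp add: divide_eq_eq)
  then have gf: "overpartition_gf (exp (- s)) = G / T"
    using T0 by (simp add: eq_divide_eq)
  have nG: "norm G \<le> exp (a / 4)"
  proof -
    have "norm x \<ge> 1" using complex_Re_le_cmod[of x] x by linarith
    then have "sqrt (norm x) \<ge> 1" by simp
    have "sqrt pi \<le> sqrt 4" using pi_less_4 by (intro real_sqrt_le_mono) simp
    then have "sqrt pi \<le> 2" by simp
    have "norm G = exp (a / 4) * sqrt pi / sqrt (norm x) / 2"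
      by (simp add: G_def norm_mult norm_divide a_def)
    also have "\<dots> \<le> exp (a / 4) * 2 / 1 / 2"
      using \<open>sqrt pi \<le> 2\<close> \<open>sqrt (norm x) \<ge> 1\<close> by (intro divide_right_mono frac_le mult_left_mono) auto
    finally show ?thesis by simp
  qed
  have "norm (G / T) = norm G / norm T" by (rule norm_divide)
  also have "\<dots> \<le> exp (a / 4) / (2 / 3)" using nG Tlb by (intro frac_le) auto
  also have "\<dots> \<le> 2 * exp (a / 4)" by simp
  finally show "norm (overpartition_gf (exp (- s))) \<le> 2 * exp (Re x / 4)" by (simp add: gf a_def)
  have "G / T - G = G * (1 - T) / T" using T0 by (simp add: field_simps)
  then have "norm (G / T - G) = norm G * norm (T - 1) / norm T"
    by (simp add: norm_mult norm_divide norm_minus_commute)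
  also have "\<dots> \<le> exp (a / 4) * (4 / 3 * exp (- 2 * a)) / (2 / 3)"
    using nG T1 Tlb by (intro frac_le mult_mono) auto
  also have "\<dots> = 2 * exp (a / 4 + - 2 * a)" unfolding exp_add by simp
  also have "\<dots> \<le> 2 * exp 0" using x by (intro mult_left_mono) (auto simp: a_def)
  finally show "norm (overpartition_gf (exp (- s)) - exp (x / 4) * complex_of_real (sqrt pi) / csqrt x / 2) \<le> 2"
    by (simp add: gf G_def)
qed

section \<open>The combination matching the singularity at q = 1\<close>

text \<open>The coefficient of 1 / s^(j+1) in (\<open>dawson_series\<close> (pi^2 / s) - 1) / 2. The
  1/2 is half the principal part's factor in 1 / \<theta>; the constant term is left out and counted
  as bounded error.\<close>

definition main_weight :: "nat \<Rightarrow> real" where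
  "main_weight j = pi ^ (2 * Suc j) * dawson_coef (Suc j) / 2"

definition main_gf :: "nat \<Rightarrow> complex \<Rightarrow> complex" where
  "main_gf J q = (\<Sum>j<J. of_real (main_weight j / fact j) * polylog j q)"

definition main_coeff :: "nat \<Rightarrow> nat \<Rightarrow> real" where
  "main_coeff J n = (\<Sum>j<J. main_weight j / fact j * real (n ^ j))"

lemma main_weight_nonneg: "main_weight j \<ge> 0"
  using dawson_coef_pos[of "Suc j"] by (simp add: main_weight_def)

lemma norm_main_weight: "norm (complex_of_real (main_weight j / fact j)) = main_weight j / fact j"
  unfolding norm_of_real using main_weight_nonneg[of j] by simp

text \<open>Comparison with the exponential series, uniformly in \<open>J\<close>. It is used with y
  = 1 / |1 - q| to bound \<open>main_gf\<close> far from 1, and with y = 2 to sum the errors 2^j of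
  \<open>polylog_near_1\<close>.\<close>

lemma main_weight_sum_le:
  assumes y: "y \<ge> 0"
  shows "(\<Sum>j<J. main_weight j * y ^ Suc j) \<le> exp (pi ^ 2 * y / 4) / 2"
proof -
  define u where "u = pi ^ 2 * y / 4"
  have u: "u \<ge> 0" using y by (simp add: u_def)
  have "(\<Sum>j<J. main_weight j * y ^ Suc j) \<le> (\<Sum>j<J. (u ^ Suc j / fact (Suc j)) / 2)"
  proof (rule sum_mono)
    fix j
    have "main_weight j * y ^ Suc j = dawson_coef (Suc j) * (pi ^ 2 * y) ^ Suc j / 2"
      unfolding main_weight_def power_mult power_mult_distrib by simp
    also have "\<dots> \<le> ((1 / 4) ^ Suc j / fact (Suc j)) * (pi ^ 2 * y) ^ Suc j / 2"
      using y by (intro divide_right_mono mult_right_mono dawson_coef_le) auto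
    also have "\<dots> = (u ^ Suc j / fact (Suc j)) / 2"
      by (simp add: u_def power_divide)
    finally show "main_weight j * y ^ Suc j \<le> (u ^ Suc j / fact (Suc j)) / 2" .
  qed
  also have "\<dots> = (\<Sum>j<J. u ^ Suc j / fact (Suc j)) / 2" by (simp only: sum_divide_distrib)
  also have "(\<Sum>j<J. u ^ Suc j / fact (Suc j)) \<le> (\<Sum>k<Suc J. u ^ k / fact k)"
    by (subst sum.lessThan_Suc_shift) simp
  also have "\<dots> \<le> (\<Sum>k. u ^ k / fact k)"
    using u by (intro sum_le_suminf sums_summable[OF exp_sums_real]) auto
  also have "\<dots> = exp u" using exp_sums_real[of u] by (simp add: sums_iff)
  finally show ?thesis by (simp add: u_def)
qed

lemma norm_main_gf_le:
  assumes q: "norm q < 1"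
  shows "norm (main_gf J q) \<le> exp (pi ^ 2 / (4 * norm (1 - q))) / 2"
proof -
  have "norm (main_gf J q) \<le> (\<Sum>j<J. main_weight j * (1 / norm (1 - q)) ^ Suc j)"
    unfolding main_gf_def
  proof (rule sum_norm_le)
    fix j
    have "norm (of_real (main_weight j / fact j) * polylog j q) \<le> main_weight j / fact j * (fact j / norm (1 - q) ^ Suc j)"
      unfolding norm_mult norm_main_weight using norm_polylog_le[OF q, of j] main_weight_nonneg[of j]
      by (intro mult_left_mono) auto
    then show "norm (of_real (main_weight j / fact j) * polylog j q) \<le> main_weight j * (1 / norm (1 - q)) ^ Suc j"
      by (simp add: power_divide)
  qed
  also have "\<dots> \<le> exp (pi ^ 2 * (1 / norm (1 - q)) / 4) / 2" by (rule main_weight_sum_le) simp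
  finally show ?thesis by (simp add: mult.commute)
qed

text \<open>Remainder of the Taylor series at the positive point \<open>Y\<close>; by positivity of
  the coefficients it dominates the remainder in the whole disc of radius \<open>Y\<close>. It is
  the only error term that depends on \<open>J\<close>.\<close>

definition dawson_tail :: "real \<Rightarrow> nat \<Rightarrow> real" where
  "dawson_tail Y J = (\<Sum>k. dawson_coef k * Y ^ k) - (\<Sum>k<J. dawson_coef k * Y ^ k)"

lemma dawson_coef_summable_real: "summable (\<lambda>k. dawson_coef k * Y ^ k)"
  using summable_Re[OF dawson_coef_summable[of "of_real Y"]] by (simp flip: of_real_power of_real_mult)

lemma dawson_tail_tendsto: "dawson_tail Y \<longlonglongrightarrow> 0"
  using tendsto_diff[OF tendsto_const[of "\<Sum>k. dawson_coef k * Y ^ k"] summable_LIMSEQ[OF dawson_coef_summable_real[of Y]]]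
  by (simp add: dawson_tail_def[abs_def])

lemma dawson_series_partial:
  assumes "norm x \<le> Y"
  shows "norm (dawson_series x - (\<Sum>k<J. of_real (dawson_coef k) * x ^ k)) \<le> dawson_tail Y J"
proof -
  have s: "summable (\<lambda>k. dawson_coef (k + J) * Y ^ (k + J))"
    using dawson_coef_summable_real[of Y] summable_iff_shift[of "\<lambda>k. dawson_coef k * Y ^ k" J] by simp
  have "dawson_series x - (\<Sum>k<J. of_real (dawson_coef k) * x ^ k) = (\<Sum>k. of_real (dawson_coef (k + J)) * x ^ (k + J))"
    unfolding dawson_series_def by (subst suminf_split_initial_segment[OF dawson_coef_summable, of _ J]) simp
  also have "norm \<dots> \<le> (\<Sum>k. dawson_coef (k + J) * Y ^ (k + J))"
  proof (rule norm_suminf_le[OF _ s])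
    fix k show "norm (of_real (dawson_coef (k + J)) * x ^ (k + J)) \<le> dawson_coef (k + J) * Y ^ (k + J)"
      using dawson_coef_pos[of "k + J"] assms by (simp add: norm_mult norm_power mult_left_mono power_mono)
  qed
  also have "\<dots> = dawson_tail Y J"
    using suminf_split_initial_segment[OF dawson_coef_summable_real[of Y], of J] by (simp add: dawson_tail_def)
  finally show ?thesis .
qed

text \<open>\<open>L\<close> is the Taylor section in 1/s that the combination is built to imitate.
  The errors of the single polylogarithms sum to at most 5 exp (pi^2 / 2) / 2, the rest is the
  Taylor remainder.\<close>

lemma main_gf_near_1:
  assumes s: "Re s > 0" "norm s < 2 / 5"
  defines "x \<equiv> complex_of_real (pi ^ 2) / s"
  assumes Y: "norm x \<le> Y"
  shows "norm (main_gf J (exp (- s)) - (dawson_series x - 1) / 2) \<le> 400 + dawson_tail Y (Suc J)"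
proof -
  define L where "L = (\<Sum>j<J. of_real (main_weight j) / s ^ Suc j)"
  have "norm (main_gf J (exp (- s)) - L) \<le> (\<Sum>j<J. 5 * (main_weight j * 2 ^ Suc j))"
    unfolding main_gf_def L_def sum_subtractf[symmetric]
  proof (rule sum_norm_le)
    fix j
    have "of_real (main_weight j / fact j) * polylog j (exp (- s)) - of_real (main_weight j) / s ^ Suc j =
      of_real (main_weight j / fact j) * (polylog j (exp (- s)) - fact j / s ^ Suc j)"
      by (simp add: right_diff_distrib)
    also have "norm \<dots> \<le> main_weight j / fact j * (10 * fact j * 2 ^ j)"
      unfolding norm_mult norm_main_weight using polylog_near_1[OF s, of j] main_weight_nonneg[of j]
      by (intro mult_left_mono) auto
    finally show "norm (of_real (main_weight j / fact j) * polylog j (exp (- s)) - of_real (main_weight j) / s ^ Suc j) \<le> 5 * (main_weight j * 2 ^ Suc j)"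
      by simp
  qed
  also have "\<dots> = 5 * (\<Sum>j<J. main_weight j * 2 ^ Suc j)" by (simp only: sum_distrib_left)
  also have "\<dots> \<le> 5 * (exp (pi ^ 2 * 2 / 4) / 2)" by (intro mult_left_mono main_weight_sum_le) auto
  \<comment> \<open>pi^2 / 2 < 5 and e < 2.72 give exp (pi^2 / 2) < 160.\<close>
  also have "\<dots> \<le> 5 * (160 / 2)"
  proof -
    have "pi < 3.15" using pi_approx by simp
    then have "pi ^ 2 \<le> 3.15 ^ 2" by (intro power_mono) auto
    then have "pi ^ 2 * 2 / 4 \<le> 5" by (simp add: power2_eq_square)
    then have "exp (pi ^ 2 * 2 / 4) \<le> exp (real 5 * 1)" by simp
    also have "\<dots> = exp 1 ^ 5" by (rule exp_of_nat_mult)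
    also have "\<dots> \<le> (272 / 100) ^ 5" using e_less_272 by (intro power_mono) auto
    also have "\<dots> \<le> (160 :: real)" by (simp add: power_divide)
    finally show ?thesis by simp
  qed
  finally have 1: "norm (main_gf J (exp (- s)) - L) \<le> 400" by simp
  have L: "L = ((\<Sum>k<Suc J. of_real (dawson_coef k) * x ^ k) - 1) / 2"
  proof -
    have "(\<Sum>k<Suc J. of_real (dawson_coef k) * x ^ k) - 1 = (\<Sum>j<J. of_real (dawson_coef (Suc j)) * x ^ Suc j)"
      by (subst sum.lessThan_Suc_shift) simp
    also have "\<dots> / 2 = (\<Sum>j<J. of_real (main_weight j) / s ^ Suc j)"
      unfolding sum_divide_distrib
    proof (rule sum.cong[OF refl])
      fix j
      have "x ^ Suc j = complex_of_real (pi ^ (2 * Suc j)) / s ^ Suc j"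
        unfolding x_def power_divide power_mult by simp
      then show "of_real (dawson_coef (Suc j)) * x ^ Suc j / 2 = of_real (main_weight j) / s ^ Suc j"
        by (simp add: main_weight_def mult.commute del: power_Suc mult_Suc_right)
    qed
    finally show ?thesis by (simp add: L_def)
  qed
  have "L - (dawson_series x - 1) / 2 = - ((dawson_series x - (\<Sum>k<Suc J. of_real (dawson_coef k) * x ^ k)) / 2)"
    unfolding L by (simp add: diff_divide_distrib)
  then have "norm (L - (dawson_series x - 1) / 2) = norm (dawson_series x - (\<Sum>k<Suc J. of_real (dawson_coef k) * x ^ k)) / 2"
    by (simp add: norm_divide del: sum.lessThan_Suc)
  also have "\<dots> \<le> dawson_tail Y (Suc J)"
    using dawson_series_partial[OF Y, of "Suc J"] norm_ge_zero[of "dawson_series x - (\<Sum>k<Suc J. of_real (dawson_coef k) * x ^ k)"] by linarith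
  finally have 2: "norm (L - (dawson_series x - 1) / 2) \<le> dawson_tail Y (Suc J)" .
  have "main_gf J (exp (- s)) - (dawson_series x - 1) / 2 = (main_gf J (exp (- s)) - L) + (L - (dawson_series x - 1) / 2)" by simp
  then have "norm (main_gf J (exp (- s)) - (dawson_series x - 1) / 2) \<le> norm (main_gf J (exp (- s)) - L) + norm (L - (dawson_series x - 1) / 2)"
    by (simp only: norm_triangle_ineq)
  with 1 2 show ?thesis by linarith
qed

text \<open>The constant collects 400 from \<open>main_gf_near_1\<close>, 2 for replacing the
  triangular series by 1, 1 for the entire substitute and 1/2 for its omitted constant term, rounded
  up.\<close>

lemma overpartition_gf_near_1:
  assumes s: "Re s > 0" "norm s < 2 / 5"
  defines "x \<equiv> complex_of_real (pi ^ 2) / s"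
  assumes Y: "norm x \<le> Y" and x: "Re x \<ge> 1"
  shows "norm (overpartition_gf (exp (- s)) - main_gf J (exp (- s))) \<le> 404 + dawson_tail Y (Suc J)"
proof -
  define G where "G = exp (x / 4) * complex_of_real (sqrt pi) / csqrt x"
  have 1: "norm (overpartition_gf (exp (- s)) - G / 2) \<le> 2"
    unfolding G_def x_def by (rule overpartition_gf_via_triangular(1)[OF s(1) x[unfolded x_def]])
  have "norm (dawson_series x - G) \<le> 2 / Re x"
    unfolding G_def by (rule dawson_series_approx) (use x in simp)
  also have "\<dots> \<le> 2" using x by (simp add: divide_le_eq)
  finally have "norm ((dawson_series x - G) / 2) \<le> 1" by (simp add: norm_divide)
  then have 2: "norm ((dawson_series x - 1) / 2 - (G / 2 - 1 / 2)) \<le> 1" by (simp add: diff_divide_distrib)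
  have 3: "norm (main_gf J (exp (- s)) - (dawson_series x - 1) / 2) \<le> 400 + dawson_tail Y (Suc J)"
    unfolding x_def by (rule main_gf_near_1[OF s Y[unfolded x_def]])
  have tri: "norm (A - B) \<le> norm (A - g) + norm (d - (g - 1 / 2)) + norm (B - d) + 1 / 2" for A B g d :: complex
  proof -
    have "A - B = ((A - g) - (d - (g - 1 / 2))) + (- (B - d) + 1 / 2)" by simp
    also have "norm \<dots> \<le> norm ((A - g) - (d - (g - 1 / 2))) + norm (- (B - d) + 1 / 2)" by (rule norm_triangle_ineq)
    also have "\<dots> \<le> (norm (A - g) + norm (d - (g - 1 / 2))) + (norm (- (B - d)) + norm (1 / 2 :: complex))"
      by (intro add_mono norm_triangle_ineq4 norm_triangle_ineq)
    finally show ?thesis by (simp add: norm_minus_commute)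
  qed
  show ?thesis using tri[of "overpartition_gf (exp (- s))" "main_gf J (exp (- s))" "G / 2" "(dawson_series x - 1) / 2"] 1 2 3
    by linarith
qed

section \<open>The circle away from q = 1\<close>

text \<open>The third bound is tanh (u / 2) \<le> u / 2; it yields (1 + r) / (1 - r) \<ge> 2 / u for
  r = exp (-u) without loss in the constant.\<close>

lemma one_minus_exp_neg_bounds:
  fixes u :: real
  assumes "u > 0"
  shows "1 - exp (- u) \<le> u" "1 - exp (- u) \<ge> u / (1 + u)" "1 - exp (- u) \<le> u * (1 + exp (- u)) / 2"
proof -
  show "1 - exp (- u) \<le> u" using exp_ge_add_one_self[of "- u"] by linarith
  have "exp (- u) \<le> 1 / (1 + u)"
    using exp_ge_add_one_self[of u] assms by (simp add: exp_minus inverse_eq_divide divide_left_mono)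
  moreover have "1 - 1 / (1 + u) = u / (1 + u)" using assms by (simp add: field_simps)
  ultimately show "1 - exp (- u) \<ge> u / (1 + u)" by linarith
  have "0 * (1 + exp (- 0)) - 2 * (1 - exp (- 0)) \<le> u * (1 + exp (- u)) - 2 * (1 - exp (- u))"
  proof (rule DERIV_nonneg_imp_nondecreasing[of 0 u])
    fix z :: real assume "0 \<le> z" "z \<le> u"
    have "exp (- z) * (1 + z) \<le> exp (- z) * exp z" by (intro mult_left_mono exp_ge_add_one_self) auto
    then have "exp (- z) * (1 + z) \<le> 1" by (simp flip: exp_add)
    then show "\<exists>d. ((\<lambda>u. u * (1 + exp (- u)) - 2 * (1 - exp (- u))) has_real_derivative d) (at z) \<and> 0 \<le> d"
      by (intro exI[of _ "1 - exp (- z) * (1 + z)"] conjI)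
        (auto intro!: derivative_eq_intros simp: algebra_simps)
  qed (use assms in simp)
  then show "1 - exp (- u) \<le> u * (1 + exp (- u)) / 2" by simp
qed

text \<open>2 q / (1 - q) = (1 + q) / (1 - q) - 1, and the real part of (1 + q) / (1 - q) is the
  Poisson kernel.\<close>

lemma Re_geometric:
  fixes q :: complex
  assumes "q \<noteq> 1"
  shows "2 * Re (q / (1 - q)) = (1 - norm q ^ 2) / norm (1 - q) ^ 2 - 1"
proof -
  have nz: "norm (1 - q) ^ 2 \<noteq> 0" using assms by simp
  have "norm (1 - q) ^ 2 = 1 - 2 * Re q + norm q ^ 2"
    unfolding cmod_power2 by (simp add: power2_eq_square algebra_simps)
  moreover have "Re (q / (1 - q)) = (Re q - norm q ^ 2) / norm (1 - q) ^ 2"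
    unfolding Re_divide' cmod_power2 by (simp add: power2_eq_square algebra_simps)
  ultimately show ?thesis using nz by (simp add: field_simps)
qed

text \<open>At distance at least 4 (1 - r) from 1 the Poisson kernel has dropped to 1/16 of its
  maximum (1 + r) / (1 - r) \<ge> 2 / u. The saving is thus 15/16 of 2 / u, i.e. 15 / (8 u). For the
  combination, the exponent is divided by 4 up to 1 + u \<le> 21/20.\<close>

lemma generating_functions_far_from_1:
  fixes q :: complex
  assumes u: "0 < u" "u \<le> 1 / 20" and q: "norm q = exp (- u)" and far: "norm (1 - q) \<ge> 4 * (1 - exp (- u))"
  shows "norm (overpartition_gf q) \<le> 2 * exp ((pi ^ 2 / 4 - 15 / 8) / u)"
    and "norm (main_gf J q) \<le> exp (21 / 20 * pi ^ 2 / 16 / u) / 2"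
proof -
  define r where "r = exp (- u)"
  have r: "0 < r" "r < 1" using u by (auto simp: r_def)
  have q1: "norm q < 1" using q r by (simp add: r_def)
  have d: "norm (1 - q) \<ge> 4 * (1 - r)" using far by (simp add: r_def)
  have ne: "q \<noteq> 1" using q1 by auto
  have x0: "complex_of_real (pi ^ 2) / complex_of_real u = complex_of_real (pi ^ 2 / u)" by simp
  have "pi ^ 2 / u \<ge> 1"
  proof -
    have "pi ^ 2 \<ge> 3 ^ 2" using pi_gt3 by (intro power_mono) auto
    then show ?thesis using u by (simp add: le_divide_eq)
  qed
  then have "norm (overpartition_gf (exp (- complex_of_real u))) \<le> 2 * exp (pi ^ 2 / u / 4)"
    using overpartition_gf_via_triangular(2)[of "complex_of_real u"] u unfolding x0 by simp
  moreover have "exp (- complex_of_real u) = complex_of_real r" by (simp add: r_def exp_of_real[symmetric])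
  ultimately have gr: "norm (overpartition_gf (complex_of_real r)) \<le> 2 * exp (pi ^ 2 / u / 4)" by simp
  have ex: "- 2 * (r / (1 - r) - Re (q / (1 - q))) \<le> - (15 / 8 / u)"
  proof -
    have A: "2 * Re (q / (1 - q)) = (1 - r ^ 2) / norm (1 - q) ^ 2 - 1"
      using Re_geometric[OF ne] q by (simp add: r_def)
    have B: "2 * (r / (1 - r)) = (1 + r) / (1 - r) - 1" using r by (simp add: field_simps)
    have r2: "1 - r ^ 2 \<ge> 0" using r by (simp add: power_le_one)
    have "(1 - r ^ 2) / norm (1 - q) ^ 2 \<le> (1 - r ^ 2) / (4 * (1 - r)) ^ 2"
      using d r r2 ne by (intro divide_left_mono power_mono mult_pos_pos) auto
    also have "\<dots> = (1 + r) / (1 - r) / 16"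
    proof -
      have "1 - r ^ 2 = (1 - r) * (1 + r)" "(4 * (1 - r)) ^ 2 = (1 - r) * (16 * (1 - r))"
        by (simp_all add: power2_eq_square algebra_simps)
      then show ?thesis using r by simp
    qed
    finally have "(1 - r ^ 2) / norm (1 - q) ^ 2 \<le> (1 + r) / (1 - r) / 16" .
    then have C: "- 2 * (r / (1 - r) - Re (q / (1 - q))) \<le> - (15 / 16 * ((1 + r) / (1 - r)))"
    proof -
      have "- 2 * (S - R) \<le> - (15 / 16 * Q)" if "P \<le> Q / 16" "2 * R = P - 1" "2 * S = Q - 1" for P Q R S :: real
      proof -
        have "- 2 * (S - R) = P - Q" using that(2,3) by (simp add: algebra_simps)
        also have "\<dots> \<le> - (15 / 16 * Q)" using that(1) by (simp add: field_simps)
        finally show ?thesis .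
      qed
      from this[OF _ A B] \<open>(1 - r ^ 2) / norm (1 - q) ^ 2 \<le> (1 + r) / (1 - r) / 16\<close> show ?thesis by blast
    qed
    have "1 - r \<le> u * (1 + r) / 2" using one_minus_exp_neg_bounds(3)[OF u(1)] by (simp add: r_def)
    then have "2 / u \<le> (1 + r) / (1 - r)" using r u by (simp add: field_simps)
    then have "15 / 16 * (2 / u) \<le> 15 / 16 * ((1 + r) / (1 - r))" by (intro mult_left_mono) auto
    with C show ?thesis by simp
  qed
  have "norm (overpartition_gf q) \<le> norm (overpartition_gf (complex_of_real r)) * exp (- 2 * (r / (1 - r) - Re (q / (1 - q))))"
    using norm_overpartition_gf_le[OF q1] q by (simp add: r_def)
  also have "\<dots> \<le> (2 * exp (pi ^ 2 / u / 4)) * exp (- (15 / 8 / u))"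
    using gr ex by (intro mult_mono) auto
  also have "\<dots> = 2 * exp ((pi ^ 2 / 4 - 15 / 8) / u)"
    by (simp add: exp_add[symmetric] mult.assoc diff_divide_distrib)
  finally show "norm (overpartition_gf q) \<le> 2 * exp ((pi ^ 2 / 4 - 15 / 8) / u)" .
  have "norm (main_gf J q) \<le> exp (pi ^ 2 / (4 * norm (1 - q))) / 2" by (rule norm_main_gf_le[OF q1])
  also have "pi ^ 2 / (4 * norm (1 - q)) \<le> 21 / 20 * pi ^ 2 / 16 / u"
  proof -
    have "1 - r \<ge> u / (1 + u)" using one_minus_exp_neg_bounds(2)[OF u(1)] by (simp add: r_def)
    moreover have "u / (1 + u) \<ge> u / (21 / 20)" using u by (intro divide_left_mono) auto
    ultimately have "1 - r \<ge> u / (21 / 20)" by (rule order_trans[rotated])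
    then have "4 * (1 - r) \<ge> 4 * (u / (21 / 20))" by (intro mult_left_mono) auto
    then have "norm (1 - q) \<ge> 4 * (u / (21 / 20))" using d by (rule order_trans)
    then have "pi ^ 2 / (4 * norm (1 - q)) \<le> pi ^ 2 / (4 * (4 * (u / (21 / 20))))"
      using u ne by (intro divide_left_mono mult_pos_pos) auto
    then show ?thesis by (simp add: field_simps)
  qed
  then have "exp (pi ^ 2 / (4 * norm (1 - q))) / 2 \<le> exp (21 / 20 * pi ^ 2 / 16 / u) / 2" by simp
  finally show "norm (main_gf J q) \<le> exp (21 / 20 * pi ^ 2 / 16 / u) / 2" .
qed

lemma overpartition_gf_minus_main_gf:
  fixes q :: complex
  assumes u: "0 < u" "u \<le> 1 / 20" "8 * u < 2 / 5" and q: "norm q = exp (- u)"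
  shows "norm (overpartition_gf q - main_gf J q) \<le>
     2 * exp ((pi ^ 2 / 4 - 15 / 8) / u) + exp (21 / 20 * pi ^ 2 / 16 / u) / 2 + 404 + \<bar>dawson_tail (pi ^ 2 / u) (Suc J)\<bar>"
proof (cases "norm (1 - q) \<ge> 4 * (1 - exp (- u))")
  case True
  then show ?thesis
    using generating_functions_far_from_1(1)[OF u(1,2) q True] generating_functions_far_from_1(2)[OF u(1,2) q True, of J] norm_triangle_ineq4[of "overpartition_gf q" "main_gf J q"]
    by linarith
next
  case False
  \<comment> \<open>The principal logarithm: |s| \<le> 2 |q - 1| < 8 u stays below the 2/5 allowed
    near 1, and Re x = pi^2 u / |s|^2 is still at least 1.\<close>
  define s where "s = - Ln q"
  have qnz: "q \<noteq> 0" using q by auto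
  have "norm (q - 1) < 4 * u" using False one_minus_exp_neg_bounds(1)[OF u(1)] by (simp add: norm_minus_commute)
  then have "norm (q - 1) < 1 / 2" using u by linarith
  then have "norm (Ln (1 + (q - 1))) \<le> 2 * norm (q - 1)" by (rule norm_Ln_le)
  then have ns: "norm s < 8 * u" using \<open>norm (q - 1) < 4 * u\<close> by (simp add: s_def)
  have es: "exp (- s) = q" using qnz by (simp add: s_def)
  have Res: "Re s = u" using qnz q by (simp add: s_def)
  have lb: "norm s \<ge> u" using complex_Re_le_cmod[of s] Res by simp
  define x where "x = complex_of_real (pi ^ 2) / s"
  have nx: "norm x \<le> pi ^ 2 / u"
  proof -
    have "norm x = pi ^ 2 / norm s" by (simp add: x_def norm_divide norm_power)
    also have "\<dots> \<le> pi ^ 2 / u" using lb u by (intro divide_left_mono mult_pos_pos) auto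
    finally show ?thesis .
  qed
  have "Re x = pi ^ 2 * u / norm s ^ 2"
    unfolding x_def Re_divide' by (simp add: Res)
  moreover have "pi ^ 2 * u / norm s ^ 2 \<ge> 1"
  proof -
    have "norm s ^ 2 \<le> (8 * u) ^ 2" using ns by (intro power_mono) auto
    also have "\<dots> = 64 * u * u" by (simp add: power2_eq_square)
    also have "\<dots> \<le> 9 * u" using u by (intro mult_right_mono) auto
    also have "\<dots> \<le> pi ^ 2 * u"
    proof -
      have "(3::real) ^ 2 \<le> pi ^ 2" using pi_gt3 by (intro power_mono) auto
      then show ?thesis using u by (intro mult_right_mono) auto
    qed
    finally show ?thesis using lb u by (subst le_divide_eq_1_pos) (auto intro: zero_less_power)
  qed
  ultimately have Rx: "Re x \<ge> 1" by simp
  have "norm (overpartition_gf (exp (- s)) - main_gf J (exp (- s))) \<le> 404 + dawson_tail (pi ^ 2 / u) (Suc J)"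
    using Rx nx ns u Res unfolding x_def by (intro overpartition_gf_near_1) auto
  moreover have "exp ((pi ^ 2 / 4 - 15 / 8) / u) \<ge> 0" "exp (21 / 20 * pi ^ 2 / 16 / u) \<ge> 0" by auto
  ultimately show ?thesis unfolding es by linarith
qed

section \<open>From the circle to the coefficients\<close>

lemma cauchy_coeff_bound:
  fixes f :: "nat \<Rightarrow> complex"
  assumes f: "\<And>z. norm z < 1 \<Longrightarrow> summable (\<lambda>n. f n * z ^ n)"
    and r: "0 < r" "r < 1" and B: "\<And>z. norm z = r \<Longrightarrow> norm (\<Sum>n. f n * z ^ n) \<le> B"
  shows "norm (f n) \<le> B / r ^ n"
proof -
  define A where "A = Abs_fps f"
  have rad: "fps_conv_radius A \<ge> 1"
    unfolding fps_conv_radius_def A_def by (rule conv_radius_ge_1) (simp add: f)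
  have hol: "eval_fps A holomorphic_on ball 0 1"
    using rad by (intro holomorphic_on_eval_fps) (simp add: ball_eball_mono one_ereal_def)
  have "norm ((deriv ^^ n) (eval_fps A) 0) \<le> fact n * B / r ^ n"
  proof (rule Cauchy_inequality)
    show "eval_fps A holomorphic_on ball 0 r" by (rule holomorphic_on_subset[OF hol]) (use r in auto)
    show "continuous_on (cball 0 r) (eval_fps A)"
      by (rule continuous_on_subset[OF holomorphic_on_imp_continuous_on[OF hol]]) (use r in auto)
  qed (use r B in \<open>auto simp: eval_fps_def A_def\<close>)
  moreover have "fps_nth A n = (deriv ^^ n) (eval_fps A) 0 / fact n"
    by (rule fps_nth_conv_deriv) (rule less_le_trans[OF _ rad], simp)
  then have "norm (f n) = norm ((deriv ^^ n) (eval_fps A) 0) / fact n"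
    by (simp add: A_def norm_divide)
  ultimately have "norm (f n) \<le> (fact n * B / r ^ n) / fact n"
    by (simp only:) (intro divide_right_mono, auto)
  then show ?thesis by simp
qed

lemma overpartition_minus_main_coeff:
  assumes u: "0 < u" "u \<le> 1 / 20" "8 * u < 2 / 5"
  shows "\<bar>real (overpartition_count n) - main_coeff J n\<bar> \<le>
    (2 * exp ((pi ^ 2 / 4 - 15 / 8) / u) + exp (21 / 20 * pi ^ 2 / 16 / u) / 2 + 404 + \<bar>dawson_tail (pi ^ 2 / u) (Suc J)\<bar>) * exp (u * real n)"
proof -
  let ?B = "2 * exp ((pi ^ 2 / 4 - 15 / 8) / u) + exp (21 / 20 * pi ^ 2 / 16 / u) / 2 + 404 + \<bar>dawson_tail (pi ^ 2 / u) (Suc J)\<bar>"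
  define f where "f n = complex_of_real (real (overpartition_count n) - main_coeff J n)" for n
  have sums: "(\<lambda>n. f n * z ^ n) sums (overpartition_gf z - main_gf J z)" if z: "norm z < 1" for z
  proof -
    have 1: "(\<lambda>n. of_nat (overpartition_count n) * z ^ n) sums overpartition_gf z"
      unfolding overpartition_gf_def by (rule summable_sums[OF summable_norm_cancel[OF overpartition_summable[OF z]]])
    have "(\<lambda>n. \<Sum>j<J. of_real (main_weight j / fact j) * (of_nat (n ^ j) * z ^ n)) sums main_gf J z"
      unfolding main_gf_def polylog_def
      by (intro sums_sum sums_mult summable_sums polylog_summable z)
    moreover have "(\<Sum>j<J. of_real (main_weight j / fact j) * (of_nat (n ^ j) * z ^ n)) = of_real (main_coeff J n) * z ^ n" for n
      unfolding main_coeff_def of_real_sum sum_distrib_right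
      by (intro sum.cong refl) simp
    ultimately have 2: "(\<lambda>n. of_real (main_coeff J n) * z ^ n) sums main_gf J z" by simp
    have "of_nat (overpartition_count n) * z ^ n - of_real (main_coeff J n) * z ^ n = f n * z ^ n" for n
      by (simp add: f_def left_diff_distrib)
    with sums_diff[OF 1 2] show ?thesis by simp
  qed
  have "norm (f n) \<le> ?B / exp (- u) ^ n"
  proof (rule cauchy_coeff_bound)
    show "norm (\<Sum>n. f n * z ^ n) \<le> ?B" if "norm z = exp (- u)" for z
    proof -
      have "(\<Sum>n. f n * z ^ n) = overpartition_gf z - main_gf J z"
        using sums[of z] that u by (simp add: sums_iff)
      then show ?thesis using overpartition_gf_minus_main_gf[OF u that, of J] by simp
    qed
  qed (use u sums in \<open>auto simp: sums_iff\<close>)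
  also have "exp (- u) ^ n = exp (real n * - u)" by (rule exp_of_nat_mult[symmetric])
  also have "?B / exp (real n * - u) = ?B * exp (u * real n)"
    by (simp add: exp_minus field_simps)
  finally show ?thesis unfolding f_def norm_of_real .
qed

lemma cosh_sums_real: "(\<lambda>k. y ^ (2 * k) / fact (2 * k)) sums cosh (y :: real)"
proof -
  have "(\<lambda>n. if even n then y ^ n /\<^sub>R fact n else 0) sums cosh y" by (rule cosh_converges)
  then have "(\<lambda>k. if even (2 * k) then y ^ (2 * k) /\<^sub>R fact (2 * k) else 0) sums cosh y"
    by (subst sums_mono_reindex) (auto simp: strict_mono_def elim!: evenE)
  then show ?thesis by (simp add: divide_inverse mult.commute)
qed

lemma sinh_sums_real: "(\<lambda>k. y ^ (2 * k + 1) / fact (2 * k + 1)) sums sinh (y :: real)"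
proof -
  have "(\<lambda>n. if even n then 0 else y ^ n /\<^sub>R fact n) sums sinh y" by (rule sinh_converges)
  then have "(\<lambda>k. if even (2 * k + 1) then 0 else y ^ (2 * k + 1) /\<^sub>R fact (2 * k + 1)) sums sinh y"
    by (subst sums_mono_reindex) (auto simp: strict_mono_def elim!: oddE)
  then show ?thesis by (simp add: divide_inverse mult.commute)
qed

text \<open>The difference of the series of cosh y and sinh y / y has the terms y^(2k) 2k / (2k +
  1)!, vanishing for k = 0; with k = j + 1 and y^2 = pi^2 n they match the weights. The limit is the
  derivative of sinh (pi sqrt n) / sqrt n in n, divided by 2 pi: a Bessel function of order
  3/2.\<close>

lemma main_coeff_limit:
  fixes n :: nat
  assumes n: "n > 0"
  defines "X \<equiv> sqrt (real n)"
  shows "(\<lambda>J. main_coeff J n) \<longlonglongrightarrow> (cosh (pi * X) - sinh (pi * X) / (pi * X)) / (4 * X ^ 2)"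
proof -
  have X: "X > 0" "X ^ 2 = real n" using n by (auto simp: X_def)
  define y where "y = pi * X"
  have y: "y > 0" using X by (simp add: y_def)
  have "(\<lambda>k. y ^ (2 * k) / fact (2 * k) - y ^ (2 * k + 1) / fact (2 * k + 1) / y) sums (cosh y - sinh y / y)"
    by (intro sums_diff sums_divide cosh_sums_real sinh_sums_real)
  then have "(\<lambda>j. y ^ (2 * Suc j) / fact (2 * Suc j) - y ^ (2 * Suc j + 1) / fact (2 * Suc j + 1) / y) sums (cosh y - sinh y / y)"
    using y by (subst sums_Suc_iff) simp
  then have "(\<lambda>j. (y ^ (2 * Suc j) / fact (2 * Suc j) - y ^ (2 * Suc j + 1) / fact (2 * Suc j + 1) / y) / (4 * X ^ 2)) sums ((cosh y - sinh y / y) / (4 * X ^ 2))"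
    by (rule sums_divide)
  moreover have "(y ^ (2 * Suc j) / fact (2 * Suc j) - y ^ (2 * Suc j + 1) / fact (2 * Suc j + 1) / y) / (4 * X ^ 2) = main_weight j / fact j * real (n ^ j)" for j
  proof -
    define F where "F = (fact (2 * Suc j) :: real)"
    have F: "F > 0" by (simp add: F_def)
    have f1: "fact (2 * Suc j + 1) = (2 * real j + 3) * F" by (simp add: F_def)
    have p: "2 * real j + 3 > 0" by linarith
    have 1: "y ^ (2 * Suc j) / F - y ^ (2 * Suc j + 1) / ((2 * real j + 3) * F) / y = y ^ (2 * Suc j) * ((2 * (real j + 1)) / ((2 * real j + 3) * F))"
      using y F p by (simp add: divide_simps) (simp add: algebra_simps)
    have 2: "y ^ (2 * Suc j) = pi ^ (2 * Suc j) * X ^ 2 * real (n ^ j)"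
    proof -
      have "y ^ (2 * Suc j) = pi ^ (2 * Suc j) * (X ^ 2) ^ Suc j"
        unfolding y_def power_mult_distrib power_mult[of X, symmetric] by simp
      then show ?thesis unfolding X(2) by simp
    qed
    have 3: "main_weight j / fact j = pi ^ (2 * Suc j) * ((real j + 1) / ((2 * real j + 3) * F)) / 2"
      unfolding main_weight_def dawson_coef_def f1 by (simp add: mult.commute del: power_Suc mult_Suc_right)
    have cancel: "(P * w * M * ((2 * a) / D)) / (4 * w) = P * (a / D) / 2 * M" if "w \<noteq> 0" for P w M a D :: real
      using that by (simp add: mult_ac)
    show ?thesis unfolding f1 F_def[symmetric] 1 3 unfolding 2 by (rule cancel) (use X n in simp)
  qed
  ultimately have "(\<lambda>j. main_weight j / fact j * real (n ^ j)) sums ((cosh y - sinh y / y) / (4 * X ^ 2))" by simp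
  then show ?thesis unfolding sums_def main_coeff_def y_def .
qed

theorem overpartition_asymptotic:
  fixes n :: nat
  defines "X \<equiv> sqrt (real n)"
  assumes X: "X \<ge> 32"
  shows "\<bar>real (overpartition_count n) - (cosh (pi * X) - sinh (pi * X) / (pi * X)) / (4 * X ^ 2)\<bar> \<le> 3 * exp ((pi / 2 + 42 / 100) * X)"
proof -
  \<comment> \<open>The minimum of pi^2 / (4 u) + u X^2. For X \<ge> 32 it gives u \<le> pi / 64,
    which just satisfies 8 u < 2/5.\<close>
  define u where "u = pi / (2 * X)"
  have X2: "X ^ 2 = real n" by (simp add: X_def)
  have n: "n > 0" using X by (cases n) (auto simp: X_def)
  have pi_b: "pi < 31416 / 10000" "pi > 31415 / 10000" using pi_approx by simp_all
  have u: "0 < u" "u \<le> 1 / 20" "8 * u < 2 / 5"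
    using X pi_b by (auto simp: u_def field_simps)
  define C where "C = 2 * exp ((pi ^ 2 / 4 - 15 / 8) / u) + exp (21 / 20 * pi ^ 2 / 16 / u) / 2 + 404"
  have "\<bar>real (overpartition_count n) - (cosh (pi * X) - sinh (pi * X) / (pi * X)) / (4 * X ^ 2)\<bar> \<le> (C + \<bar>0\<bar>) * exp (u * real n)"
  \<comment> \<open>Here \<open>J\<close> goes to infinity with \<open>u\<close> and
    \<open>n\<close> fixed, so the Taylor remainder disappears.\<close>
  proof (rule tendsto_le[OF sequentially_bot])
    show "(\<lambda>J. (C + \<bar>dawson_tail (pi ^ 2 / u) (Suc J)\<bar>) * exp (u * real n)) \<longlonglongrightarrow> (C + \<bar>0\<bar>) * exp (u * real n)"
      by (intro tendsto_mult tendsto_add tendsto_rabs tendsto_const LIMSEQ_Suc dawson_tail_tendsto)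
    show "(\<lambda>J. \<bar>real (overpartition_count n) - main_coeff J n\<bar>) \<longlonglongrightarrow> \<bar>real (overpartition_count n) - (cosh (pi * X) - sinh (pi * X) / (pi * X)) / (4 * X ^ 2)\<bar>"
      unfolding X_def by (intro tendsto_rabs tendsto_diff tendsto_const main_coeff_limit n)
    show "\<forall>\<^sub>F J in sequentially. \<bar>real (overpartition_count n) - main_coeff J n\<bar> \<le> (C + \<bar>dawson_tail (pi ^ 2 / u) (Suc J)\<bar>) * exp (u * real n)"
      using overpartition_minus_main_coeff[OF u, of n] by (intro always_eventually allI) (simp add: C_def)
  qed
  also have "\<dots> = C * exp (pi / 2 * X)"
  proof -
    have "u * real n = pi / 2 * X" using X unfolding X2[symmetric] u_def by (simp add: power2_eq_square)
    then show ?thesis by simp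
  qed
  \<comment> \<open>The two exponents are about 0.378 X and 0.413 X; 0.42 exceeds both. Since exp
    (0.42 X) \<ge> 1024, the constant 404 is at most half of it, and 2 + 1/2 + 1/2 = 3.\<close>
  also have "C \<le> 3 * exp (42 / 100 * X)"
  proof -
    have "(pi ^ 2 / 4 - 15 / 8) / u = (pi / 2 - 15 / (4 * pi)) * X"
      using X by (simp add: u_def field_simps power2_eq_square)
    also have "\<dots> \<le> 42 / 100 * X"
    proof (rule mult_right_mono)
      have "15 / (4 * pi) \<ge> 1193 / 1000" using pi_b by (simp add: field_simps)
      then show "pi / 2 - 15 / (4 * pi) \<le> 42 / 100" using pi_b by linarith
    qed (use X in simp)
    finally have 1: "exp ((pi ^ 2 / 4 - 15 / 8) / u) \<le> exp (42 / 100 * X)" by simp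
    have "21 / 20 * pi ^ 2 / 16 / u = 21 / 160 * pi * X"
      using X by (simp add: u_def field_simps power2_eq_square)
    also have "\<dots> \<le> 42 / 100 * X" using pi_b X by (intro mult_right_mono) auto
    finally have 2: "exp (21 / 20 * pi ^ 2 / 16 / u) \<le> exp (42 / 100 * X)" by simp
    have "(2::real) ^ 10 \<le> exp 1 ^ 10" using exp_ge_add_one_self[of 1] by (intro power_mono) auto
    also have "\<dots> = exp (real 10 * 1)" by (rule exp_of_nat_mult[symmetric])
    also have "\<dots> \<le> exp (42 / 100 * X)" using X by simp
    finally have 3: "1024 \<le> exp (42 / 100 * X)" by simp
    show ?thesis using 1 2 3 unfolding C_def by linarith
  qed
  then have "C * exp (pi / 2 * X) \<le> 3 * exp (42 / 100 * X) * exp (pi / 2 * X)"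
    by (intro mult_right_mono) auto
  also have "\<dots> = 3 * exp ((pi / 2 + 42 / 100) * X)"
    by (simp add: exp_add[symmetric] distrib_right add.commute)
  finally show ?thesis .
qed

section \<open>Second differences of the asymptotic formula\<close>

text \<open>The asymptotic formula with the parts exp (- pi X) of cosh and sinh removed, which makes
  ratios of neighbouring values factor.\<close>

definition main_term :: "real \<Rightarrow> real" where
  "main_term X = exp (pi * X) * (pi * X - 1) / (8 * pi * X ^ 3)"

lemma pi_bounds: "pi < 31416 / 10000" "pi > 31415 / 10000"
  using pi_approx by simp_all

text \<open>With X = 32 t, the inequality t \<le> exp (t - 1) reduces everything to t = 1, where it
  is numerical.\<close>

lemma exp_dominates_power:
  assumes X: "X \<ge> (32::real)"
  shows "X ^ 8 * exp (- (115 / 100) * X) \<le> 1 / 2000"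
proof -
  define t where "t = X / 32"
  have t: "t \<ge> 1" "X = 32 * t" using X by (auto simp: t_def)
  have "t ^ 8 \<le> exp (t - 1) ^ 8"
    using exp_ge_add_one_self[of "t - 1"] t by (intro power_mono) auto
  also have "\<dots> = exp (8 * (t - 1))" using exp_of_nat_mult[of 8 "t - 1"] by simp
  finally have "X ^ 8 * exp (- (115 / 100) * X) \<le> 32 ^ 8 * exp (8 * (t - 1)) * exp (- (115 / 100) * X)"
    unfolding t(2) power_mult_distrib by (intro mult_right_mono mult_left_mono) auto
  also have "\<dots> = 32 ^ 8 * exp (8 * (t - 1) + - (115 / 100) * X)" by (simp only: mult.assoc exp_add)
  also have "\<dots> \<le> 32 ^ 8 * exp (- 36)"
    using t by (intro mult_left_mono) auto
  also have "\<dots> = 32 ^ 8 / exp 1 ^ 36"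
    using exp_of_nat_mult[of 36 "1::real"] by (simp add: exp_minus divide_inverse)
  also have "\<dots> \<le> 32 ^ 8 / (27 / 10) ^ 36"
  proof (intro divide_left_mono power_mono mult_pos_pos)
    have "\<bar>exp 1 - 5837465777 / 2147483648\<bar> \<le> (inverse (2 ^ 32) :: real)" by (rule e_approx_32)
    then have "exp 1 \<ge> 5837465777 / 2147483648 - (inverse (2 ^ 32) :: real)" by linarith
    moreover have "5837465777 / 2147483648 - (inverse (2 ^ 32) :: real) \<ge> 27 / 10" by simp
    ultimately show "27 / 10 \<le> exp (1::real)" by linarith
  qed auto
  also have "(32::real) ^ 8 / (27 / 10) ^ 36 \<le> 1 / 2000" by (simp add: power_divide divide_simps)
  finally show ?thesis .
qed

text \<open>Relative to \<open>main_term\<close> the error decays like X^2 exp ((0.42 - pi / 2) X).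
  Only X^(-6) with a small constant is kept, because this is the order of the margin
  \<delta>(n)^2.\<close>

lemma overpartition_main_term:
  fixes N :: nat
  defines "X \<equiv> sqrt (real N)"
  assumes X: "X \<ge> 32"
  obtains e where "real (overpartition_count N) = main_term X * (1 + e)" "\<bar>e\<bar> \<le> 1 / (50 * X ^ 6)"
proof -
  have "pi * X \<ge> 3 * 32" using X pi_bounds by (intro mult_mono) auto
  then have M: "main_term X > 0"
    unfolding main_term_def using X by (intro divide_pos_pos mult_pos_pos) auto
  define e where "e = (real (overpartition_count N) - main_term X) / main_term X"
  have "\<bar>real (overpartition_count N) - main_term X\<bar> \<le> 4 * exp ((pi / 2 + 42 / 100) * X)"
  proof -
    have "(cosh (pi * X) - sinh (pi * X) / (pi * X)) / (4 * X ^ 2) - main_term X = exp (- (pi * X)) * (1 + 1 / (pi * X)) / (8 * X ^ 2)"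
      using X by (simp add: main_term_def cosh_def sinh_def field_simps power2_eq_square power3_eq_cube)
    moreover have "\<bar>exp (- (pi * X)) * (1 + 1 / (pi * X)) / (8 * X ^ 2)\<bar> \<le> 1"
    proof -
      have pX: "1 \<le> pi * X" using mult_mono[of 1 pi 1 X] pi_bounds X by simp
      have U: "exp (- (pi * X)) * (1 + 1 / (pi * X)) / (8 * X ^ 2) \<le> 1 * (1 + 1) / (8 * 1 ^ 2)"
        using X pX by (intro frac_le mult_mono add_mono mult_left_mono power_mono) auto
      have L: "exp (- (pi * X)) * (1 + 1 / (pi * X)) / (8 * X ^ 2) \<ge> 0" using X by simp
      show ?thesis unfolding abs_of_nonneg[OF L] by (rule order_trans[OF U]) simp
    qed
    moreover have "exp ((pi / 2 + 42 / 100) * X) \<ge> 1" using X by simp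
    ultimately show ?thesis using overpartition_asymptotic[of N] X unfolding X_def by linarith
  qed
  then have "\<bar>e\<bar> \<le> 4 * exp ((pi / 2 + 42 / 100) * X) / main_term X"
    unfolding e_def abs_divide using M by (simp add: divide_right_mono)
  also have "\<dots> \<le> 4 * exp ((pi / 2 + 42 / 100) * X) / (exp (pi * X) / (10 * X ^ 2))"
  proof (intro divide_left_mono mult_pos_pos M)
    have "(pi * X - 1) / (8 * pi * X ^ 3) = (1 - 1 / (pi * X)) / (8 * X ^ 2)"
      using X by (simp add: field_simps power2_eq_square power3_eq_cube)
    moreover have "1 / (pi * X) \<le> 1 / (3 * 32)"
      using X pi_bounds by (intro divide_left_mono mult_mono mult_pos_pos) auto
    then have "(1 - 1 / (pi * X)) / (8 * X ^ 2) \<ge> (8 / 10) / (8 * X ^ 2)"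
      by (intro divide_right_mono) auto
    ultimately have "(pi * X - 1) / (8 * pi * X ^ 3) \<ge> 1 / (10 * X ^ 2)" by simp
    then have "exp (pi * X) * ((pi * X - 1) / (8 * pi * X ^ 3)) \<ge> exp (pi * X) * (1 / (10 * X ^ 2))"
      by (intro mult_left_mono) auto
    then show "exp (pi * X) / (10 * X ^ 2) \<le> main_term X" by (simp add: main_term_def)
  qed (use X in auto)
  also have "\<dots> = 40 * X ^ 2 * exp ((42 / 100 - pi / 2) * X)"
    by (simp add: exp_diff exp_add distrib_right left_diff_distrib) (simp add: field_simps flip: exp_add)
  also have "\<dots> \<le> 40 * X ^ 2 * exp (- (115 / 100) * X)"
  proof -
    have "(42 / 100 - pi / 2) * X \<le> - (115 / 100) * X"
      using X pi_bounds by (intro mult_right_mono) auto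
    then show ?thesis by (intro mult_left_mono) auto
  qed
  also have "\<dots> = 40 * (X ^ 8 * exp (- (115 / 100) * X)) / X ^ 6"
    using X by (simp add: field_simps flip: power_add)
  also have "\<dots> \<le> 40 * (1 / 2000) / X ^ 6"
    using X exp_dominates_power[OF X] by (intro divide_right_mono mult_left_mono) auto
  finally have "\<bar>e\<bar> \<le> 1 / (50 * X ^ 6)" by simp
  moreover have "real (overpartition_count N) = main_term X * (1 + e)"
    using M by (simp add: e_def field_simps)
  ultimately show ?thesis using that by blast
qed

section \<open>Expansion of the ratio of neighbouring main terms\<close>

text \<open>With k = h^4, the product c = \<open>Xp * Xm * h^2\<close> satisfies c^2 = 1 - k, and s
  = h (\<open>Xp + Xm\<close>) satisfies s^2 = 2 + 2 c. Each bound follows by squaring a truncated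
  expansion in k.\<close>

lemma sqrt_neighbour_bounds:
  fixes X :: real
  assumes X: "X \<ge> 32"
  defines "h \<equiv> 1 / X" and "Xp \<equiv> sqrt (X ^ 2 + 1)" and "Xm \<equiv> sqrt (X ^ 2 - 1)"
  shows "h ^ 4 / 2 \<le> 1 - Xp * Xm * h ^ 2" "1 - Xp * Xm * h ^ 2 \<le> h ^ 4 / 2 + h ^ 8 / 2"
    and "h ^ 3 / 4 \<le> 2 * X - Xp - Xm" "2 * X - Xp - Xm \<le> h ^ 3 / 4 + h ^ 7 / 2"
proof -
  define k where "k = h ^ 4"
  have h: "0 < h" "h \<le> 1 / 32" using X by (auto simp: h_def divide_simps)
  have hX: "h * X = 1" using X by (simp add: h_def)
  have k: "0 < k" "k \<le> 1"
    using h power_le_one[of h 4] by (auto simp: k_def)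
  have X2: "X ^ 2 \<ge> 1" using X by (intro one_le_power) auto
  define c where "c = Xp * Xm * h ^ 2"
  have c0: "c \<ge> 0" using X2 by (simp add: c_def Xp_def Xm_def)
  have c2: "c ^ 2 = 1 - k"
  proof -
    have "c ^ 2 = (X ^ 2 + 1) * (X ^ 2 - 1) * h ^ 4"
      using X2 by (simp add: c_def power_mult_distrib Xp_def Xm_def flip: power_mult)
    also have "\<dots> = (h * X) ^ 4 - h ^ 4" by (simp add: power_mult_distrib algebra_simps power_numeral_reduce)
    finally show ?thesis by (simp add: hX k_def)
  qed
  have c_up: "c \<le> 1 - k / 2"
  proof (rule power2_le_imp_le)
    have "(1 - k / 2) ^ 2 = 1 - k + (k / 2) ^ 2" by (simp add: power2_eq_square algebra_simps)
    then show "c ^ 2 \<le> (1 - k / 2) ^ 2" using c2 by simp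
  qed (use k in simp)
  have c_lo: "1 - k / 2 - k ^ 2 / 2 \<le> c"
  proof (rule power2_le_imp_le)
    have "(1 - k / 2 - k ^ 2 / 2) ^ 2 = 1 - k - k ^ 2 * (1 - (1 + k) ^ 2 / 4)" by (simp add: power2_eq_square field_simps)
    moreover have "(1 + k) ^ 2 \<le> 2 ^ 2" using k by (intro power_mono) auto
    then have "k ^ 2 * (1 - (1 + k) ^ 2 / 4) \<ge> 0" by (intro mult_nonneg_nonneg) auto
    ultimately show "(1 - k / 2 - k ^ 2 / 2) ^ 2 \<le> c ^ 2" using c2 by simp
  qed (rule c0)
  have k8: "k ^ 2 = h ^ 8" by (simp add: k_def flip: power_mult)
  show "h ^ 4 / 2 \<le> 1 - Xp * Xm * h ^ 2" "1 - Xp * Xm * h ^ 2 \<le> h ^ 4 / 2 + h ^ 8 / 2"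
    using c_up c_lo unfolding c_def[symmetric] k8[symmetric] k_def[symmetric] by linarith+
  define s where "s = h * (Xp + Xm)"
  have s0: "s \<ge> 0" using h X2 by (simp add: s_def Xp_def Xm_def)
  have s2: "s ^ 2 = 2 + 2 * c"
  proof -
    have "s ^ 2 = h ^ 2 * (Xp ^ 2 + Xm ^ 2) + 2 * c" by (simp add: s_def c_def power2_eq_square algebra_simps)
    also have "Xp ^ 2 + Xm ^ 2 = 2 * X ^ 2" using X2 by (simp add: Xp_def Xm_def)
    also have "h ^ 2 * (2 * X ^ 2) = 2 * (h * X) ^ 2" by (simp add: power_mult_distrib)
    finally show ?thesis by (simp add: hX)
  qed
  have s_up: "s \<le> 2 - k / 4"
  proof (rule power2_le_imp_le)
    have "(2 - k / 4) ^ 2 = 4 - k + (k / 4) ^ 2" by (simp add: power2_eq_square algebra_simps)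
    moreover have "(k / 4) ^ 2 \<ge> 0" by simp
    ultimately show "s ^ 2 \<le> (2 - k / 4) ^ 2" using s2 c_up by linarith
  qed (use k in simp)
  have s_lo: "2 - k / 4 - k ^ 2 / 2 \<le> s"
  proof (rule power2_le_imp_le)
    have "(2 - k / 4 - k ^ 2 / 2) ^ 2 = 4 - k - k ^ 2 - k ^ 2 * (1 - (1 / 4 + k / 2) ^ 2)" by (simp add: power2_eq_square field_simps)
    moreover have "(1 / 4 + k / 2) ^ 2 \<le> 1 ^ 2" using k by (intro power_mono) auto
    then have "k ^ 2 * (1 - (1 / 4 + k / 2) ^ 2) \<ge> 0" by (intro mult_nonneg_nonneg) auto
    ultimately show "(2 - k / 4 - k ^ 2 / 2) ^ 2 \<le> s ^ 2" using s2 c_lo by linarith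
  qed (rule s0)
  have eq: "2 * X - Xp - Xm = (2 - s) / h"
    using h by (simp add: s_def field_simps) (simp add: algebra_simps flip: hX)
  have k3: "k / h = h ^ 3" "k ^ 2 / h = h ^ 7" using h by (simp_all add: k_def divide_simps flip: power_mult) (simp_all add: eval_nat_numeral mult_ac)
  have "(k / 4) / h \<le> (2 - s) / h" using s_up h by (intro divide_right_mono) auto
  then show "h ^ 3 / 4 \<le> 2 * X - Xp - Xm" unfolding eq k3(1)[symmetric] by (simp add: mult.commute)
  have "(2 - s) / h \<le> (k / 4 + k ^ 2 / 2) / h" using s_lo h by (intro divide_right_mono) auto
  also have "\<dots> = h ^ 3 / 4 + h ^ 7 / 2" unfolding k3[symmetric] by (simp add: add_divide_distrib)
  finally show "2 * X - Xp - Xm \<le> h ^ 3 / 4 + h ^ 7 / 2" unfolding eq .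
qed

text \<open>An exact identity: the factors come from the exponentials, the cubes and the linear
  factors pi X - 1 of \<open>main_term\<close>. The last is written as 1 minus a small quantity, in
  terms of the same \<open>\<tau>\<close> and \<open>c\<close>, so that only these two need be
  expanded.\<close>

lemma main_term_ratio:
  fixes X :: real
  assumes X: "X \<ge> 32"
  defines "h \<equiv> 1 / X" and "Xp \<equiv> sqrt (X ^ 2 + 1)" and "Xm \<equiv> sqrt (X ^ 2 - 1)"
  defines "\<tau> \<equiv> pi * (2 * X - Xp - Xm)" and "c \<equiv> Xp * Xm * h ^ 2"
  shows "main_term Xp * main_term Xm / main_term X ^ 2 =
     exp (- \<tau>) * (1 / c ^ 3) * (1 - ((1 - c) - \<tau> * h ^ 2 / pi ^ 2) / (1 - h / pi) ^ 2)"
proof -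
  have h: "h > 0" "h * X = 1" using X by (auto simp: h_def)
  have "pi * X \<ge> 3 * 32" using X pi_bounds by (intro mult_mono) auto
  then have A: "pi * X - 1 > 0" by simp
  have X2: "X ^ 2 > 1" using X by (intro one_less_power) auto
  have Xp: "Xp > 0" "Xm > 0" using X2 by (auto simp: Xp_def Xm_def)
  have Ah: "(1 - h / pi) ^ 2 = (pi * X - 1) ^ 2 / (pi * X) ^ 2"
  proof -
    have "1 - h / pi = (pi * X - 1) / (pi * X)" using X by (simp add: h_def field_simps)
    then show ?thesis by (simp add: power_divide)
  qed
  have C: "1 - ((1 - c) - \<tau> * h ^ 2 / pi ^ 2) / (1 - h / pi) ^ 2 = (pi * Xp - 1) * (pi * Xm - 1) / (pi * X - 1) ^ 2"
  proof -
    have num: "((1 - c) - \<tau> * h ^ 2 / pi ^ 2) * (pi * X) ^ 2 = pi ^ 2 * (X ^ 2 - Xp * Xm) - \<tau>"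
    proof -
      have "((1 - c) - \<tau> * h ^ 2 / pi ^ 2) * (pi * X) ^ 2 = pi ^ 2 * (X ^ 2 - Xp * Xm * (h * X) ^ 2) - \<tau> * (h * X) ^ 2"
        by (simp add: c_def power_mult_distrib algebra_simps)
      then show ?thesis by (simp add: h)
    qed
    have "1 - ((1 - c) - \<tau> * h ^ 2 / pi ^ 2) / (1 - h / pi) ^ 2 = 1 - (pi ^ 2 * (X ^ 2 - Xp * Xm) - \<tau>) / (pi * X - 1) ^ 2"
      unfolding Ah num[symmetric] by simp
    also have "\<dots> = ((pi * X - 1) ^ 2 - (pi ^ 2 * (X ^ 2 - Xp * Xm) - \<tau>)) / (pi * X - 1) ^ 2"
      using A by (simp add: diff_divide_distrib)
    also have "(pi * X - 1) ^ 2 - (pi ^ 2 * (X ^ 2 - Xp * Xm) - \<tau>) = (pi * Xp - 1) * (pi * Xm - 1)"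
      by (simp add: \<tau>_def power2_eq_square algebra_simps)
    finally show ?thesis .
  qed
  have c3: "1 / c ^ 3 = X ^ 6 / (Xp ^ 3 * Xm ^ 3)"
    using Xp X by (simp add: c_def h_def power_mult_distrib power_divide flip: power_mult)
  have ex: "exp (- \<tau>) = exp (pi * Xp) * exp (pi * Xm) / exp (pi * X) ^ 2"
  proof -
    have "- \<tau> = pi * Xp + pi * Xm - (pi * X + pi * X)" by (simp add: \<tau>_def algebra_simps)
    then show ?thesis by (simp only: exp_diff exp_add power2_eq_square)
  qed
  have gen: "(a * x / (8 * p * u ^ 3)) * (b * y / (8 * p * v ^ 3)) / (d * z / (8 * p * w ^ 3)) ^ 2 =
      (a * b / d ^ 2) * (w ^ 6 / (u ^ 3 * v ^ 3)) * (x * y / z ^ 2)"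
    if "p > 0" "u > 0" "v > 0" "w > 0" "z > 0" "d > 0" for a b d x y z u v w p :: real
  proof -
    have "w ^ 6 = w ^ 3 * w ^ 3" by (simp flip: power_add)
    with that show ?thesis by (simp add: power2_eq_square mult_ac)
  qed
  show ?thesis unfolding C c3 ex main_term_def
    by (rule gen) (use A X Xp in auto)
qed

lemma inverse_square_bounds:
  fixes y :: real
  assumes y: "0 \<le> y" "y \<le> 1 / 32"
  shows "1 + 2 * y + 3 * y ^ 2 \<le> 1 / (1 - y) ^ 2" "1 / (1 - y) ^ 2 \<le> 1 + 2 * y + 4 * y ^ 2"
proof -
  have p: "(1 - y) ^ 2 > 0" using y by simp
  have "(1 + 2 * y + 3 * y ^ 2) * (1 - y) ^ 2 = 1 - y ^ 3 * (4 - 3 * y)"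
    by (simp add: power2_eq_square power3_eq_cube algebra_simps)
  moreover have "y ^ 3 * (4 - 3 * y) \<ge> 0" using y by (intro mult_nonneg_nonneg) auto
  ultimately have "(1 + 2 * y + 3 * y ^ 2) * (1 - y) ^ 2 \<le> 1" by simp
  then show "1 + 2 * y + 3 * y ^ 2 \<le> 1 / (1 - y) ^ 2" using p by (simp add: pos_le_divide_eq)
  have "(1 + 2 * y + 4 * y ^ 2) * (1 - y) ^ 2 = 1 + y ^ 2 * (1 - 6 * y + 4 * y ^ 2)"
    by (simp add: power2_eq_square algebra_simps)
  moreover have "y ^ 2 * (1 - 6 * y + 4 * y ^ 2) \<ge> 0" using y by (intro mult_nonneg_nonneg) auto
  ultimately have "(1 + 2 * y + 4 * y ^ 2) * (1 - y) ^ 2 \<ge> 1" by simp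
  then show "1 / (1 - y) ^ 2 \<le> 1 + 2 * y + 4 * y ^ 2" using p by (simp add: pos_divide_le_eq)
qed

lemma inverse_cube_bounds:
  fixes k c :: real
  assumes k: "0 \<le> k" "k \<le> 1 / 100" and c: "k / 2 \<le> 1 - c" "1 - c \<le> k / 2 + k ^ 2 / 2"
  shows "1 + 3 / 2 * k \<le> 1 / c ^ 3" "1 / c ^ 3 \<le> 1 + 3 / 2 * k + 4 * k ^ 2"
proof -
  define b where "b = 1 - c"
  have k2: "k ^ 2 \<le> k" using k mult_left_le[of k k] by (simp add: power2_eq_square)
  have b: "0 \<le> b" "b \<le> 1 / 50" "k / 2 \<le> b" using c k k2 unfolding b_def by linarith+
  have c0: "c > 0" using b(2) unfolding b_def by simp
  have "c ^ 3 \<le> (1 - k / 2) ^ 3" using c c0 by (intro power_mono) auto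
  then have "(1 + 3 / 2 * k) * c ^ 3 \<le> (1 + 3 / 2 * k) * (1 - k / 2) ^ 3" using k by (intro mult_left_mono) auto
  also have "\<dots> = 1 - k ^ 2 * (3 / 2 - k + 3 / 16 * k ^ 2)" by (simp add: power2_eq_square power3_eq_cube field_simps)
  also have "\<dots> \<le> 1" using k by (simp add: mult_nonneg_nonneg)
  finally show "1 + 3 / 2 * k \<le> 1 / c ^ 3" using c0 by (simp add: pos_le_divide_eq)
  have "c ^ 3 = 1 - 3 * b + b ^ 2 * (3 - b)" unfolding b_def by (simp add: power2_eq_square power3_eq_cube algebra_simps)
  moreover have "b ^ 2 * (3 - b) \<ge> (k / 2) ^ 2 * 2"
    by (intro mult_mono power_mono) (use b k in auto)
  moreover have "(k / 2) ^ 2 * 2 = k ^ 2 / 2" by (simp add: power_divide)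
  moreover have "b \<le> k / 2 + k ^ 2 / 2" using c(2) by (simp add: b_def)
  ultimately have "c ^ 3 \<ge> 1 - 3 / 2 * k - k ^ 2" by linarith
  then have "(1 + 3 / 2 * k + 4 * k ^ 2) * c ^ 3 \<ge> (1 + 3 / 2 * k + 4 * k ^ 2) * (1 - 3 / 2 * k - k ^ 2)"
    using k by (intro mult_left_mono) auto
  moreover have "(1 + 3 / 2 * k + 4 * k ^ 2) * (1 - 3 / 2 * k - k ^ 2) = 1 + k ^ 2 * (3 / 4 - 15 / 2 * k - 4 * k ^ 2)"
    by (simp add: power2_eq_square algebra_simps)
  moreover have "k ^ 2 * (3 / 4 - 15 / 2 * k - 4 * k ^ 2) \<ge> 0" using k k2 by (intro mult_nonneg_nonneg) auto
  ultimately have "(1 + 3 / 2 * k + 4 * k ^ 2) * c ^ 3 \<ge> 1" by linarith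
  then show "1 / c ^ 3 \<le> 1 + 3 / 2 * k + 4 * k ^ 2" using c0 by (simp add: pos_divide_le_eq)
qed


lemma exp_neg_bounds:
  fixes t :: real
  assumes "t \<ge> 0"
  shows "1 - t + t ^ 2 / 2 - t ^ 3 / 6 \<le> exp (- t)" "exp (- t) \<le> 1 - t + t ^ 2 / 2"
proof -
  have d0: "1 - t \<le> exp (- t)" for t :: real using exp_ge_add_one_self[of "- t"] by simp
  have up: "exp (- t) \<le> 1 - t + t ^ 2 / 2" if "t \<ge> 0" for t :: real
  proof -
    have "1 - 0 + 0 ^ 2 / 2 - exp (- 0) \<le> 1 - t + t ^ 2 / 2 - exp (- t)"
    proof (rule DERIV_nonneg_imp_nondecreasing[OF that])
      fix z :: real assume "0 \<le> z" "z \<le> t"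
      show "\<exists>d. ((\<lambda>t. 1 - t + t ^ 2 / 2 - exp (- t)) has_real_derivative d) (at z) \<and> 0 \<le> d"
        using d0[of z] by (intro exI[of _ "- 1 + z + exp (- z)"] conjI) (auto intro!: derivative_eq_intros)
    qed
    then show ?thesis by simp
  qed
  show "exp (- t) \<le> 1 - t + t ^ 2 / 2" by (rule up[OF assms])
  have "exp (- 0) - (1 - 0 + 0 ^ 2 / 2 - 0 ^ 3 / 6) \<le> exp (- t) - (1 - t + t ^ 2 / 2 - t ^ 3 / 6)"
  proof (rule DERIV_nonneg_imp_nondecreasing[OF assms])
    fix z :: real assume "0 \<le> z" "z \<le> t"
    then show "\<exists>d. ((\<lambda>t. exp (- t) - (1 - t + t ^ 2 / 2 - t ^ 3 / 6)) has_real_derivative d) (at z) \<and> 0 \<le> d"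
      using up[of z] by (intro exI[of _ "1 - z + z ^ 2 / 2 - exp (- z)"] conjI) (auto intro!: derivative_eq_intros)
  qed
  then show "1 - t + t ^ 2 / 2 - t ^ 3 / 6 \<le> exp (- t)" by simp
qed

text \<open>The product (1 - u)(1 + v)(1 - w) to first order, where only the mixed terms with the
  unfavourable sign are retained.\<close>

lemma triple_product_bounds:
  fixes E B C u v w :: real
  shows "E \<le> 1 - u \<Longrightarrow> B \<le> 1 + v \<Longrightarrow> C \<le> 1 - w \<Longrightarrow> 0 \<le> E \<Longrightarrow> 0 \<le> B \<Longrightarrow> 0 \<le> C \<Longrightarrow> 0 \<le> u \<Longrightarrow> 0 \<le> v \<Longrightarrow> v \<le> 1 \<Longrightarrow> 0 \<le> w \<Longrightarrow>
      E * B * C \<le> 1 - u + v - w + 2 * (u * w)"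
    and "1 - u \<le> E \<Longrightarrow> 1 + v \<le> B \<Longrightarrow> 1 - w \<le> C \<Longrightarrow> 0 \<le> u \<Longrightarrow> u \<le> 1 \<Longrightarrow> 0 \<le> v \<Longrightarrow> 0 \<le> w \<Longrightarrow> w \<le> 1 \<Longrightarrow>
      1 - u + v - w - u * v - v * w \<le> E * B * C"
proof -
  assume a: "E \<le> 1 - u" "B \<le> 1 + v" "C \<le> 1 - w" "0 \<le> E" "0 \<le> B" "0 \<le> C" "0 \<le> u" "0 \<le> v" "v \<le> 1" "0 \<le> w"
  have "E * B * C \<le> (1 - u) * (1 + v) * (1 - w)" using a by (intro mult_mono mult_nonneg_nonneg) auto
  also have "\<dots> = 1 - u + v - w + u * w * (1 + v) - u * v - v * w" by (simp add: algebra_simps)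
  also have "\<dots> \<le> 1 - u + v - w + u * w * 2 - 0 - 0"
    using a by (intro diff_mono add_mono mult_left_mono mult_nonneg_nonneg) auto
  finally show "E * B * C \<le> 1 - u + v - w + 2 * (u * w)" by simp
next
  assume a: "1 - u \<le> E" "1 + v \<le> B" "1 - w \<le> C" "0 \<le> u" "u \<le> 1" "0 \<le> v" "0 \<le> w" "w \<le> 1"
  have "1 - u + v - w - u * v - v * w \<le> 1 - u + v - w - u * v - v * w + u * w * (1 + v)"
    using a by simp
  also have "\<dots> = (1 - u) * (1 + v) * (1 - w)" by (simp add: algebra_simps)
  also have "\<dots> \<le> E * B * C" using a by (intro mult_mono mult_nonneg_nonneg) auto
  finally show "1 - u + v - w - u * v - v * w \<le> E * B * C" .
qed

text \<open>Expansion of 1 - R for the ratio R of main terms: the exponential contributes pi/4 h^3,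
  the cubes -3/2 h^4, and the linear factors h^4 / 2 + 3 / (4 pi) h^5.\<close>

definition delta_model :: "real \<Rightarrow> real" where
  "delta_model h = pi / 4 * h ^ 3 - h ^ 4 + 3 / (4 * pi) * h ^ 5"

lemma power_le_scaled:
  fixes h :: real
  assumes "0 \<le> h" "h \<le> 1 / 32"
  shows "h ^ (m + k) \<le> h ^ m * (1 / 32) ^ k"
  unfolding power_add using assms by (intro mult_left_mono power_mono) auto

text \<open>The true coefficient of h^6 is 1 / pi^2 - pi^2 / 32, about -0.207. The interval from
  -0.24 to -0.06 leaves room for the terms from h^7 on, which h \<le> 1/32 makes small.\<close>

lemma main_term_ratio_bounds:
  fixes X :: real
  assumes X: "X \<ge> 32"
  defines "h \<equiv> 1 / X"
  defines "R \<equiv> main_term (sqrt (X ^ 2 + 1)) * main_term (sqrt (X ^ 2 - 1)) / main_term X ^ 2"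
  shows "delta_model h - 24 / 100 * h ^ 6 \<le> 1 - R" "1 - R \<le> delta_model h - 6 / 100 * h ^ 6" "R > 0"
proof -
  \<comment> \<open>The reciprocal of pi becomes an atom with \<open>\<iota> * pi = 1\<close>, which
    keeps the estimates polynomial.\<close>
  define \<iota> where "\<iota> = 1 / pi"
  have \<iota>: "\<iota> \<le> 3184 / 10000" "\<iota> \<ge> 3183 / 10000" "\<iota> * pi = 1" "pi \<noteq> 0"
    using pi_bounds by (auto simp: \<iota>_def field_simps)
  have h: "0 < h" "h \<le> 1 / 32" using X by (auto simp: h_def divide_simps)
  define Xp where "Xp = sqrt (X ^ 2 + 1)"
  define Xm where "Xm = sqrt (X ^ 2 - 1)"
  define \<tau> where "\<tau> = pi * (2 * X - Xp - Xm)"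
  define c where "c = Xp * Xm * h ^ 2"
  define y where "y = h * \<iota>"
  define Z where "Z = (1 - c) - \<tau> * (h ^ 2 * \<iota> ^ 2)"
  define W where "W = Z * (1 / (1 - y) ^ 2)"
  have Req: "R = exp (- \<tau>) * (1 / c ^ 3) * (1 - W)"
    unfolding R_def main_term_ratio[OF X] W_def Z_def y_def \<iota>_def \<tau>_def c_def Xp_def Xm_def h_def by (simp add: power_divide)
  have y: "0 \<le> y" "y \<le> 1 / 32"
    using h \<iota> mult_mono[of h "1 / 32" \<iota> 1] by (auto simp: y_def)
  have c: "h ^ 4 / 2 \<le> 1 - c" "1 - c \<le> h ^ 4 / 2 + h ^ 8 / 2"
    and \<tau>1: "h ^ 3 / 4 \<le> 2 * X - Xp - Xm" "2 * X - Xp - Xm \<le> h ^ 3 / 4 + h ^ 7 / 2"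
    using sqrt_neighbour_bounds[OF X] unfolding h_def c_def Xp_def Xm_def by blast+
  have k8: "(h ^ 4) ^ 2 = h ^ 8" by (simp flip: power_mult)
  have k4: "0 \<le> h ^ 4" "h ^ 4 \<le> 1 / 100" using h power_mono[of h "1 / 32" 4] by (auto simp: power_divide)
  define \<tau>0 where "\<tau>0 = pi / 4 * h ^ 3"
  have \<tau>: "\<tau>0 \<le> \<tau>" "\<tau> \<le> \<tau>0 + pi / 2 * h ^ 7"
    using mult_left_mono[OF \<tau>1(1), of pi] mult_left_mono[OF \<tau>1(2), of pi] by (auto simp: \<tau>_def \<tau>0_def algebra_simps)
  \<comment> \<open>Linear arithmetic treats the powers of h as unrelated atoms; these comparisons
    let it absorb the higher ones.\<close>
  have hp: "h ^ 7 \<le> h ^ 6 * (1 / 32)" "h ^ 8 \<le> h ^ 6 * (1 / 1024)" "h ^ 8 \<le> h ^ 7 * (1 / 32)" "h ^ 9 \<le> h ^ 7 * (1 / 1024)"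
    "h ^ 5 \<le> h ^ 4 * (1 / 32)" "h ^ 6 \<le> h ^ 4 * (1 / 1024)" "h ^ 3 \<le> 1 / 32768"  "h ^ 7 \<le> h ^ 3 * (1 / 1048576)" "h ^ 8 \<le> h ^ 4 * (1 / 1048576)"
    using power_le_scaled[of h 6 1] power_le_scaled[of h 6 2] power_le_scaled[of h 7 1] power_le_scaled[of h 7 2]
      power_le_scaled[of h 4 1] power_le_scaled[of h 4 2] power_le_scaled[of h 0 3] power_le_scaled[of h 3 4] power_le_scaled[of h 4 4] h
    by (auto simp: power_divide)
  have hpos: "0 < h ^ 3" "0 < h ^ 4" "0 < h ^ 5" "0 < h ^ 6" "0 < h ^ 7" "0 < h ^ 8" "0 < h ^ 9" using h by auto
  have \<tau>0: "0 \<le> \<tau>0" "\<tau>0 \<le> 8 / 10 * h ^ 3" "\<tau>0 \<ge> 7 / 10 * h ^ 3"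
    unfolding \<tau>0_def using pi_bounds h by (auto intro!: mult_right_mono)
  have \<tau>0_1: "\<tau>0 \<le> 1 / 1000" using \<tau>0 hp by linarith
  have t02: "\<tau>0 ^ 2 / 2 = pi ^ 2 / 32 * h ^ 6"
    by (simp add: \<tau>0_def power_mult_distrib power_divide flip: power_mult)
  have pi2: "pi ^ 2 \<le> 98697 / 10000" "pi ^ 2 \<ge> 98690 / 10000"
    using power_mono[of pi "31416 / 10000" 2] power_mono[of "31415 / 10000" pi 2] pi_bounds by (auto simp: power2_eq_square)
  have \<iota>2: "\<iota> ^ 2 \<le> 1014 / 10000" "\<iota> ^ 2 \<ge> 1013 / 10000" "0 \<le> \<iota> ^ 2"
    using power_mono[of \<iota> "3184 / 10000" 2] power_mono[of "3183 / 10000" \<iota> 2] \<iota> by (auto simp: power2_eq_square)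
  have \<tau>\<iota>: "\<tau>0 * (h ^ 2 * \<iota> ^ 2) = \<iota> / 4 * h ^ 5" "pi / 2 * h ^ 7 * (h ^ 2 * \<iota> ^ 2) = \<iota> / 2 * h ^ 9"
  proof -
    have "\<tau>0 * (h ^ 2 * \<iota> ^ 2) = (\<iota> * pi) * (\<iota> / 4 * (h ^ 3 * h ^ 2))" "pi / 2 * h ^ 7 * (h ^ 2 * \<iota> ^ 2) = (\<iota> * pi) * (\<iota> / 2 * (h ^ 7 * h ^ 2))"
      by (simp_all add: \<tau>0_def power2_eq_square)
    then show "\<tau>0 * (h ^ 2 * \<iota> ^ 2) = \<iota> / 4 * h ^ 5" "pi / 2 * h ^ 7 * (h ^ 2 * \<iota> ^ 2) = \<iota> / 2 * h ^ 9"
      by (simp_all add: \<iota>(3) flip: power_add)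
  qed
  have hi: "0 \<le> h ^ 2 * \<iota> ^ 2" by simp
  have Z_lo: "Z \<ge> h ^ 4 / 2 - \<iota> / 4 * h ^ 5 - \<iota> / 2 * h ^ 9"
    using c(1) mult_right_mono[OF \<tau>(2) hi] unfolding Z_def distrib_right \<tau>\<iota> by linarith
  have Z_up: "Z \<le> h ^ 4 / 2 + h ^ 8 / 2 - \<iota> / 4 * h ^ 5"
    using c(2) mult_right_mono[OF \<tau>(1) hi] unfolding Z_def \<tau>\<iota> by linarith
  have i3: "\<iota> ^ 3 \<le> 323 / 10000" "0 \<le> \<iota> ^ 3" using power_mono[of \<iota> "3184 / 10000" 3] \<iota> by (auto simp: power3_eq_cube)
  have \<iota>5: "\<iota> / 4 * h ^ 5 \<le> 1 / 320 * h ^ 4" "0 \<le> \<iota> / 4 * h ^ 5" "\<iota> / 2 * h ^ 9 \<le> h ^ 9" "0 \<le> \<iota> / 2 * h ^ 9"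
    "3 / 4 * \<iota> * h ^ 5 \<le> 1 / 100 * h ^ 4" "0 \<le> 3 / 4 * \<iota> * h ^ 5"
  proof -
    have "\<iota> / 4 * h ^ 5 \<le> 1 / 10 * h ^ 5" "3 / 4 * \<iota> * h ^ 5 \<le> 32 / 100 * h ^ 5" "\<iota> / 2 * h ^ 9 \<le> 1 * h ^ 9"
      using \<iota> hpos by (auto intro!: mult_right_mono)
    then show "\<iota> / 4 * h ^ 5 \<le> 1 / 320 * h ^ 4" "3 / 4 * \<iota> * h ^ 5 \<le> 1 / 100 * h ^ 4" "\<iota> / 2 * h ^ 9 \<le> h ^ 9"
      using hp hpos by linarith+
    show "0 \<le> \<iota> / 4 * h ^ 5" "0 \<le> \<iota> / 2 * h ^ 9" "0 \<le> 3 / 4 * \<iota> * h ^ 5"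
      using \<iota> hpos by (auto intro!: mult_nonneg_nonneg)
  qed
  have Z0: "Z \<ge> 0"
  proof -
    have "h ^ 9 \<le> h ^ 4 * (1 / 33554432)" using power_le_scaled[of h 4 5] h by (simp add: power_divide)
    then show ?thesis using Z_lo \<iota>5 hpos by linarith
  qed
  define K1 where "K1 = h ^ 4 / 2 + 3 / 4 * \<iota> * h ^ 5 + \<iota> ^ 2 * h ^ 6 - 5 / 100 * h ^ 7"
  have W_lo: "W \<ge> K1"
  proof -
    have br: "3 / 4 * \<iota> ^ 3 + h ^ 2 * \<iota> / 2 * (1 + 2 * y + 3 * y ^ 2) \<le> 5 / 100"
    proof -
      have "y ^ 2 \<le> 1 ^ 2" using y by (intro power_mono) auto
      then have "1 + 2 * y + 3 * y ^ 2 \<le> 6" using y by simp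
      moreover have "h ^ 2 \<le> (1 / 32) ^ 2" using h by (intro power_mono) auto
      moreover have "0 \<le> 1 + 2 * y + 3 * y ^ 2" using y by simp
      ultimately have "h ^ 2 * \<iota> / 2 * (1 + 2 * y + 3 * y ^ 2) \<le> (1 / 32) ^ 2 * 1 / 2 * 6"
        using \<iota> by (intro mult_mono divide_right_mono) auto
      moreover have "(1 / 32 :: real) ^ 2 * 1 / 2 * 6 \<le> 5 / 1000" by (simp add: power2_eq_square)
      ultimately show ?thesis using i3 by linarith
    qed
    have "(h ^ 4 / 2 - \<iota> / 4 * h ^ 5 - \<iota> / 2 * h ^ 9) * (1 + 2 * y + 3 * y ^ 2) =
       h ^ 4 / 2 + 3 / 4 * \<iota> * h ^ 5 + \<iota> ^ 2 * h ^ 6 - h ^ 7 * (3 / 4 * \<iota> ^ 3 + h ^ 2 * \<iota> / 2 * (1 + 2 * y + 3 * y ^ 2))"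
      by (simp add: y_def eval_nat_numeral algebra_simps)
    also have "\<dots> \<ge> K1"
      unfolding K1_def using mult_left_mono[OF br, of "h ^ 7"] hpos by simp
    finally have "K1 \<le> (h ^ 4 / 2 - \<iota> / 4 * h ^ 5 - \<iota> / 2 * h ^ 9) * (1 + 2 * y + 3 * y ^ 2)" .
    also have "\<dots> \<le> Z * (1 + 2 * y + 3 * y ^ 2)" using Z_lo y by (intro mult_right_mono) auto
    also have "\<dots> \<le> W" unfolding W_def using Z0 inverse_square_bounds(1)[OF y] by (intro mult_left_mono)
    finally show ?thesis .
  qed
  define K2 where "K2 = h ^ 4 / 2 + 3 / 4 * \<iota> * h ^ 5 + 3 / 2 * \<iota> ^ 2 * h ^ 6 + h ^ 8"
  have W_up: "W \<le> K2"
  proof -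
    have "y ^ 2 \<le> (1 / 32) ^ 2" using y by (intro power_mono) auto
    then have yy: "1 + 2 * y + 4 * y ^ 2 \<le> 2" using y by (simp add: power_divide)
    have "W \<le> Z * (1 + 2 * y + 4 * y ^ 2)" unfolding W_def using Z0 inverse_square_bounds(2)[OF y] by (intro mult_left_mono)
    also have "\<dots> \<le> (h ^ 4 / 2 + h ^ 8 / 2 - \<iota> / 4 * h ^ 5) * (1 + 2 * y + 4 * y ^ 2)" using Z_up y by (intro mult_right_mono) auto
    also have "\<dots> = h ^ 4 / 2 + 3 / 4 * \<iota> * h ^ 5 + 3 / 2 * \<iota> ^ 2 * h ^ 6 - h ^ 7 * \<iota> ^ 3 + h ^ 8 / 2 * (1 + 2 * y + 4 * y ^ 2)"
      by (simp add: y_def eval_nat_numeral algebra_simps)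
    also have "\<dots> \<le> K2"
    proof -
      have "h ^ 8 / 2 * (1 + 2 * y + 4 * y ^ 2) \<le> h ^ 8 / 2 * 2" using hpos by (intro mult_left_mono[OF yy]) simp
      moreover have "0 \<le> h ^ 7 * \<iota> ^ 3" using hpos i3 by (intro mult_nonneg_nonneg) auto
      ultimately show ?thesis unfolding K2_def by linarith
    qed
    finally show ?thesis .
  qed
  have i26: "\<iota> ^ 2 * h ^ 6 \<le> 1014 / 10000 * h ^ 6" "\<iota> ^ 2 * h ^ 6 \<ge> 1013 / 10000 * h ^ 6"
    using \<iota>2 hpos by (auto intro!: mult_right_mono)
  have p26: "pi ^ 2 / 32 * h ^ 6 \<le> 3085 / 10000 * h ^ 6" "pi ^ 2 / 32 * h ^ 6 \<ge> 3084 / 10000 * h ^ 6"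
    using pi2 hpos by (auto intro!: mult_right_mono)
  have K: "0 \<le> K1" "K1 \<le> 52 / 100 * h ^ 4" "0 \<le> K2" "K2 \<le> 52 / 100 * h ^ 4"
    unfolding K1_def K2_def using i26 \<iota>5 hp hpos by linarith+
  have W1: "W \<le> 1 / 2" "W \<ge> 0" using W_up W_lo K k4 by linarith+
  have model: "delta_model h = \<tau>0 - h ^ 4 + 3 / 4 * \<iota> * h ^ 5"
    by (simp add: delta_model_def \<tau>0_def \<iota>_def)
  have c0: "c > 0" using c(2) k4 hp(9) by linarith
  have B: "1 + 3 / 2 * h ^ 4 \<le> 1 / c ^ 3" "1 / c ^ 3 \<le> 1 + (3 / 2 * h ^ 4 + 4 * h ^ 8)"
    using inverse_cube_bounds[OF k4, of c] c unfolding k8 by simp_all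
  show "R > 0" unfolding Req using c0 W1 by (intro mult_pos_pos) auto
  have sq: "\<tau>0 ^ 2 \<le> \<tau>0" using \<tau>0 \<tau>0_1 mult_left_mono[of \<tau>0 1 \<tau>0] by (simp add: power2_eq_square)
  define u where "u = \<tau>0 - \<tau>0 ^ 2 / 2"
  have u: "0 \<le> u" "u \<le> 8 / 10 * h ^ 3" unfolding u_def using sq \<tau>0 zero_le_power2[of \<tau>0] by linarith+
  have E: "exp (- \<tau>) \<le> 1 - u"
  proof -
    have "exp (- \<tau>) \<le> exp (- \<tau>0)" using \<tau> by simp
    also have "\<dots> \<le> 1 - u" using exp_neg_bounds(2)[OF \<tau>0(1)] by (simp add: u_def)
    finally show ?thesis .
  qed
  have uw: "u * K1 \<le> 42 / 100 * h ^ 7"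
  proof -
    have "u * K1 \<le> (8 / 10 * h ^ 3) * (52 / 100 * h ^ 4)" using u K hpos by (intro mult_mono) auto
    also have "\<dots> = 416 / 1000 * h ^ 7" by (simp flip: power_add)
    finally show ?thesis using hpos by linarith
  qed
  have "R \<le> 1 - u + (3 / 2 * h ^ 4 + 4 * h ^ 8) - K1 + 2 * (u * K1)"
    unfolding Req
    by (rule triple_product_bounds(1)) (use E B W_lo W1 c0 u K hpos k4 hp in auto)
  then show "delta_model h - 24 / 100 * h ^ 6 \<le> 1 - R"
    using uw p26 i26 hp hpos unfolding u_def t02 model K1_def by linarith
  \<comment> \<open>The term 17/10 h^7 absorbs both the excess pi/2 h^7 of \<open>\<tau>\<close>
    over \<open>\<tau>0\<close> and the cubic term of the exponential.\<close>
  define u' where "u' = \<tau>0 - \<tau>0 ^ 2 / 2 + 17 / 10 * h ^ 7"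
  have u': "0 \<le> u'" "u' \<le> 81 / 100 * h ^ 3" using u hpos hp unfolding u'_def u_def by linarith+
  have E': "1 - u' \<le> exp (- \<tau>)"
  proof -
    define t1 where "t1 = \<tau>0 + pi / 2 * h ^ 7"
    have p7: "pi / 2 * h ^ 7 \<le> 16 / 10 * h ^ 7" "0 \<le> pi / 2 * h ^ 7" using pi_bounds hpos by (auto intro!: mult_right_mono)
    have t1: "\<tau>0 \<le> t1" "t1 \<le> h ^ 3" using p7 \<tau>0 hp hpos unfolding t1_def by linarith+
    have "t1 ^ 3 \<le> (h ^ 3) ^ 3" using t1 \<tau>0 by (intro power_mono) auto
    then have t3: "t1 ^ 3 \<le> h ^ 9" by (simp flip: power_mult)
    have t2: "\<tau>0 ^ 2 \<le> t1 ^ 2" using t1 \<tau>0 by (intro power_mono) auto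
    have "1 - u' \<le> 1 - t1 + t1 ^ 2 / 2 - t1 ^ 3 / 6"
      unfolding u'_def using t2 t3 p7 hp hpos t1_def by linarith
    also have "\<dots> \<le> exp (- t1)" using t1 \<tau>0 by (intro exp_neg_bounds) auto
    also have "\<dots> \<le> exp (- \<tau>)" using \<tau> by (simp add: t1_def)
    finally show ?thesis .
  qed
  have uv: "u' * (3 / 2 * h ^ 4) \<le> 122 / 100 * h ^ 7"
  proof -
    have "u' * (3 / 2 * h ^ 4) \<le> (81 / 100 * h ^ 3) * (3 / 2 * h ^ 4)" using u' hpos by (intro mult_right_mono) auto
    also have "\<dots> = 1215 / 1000 * h ^ 7" by (simp flip: power_add)
    finally show ?thesis using hpos by linarith
  qed
  have vw: "3 / 2 * h ^ 4 * K2 \<le> h ^ 8"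
  proof -
    have "3 / 2 * h ^ 4 * K2 \<le> 3 / 2 * h ^ 4 * (52 / 100 * h ^ 4)" using K hpos by (intro mult_left_mono) auto
    also have "\<dots> = 78 / 100 * h ^ 8" by (simp flip: power_add)
    finally show ?thesis using hpos by linarith
  qed
  have "1 - u' + 3 / 2 * h ^ 4 - K2 - u' * (3 / 2 * h ^ 4) - 3 / 2 * h ^ 4 * K2 \<le> R"
    unfolding Req
    by (rule triple_product_bounds(2)) (use E' B W_up u' K hpos k4 hp in auto)
  then show "1 - R \<le> delta_model h - 6 / 100 * h ^ 6"
    using uv vw p26 i26 hp hpos unfolding u'_def t02 model K2_def by linarith
qed

text \<open>To first order the deviation is a + b - 2 d, at most 4 e; the quadratic terms and the
  denominator raise the constant to 4.02 / 0.98 < 4.2.\<close>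

lemma perturbation_quotient:
  fixes a b d e :: real
  assumes "\<bar>a\<bar> \<le> e" "\<bar>b\<bar> \<le> e" "\<bar>d\<bar> \<le> e" "e \<le> 1 / 100"
  shows "\<bar>(1 + a) * (1 + b) / (1 + d) ^ 2 - 1\<bar> \<le> 42 / 10 * e"
proof -
  have e: "0 \<le> e" using assms(1) by linarith
  have "(1 - e) ^ 2 \<le> (1 + d) ^ 2" using assms by (intro power_mono) auto
  moreover have "(1 - 1 / 100) ^ 2 \<le> (1 - e) ^ 2" using assms by (intro power_mono) auto
  ultimately have D: "(1 + d) ^ 2 \<ge> 98 / 100" by (simp add: power_divide)
  have ab: "\<bar>a * b\<bar> \<le> 1 / 100 * e" unfolding abs_mult using assms by (intro mult_mono) auto
  have dd: "\<bar>d * d\<bar> \<le> 1 / 100 * e" unfolding abs_mult using assms by (intro mult_mono) auto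
  have "(1 + a) * (1 + b) / (1 + d) ^ 2 - 1 = (a + b + a * b - 2 * d - d * d) / (1 + d) ^ 2"
  proof -
    have "1 + d \<noteq> 0" using D by auto
    then show ?thesis by (simp add: divide_simps) (simp add: power2_eq_square algebra_simps)
  qed
  also have "\<bar>\<dots>\<bar> = \<bar>a + b + a * b - 2 * d - d * d\<bar> / (1 + d) ^ 2" by (simp add: abs_divide)
  also have "\<dots> \<le> (402 / 100 * e) / (98 / 100)"
    using D e ab dd assms by (intro frac_le) linarith+
  also have "\<dots> \<le> 42 / 10 * e" using e by simp
  finally show ?thesis .
qed

definition defect :: "nat \<Rightarrow> real" where
  "defect n = 1 - real (overpartition_count (n - 1)) * real (overpartition_count (n + 1)) / real (overpartition_count n) ^ 2"

text \<open>N \<ge> 1025 puts the smallest argument N - 1 at 32^2 or above. The relative errors of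
  the three values cost at most 0.09 h^6, which widens the interval of
  \<open>main_term_ratio_bounds\<close> to -0.34 and 0.04.\<close>

lemma defect_bounds:
  fixes N :: nat
  assumes N: "N \<ge> 1025"
  defines "h \<equiv> 1 / sqrt (real N)"
  shows "delta_model h - 34 / 100 * h ^ 6 \<le> defect N" "defect N \<le> delta_model h + 4 / 100 * h ^ 6"
    and "overpartition_count N > 0"
proof -
  define X where "X = sqrt (real N)"
  have X2: "X ^ 2 = real N" by (simp add: X_def)
  have X: "X \<ge> 32" unfolding X_def using N by (intro real_le_rsqrt) simp
  have h: "h = 1 / X" "0 < h" "h \<le> 1 / 32" using X by (auto simp: h_def X_def[symmetric] divide_simps)
  have hX: "h ^ 6 = 1 / X ^ 6" by (simp add: h(1) power_divide)
  have np: "real (N + 1) = X ^ 2 + 1" "real (N - 1) = X ^ 2 - 1" using N by (auto simp: X2 of_nat_diff)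
  have big: "sqrt (X ^ 2 + 1) \<ge> 32" "sqrt (X ^ 2 - 1) \<ge> 32" unfolding X2 using N by (auto intro!: real_le_rsqrt)
  obtain e0 where e0: "real (overpartition_count N) = main_term X * (1 + e0)" "\<bar>e0\<bar> \<le> 1 / (50 * X ^ 6)"
    using overpartition_main_term[of N] X unfolding X_def by blast
  obtain ep where ep: "real (overpartition_count (N + 1)) = main_term (sqrt (X ^ 2 + 1)) * (1 + ep)" "\<bar>ep\<bar> \<le> 1 / (50 * sqrt (X ^ 2 + 1) ^ 6)"
    using overpartition_main_term[of "N + 1"] big unfolding np by blast
  obtain em where em: "real (overpartition_count (N - 1)) = main_term (sqrt (X ^ 2 - 1)) * (1 + em)" "\<bar>em\<bar> \<le> 1 / (50 * sqrt (X ^ 2 - 1) ^ 6)"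
    using overpartition_main_term[of "N - 1"] big unfolding np by blast
  \<comment> \<open>Slightly more than 1/50, as at N - 1 the error is measured in powers of a
    smaller square root.\<close>
  define e where "e = 21 / 1000 * h ^ 6"
  have h6: "0 < h ^ 6" "h ^ 6 \<le> 1 / 1000" using h power_le_scaled[of h 0 6] by (auto simp: power_divide)
  have e0': "\<bar>e0\<bar> \<le> e" using e0(2) h6 by (simp add: e_def hX)
  have ep': "\<bar>ep\<bar> \<le> e"
  proof -
    have "X \<le> sqrt (X ^ 2 + 1)" by (rule real_le_rsqrt) simp
    then have "X ^ 6 \<le> sqrt (X ^ 2 + 1) ^ 6" using X by (intro power_mono) auto
    then have "1 / (50 * sqrt (X ^ 2 + 1) ^ 6) \<le> 1 / (50 * X ^ 6)" using X by (intro divide_left_mono mult_pos_pos) auto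
    with ep(2) show ?thesis using h6 by (simp add: e_def hX)
  qed
  have em': "\<bar>em\<bar> \<le> e"
  proof -
    have X1: "X ^ 2 \<ge> 1024" using N X2 by simp
    have "sqrt (X ^ 2 - 1) ^ 6 = (sqrt (X ^ 2 - 1) ^ 2) ^ 3" by (simp flip: power_mult)
    also have "\<dots> = (X ^ 2 - 1) ^ 3" using X1 by simp
    also have "\<dots> \<ge> (99 / 100 * X ^ 2) ^ 3" using X1 by (intro power_mono) auto
    also have "(99 / 100 * X ^ 2) ^ 3 = 970299 / 1000000 * X ^ 6" by (simp add: power_mult_distrib power_divide flip: power_mult)
    finally have "sqrt (X ^ 2 - 1) ^ 6 \<ge> 970299 / 1000000 * X ^ 6" .
    then have "1 / (50 * sqrt (X ^ 2 - 1) ^ 6) \<le> 1 / (50 * (970299 / 1000000 * X ^ 6))"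
      using X by (intro divide_left_mono mult_pos_pos mult_left_mono) (auto intro: less_le_trans[of _ "970299 / 1000000 * X ^ 6"])
    also have "\<dots> = 1000000 / 48514950 * h ^ 6" by (simp add: hX)
    also have "\<dots> \<le> e" unfolding e_def using h6 by (intro mult_right_mono) auto
    finally show ?thesis using em(2) by linarith
  qed
  define R where "R = main_term (sqrt (X ^ 2 + 1)) * main_term (sqrt (X ^ 2 - 1)) / main_term X ^ 2"
  have R: "delta_model h - 24 / 100 * h ^ 6 \<le> 1 - R" "1 - R \<le> delta_model h - 6 / 100 * h ^ 6" "R > 0"
    using main_term_ratio_bounds[OF X] unfolding h(1) R_def by blast+
  have mt: "main_term X > 0"
  proof -
    have "pi * X \<ge> 3 * 32" using X pi_bounds by (intro mult_mono) auto
    then show ?thesis unfolding main_term_def using X by (intro divide_pos_pos mult_pos_pos) auto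
  qed
  have e1: "e \<le> 1 / 100" using h6 by (simp add: e_def)
  show pos: "overpartition_count N > 0"
  proof -
    have "main_term X * (1 + e0) > 0" using mt e0' e1 by (intro mult_pos_pos) auto
    then show ?thesis unfolding e0(1)[symmetric] by simp
  qed
  define F where "F = (1 + ep) * (1 + em) / (1 + e0) ^ 2"
  have F: "\<bar>F - 1\<bar> \<le> 42 / 10 * e"
    unfolding F_def by (rule perturbation_quotient[OF ep' em' e0' e1])
  have "defect N = 1 - R * F"
    unfolding defect_def e0(1) ep(1) em(1) R_def F_def by (simp add: power_mult_distrib mult_ac)
  then have d: "defect N = (1 - R) - R * (F - 1)" by (simp add: algebra_simps)
  have model0: "delta_model h - 24 / 100 * h ^ 6 \<ge> 0"
  proof -
    have "h ^ 4 \<le> h ^ 3 * (1 / 32)" "h ^ 6 \<le> h ^ 3 * (1 / 32768)" using power_le_scaled[of h 3 1] power_le_scaled[of h 3 3] h by (auto simp: power_divide)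
    moreover have "pi / 4 * h ^ 3 \<ge> 3 / 4 * h ^ 3" using pi_bounds h by (intro mult_right_mono) auto
    moreover have "3 / (4 * pi) * h ^ 5 \<ge> 0" "h ^ 3 > 0" using h by auto
    ultimately show ?thesis unfolding delta_model_def by linarith
  qed
  have "\<bar>R * (F - 1)\<bar> \<le> 1 * (42 / 10 * e)"
    unfolding abs_mult using R model0 F by (intro mult_mono) auto
  then have "\<bar>R * (F - 1)\<bar> \<le> 9 / 100 * h ^ 6" using h6 by (simp add: e_def)
  then show "delta_model h - 34 / 100 * h ^ 6 \<le> defect N" "defect N \<le> delta_model h + 4 / 100 * h ^ 6"
    using R h6 unfolding d by linarith+
qed

text \<open>Here p and q stand for 1 / sqrt (n + 1) and 1 / sqrt (n - 1). The second difference of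
  n^(-3/2) is of order h^7, thus at most a small multiple of h^6. The bound 0.12 h^6 already
  includes the upper error 0.04 h^6 of \<open>defect_bounds\<close>.\<close>

lemma neighbour_average:
  fixes h p q :: real
  assumes h: "0 < h" "h \<le> 1 / 32"
    and p: "0 < p" "p ^ 2 * (1 + h ^ 2) = h ^ 2" and q: "0 < q" "q ^ 2 * (1 - h ^ 2) = h ^ 2"
  shows "(delta_model p + 4 / 100 * p ^ 6 + (delta_model q + 4 / 100 * q ^ 6)) / 2 \<le> delta_model h + 12 / 100 * h ^ 6"
proof -
  define t where "t = h ^ 2"
  have t: "0 < t" "t \<le> 1 / 1024" using h power_mono[of h "1 / 32" 2] by (auto simp: t_def power_divide)
  \<comment> \<open>Truncations of (1 + t)^(-1/2) - 1 and (1 - t)^(-1/2) - 1. In \<open>b\<close>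
    the quadratic coefficient 3/8 is enlarged to 1/2 to make it an upper bound.\<close>
  define a where "a = - t / 2 + 3 / 8 * t ^ 2"
  define b where "b = t / 2 + t ^ 2 / 2"
  have t2: "0 < t ^ 2" "t ^ 2 \<le> t / 1024" "t ^ 3 \<le> t ^ 2 / 1024"
  proof -
    show "0 < t ^ 2" using t by simp
    show "t ^ 2 \<le> t / 1024" using mult_left_mono[OF t(2) less_imp_le[OF t(1)]] by (simp add: power2_eq_square)
    show "t ^ 3 \<le> t ^ 2 / 1024" using mult_left_mono[OF t(2) zero_le_power2[of t]] by (simp add: power2_eq_square power3_eq_cube)
  qed
  have ab: "\<bar>a\<bar> \<le> t" "\<bar>b\<bar> \<le> t" "a \<le> 0" "0 \<le> b" "b \<le> 6 / 10 * t" using t t2 unfolding a_def b_def by linarith+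
  have ph: "p \<le> h * (1 + a)"
  proof (rule power2_le_imp_le)
    have "(1 + a) ^ 2 * (1 + t) = 1 + t ^ 3 * (5 / 8 - 15 / 64 * t + 9 / 64 * t ^ 2)"
      by (simp add: a_def power2_eq_square power3_eq_cube field_simps)
    moreover have "t ^ 3 * (5 / 8 - 15 / 64 * t + 9 / 64 * t ^ 2) \<ge> 0"
    proof (rule mult_nonneg_nonneg)
      show "0 \<le> t ^ 3" using t by simp
      show "0 \<le> 5 / 8 - 15 / 64 * t + 9 / 64 * t ^ 2" using t t2 by linarith
    qed
    ultimately have "(1 + a) ^ 2 * (1 + t) \<ge> 1" by linarith
    then have "h ^ 2 * 1 \<le> h ^ 2 * ((1 + a) ^ 2 * (1 + t))" by (intro mult_left_mono) auto
    then have "p ^ 2 * (1 + t) \<le> (h * (1 + a)) ^ 2 * (1 + t)" using p(2) by (simp add: t_def power_mult_distrib mult_ac)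
    then show "p ^ 2 \<le> (h * (1 + a)) ^ 2" using t by (simp add: mult_le_cancel_right)
    show "0 \<le> h * (1 + a)" using h ab t by (intro mult_nonneg_nonneg) auto
  qed
  have qh: "q \<le> h * (1 + b)"
  proof (rule power2_le_imp_le)
    have "(1 + b) ^ 2 * (1 - t) = 1 + t ^ 2 * (1 / 4 - 3 / 4 * t - t ^ 2 / 4 - t ^ 3 / 4)"
      by (simp add: b_def power2_eq_square power3_eq_cube field_simps)
    moreover have "t ^ 2 * (1 / 4 - 3 / 4 * t - t ^ 2 / 4 - t ^ 3 / 4) \<ge> 0" using t t2 by (intro mult_nonneg_nonneg) linarith+
    ultimately have "(1 + b) ^ 2 * (1 - t) \<ge> 1" by linarith
    then have "h ^ 2 * 1 \<le> h ^ 2 * ((1 + b) ^ 2 * (1 - t))" by (intro mult_left_mono) auto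
    then have "q ^ 2 * (1 - t) \<le> (h * (1 + b)) ^ 2 * (1 - t)" using q(2) by (simp add: t_def power_mult_distrib mult_ac)
    then show "q ^ 2 \<le> (h * (1 + b)) ^ 2" using t by (simp add: mult_le_cancel_right)
    show "0 \<le> h * (1 + b)" using h ab t by (intro mult_nonneg_nonneg) auto
  qed
  have cube: "(1 + a) ^ 3 + (1 + b) ^ 3 \<le> 2 + 5 * t ^ 2"
  proof -
    have "(1 + a) ^ 3 + (1 + b) ^ 3 = 2 + 3 * (a + b) + 3 * (a ^ 2 + b ^ 2) + a ^ 3 + b ^ 3"
      by (simp add: power2_eq_square power3_eq_cube algebra_simps)
    moreover have "a + b = 7 / 8 * t ^ 2" by (simp add: a_def b_def)
    moreover have "a ^ 2 \<le> t ^ 2 / 4"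
    proof -
      have "(- a) ^ 2 \<le> (t / 2) ^ 2" using ab t2 by (intro power_mono) (auto simp: a_def)
      then show ?thesis by (simp add: power_divide)
    qed
    moreover have "b ^ 2 \<le> 36 / 100 * t ^ 2"
    proof -
      have "b ^ 2 \<le> (6 / 10 * t) ^ 2" using ab by (intro power_mono) auto
      then show ?thesis by (simp add: power_mult_distrib power_divide)
    qed
    moreover have "a ^ 3 \<le> 0" using ab by (simp add: power3_eq_cube mult_nonneg_nonpos mult_nonpos_nonpos)
    moreover have "b ^ 3 \<le> t ^ 3" using ab by (intro power_mono) auto
    ultimately show ?thesis using t2 by argo
  qed
  have c3: "p ^ 3 + q ^ 3 \<le> h ^ 3 * (2 + 5 * t ^ 2)"
  proof -
    have "p ^ 3 + q ^ 3 \<le> (h * (1 + a)) ^ 3 + (h * (1 + b)) ^ 3" using ph qh p q by (intro add_mono power_mono) auto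
    also have "\<dots> = h ^ 3 * ((1 + a) ^ 3 + (1 + b) ^ 3)" by (subst (1 2) power_mult_distrib) (simp only: distrib_left)
    also have "\<dots> \<le> h ^ 3 * (2 + 5 * t ^ 2)" using h by (intro mult_left_mono cube) auto
    finally show ?thesis .
  qed
  \<comment> \<open>The quartic term enters with a negative sign, so convexity of 1 / n^2 works in
    favour and no error term is needed.\<close>
  have c4: "p ^ 4 + q ^ 4 \<ge> 2 * h ^ 4"
  proof -
    have p2: "p ^ 2 = t / (1 + t)" "q ^ 2 = t / (1 - t)" 
    proof -
      have "p ^ 2 * (1 + t) = t" "q ^ 2 * (1 - t) = t" using p(2) q(2) by (simp_all only: t_def)
      then show "p ^ 2 = t / (1 + t)" "q ^ 2 = t / (1 - t)" using t by (simp_all add: eq_divide_eq)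
    qed
    have "p ^ 2 + q ^ 2 \<ge> 2 * t"
    proof -
      have "p ^ 2 + q ^ 2 - 2 * t = 2 * t ^ 3 / ((1 + t) * (1 - t))" unfolding p2 using t by (simp add: divide_simps) (simp add: power3_eq_cube algebra_simps)
      moreover have "2 * t ^ 3 / ((1 + t) * (1 - t)) \<ge> 0" using t by simp
      ultimately show ?thesis by linarith
    qed
    have "4 * h ^ 4 = (2 * t) ^ 2" by (simp add: t_def power_mult_distrib flip: power_mult)
    also have "\<dots> \<le> (p ^ 2 + q ^ 2) ^ 2" using \<open>p ^ 2 + q ^ 2 \<ge> 2 * t\<close> t by (intro power_mono) auto
    also have "(p ^ 2 + q ^ 2) ^ 2 \<le> 2 * (p ^ 4 + q ^ 4)"
    proof -
      have "2 * (p ^ 4 + q ^ 4) - (p ^ 2 + q ^ 2) ^ 2 = (p ^ 2 - q ^ 2) ^ 2" by (simp add: eval_nat_numeral algebra_simps)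
      then show ?thesis using zero_le_power2[of "p ^ 2 - q ^ 2"] by linarith
    qed
    finally show ?thesis by simp
  qed
  have qu: "q \<le> h * (1 + 6 / 10 * t)" using qh ab h by (rule_tac order_trans[OF qh]) (auto intro!: mult_left_mono)
  have pu: "p \<le> h" using ph ab h by (rule_tac order_trans[OF ph]) (simp add: mult_left_le)
  have binom: "(1 + 6 / 10 * t) ^ 6 \<le> 1 + 4 * t"
  proof -
    have "(1 + 6 / 10 * t) ^ 2 = 1 + 12 / 10 * t + 36 / 100 * t ^ 2" by (simp add: power2_eq_square field_simps)
    then have "(1 + 6 / 10 * t) ^ 2 \<le> 1 + 122 / 100 * t" using t t2 by linarith
    then have "((1 + 6 / 10 * t) ^ 2) ^ 3 \<le> (1 + 122 / 100 * t) ^ 3" using t by (intro power_mono) auto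
    also have "\<dots> = 1 + 366 / 100 * t + 44652 / 10000 * t ^ 2 + 1815848 / 1000000 * t ^ 3"
      by (simp add: power2_eq_square power3_eq_cube field_simps)
    also have "\<dots> \<le> 1 + 4 * t" using t t2 by linarith
    finally show ?thesis by (simp flip: power_mult)
  qed
  have binom5: "(1 + 6 / 10 * t) ^ 5 \<le> 1 + 4 * t"
    by (rule order_trans[OF _ binom]) (use t in \<open>auto intro!: power_increasing\<close>)
  have c5: "p ^ 5 + q ^ 5 \<le> h ^ 5 * (2 + 4 * t)"
  proof -
    have "p ^ 5 + q ^ 5 \<le> h ^ 5 + (h * (1 + 6 / 10 * t)) ^ 5" using pu qu p q by (intro add_mono power_mono) auto
    also have "\<dots> \<le> h ^ 5 + h ^ 5 * (1 + 4 * t)" unfolding power_mult_distrib using h by (intro add_left_mono mult_left_mono binom5) auto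
    finally show ?thesis by (simp add: algebra_simps)
  qed
  have c6: "p ^ 6 + q ^ 6 \<le> h ^ 6 * (2 + 4 * t)"
  proof -
    have "p ^ 6 + q ^ 6 \<le> h ^ 6 + (h * (1 + 6 / 10 * t)) ^ 6" using pu qu p q by (intro add_mono power_mono) auto
    also have "\<dots> \<le> h ^ 6 + h ^ 6 * (1 + 4 * t)" unfolding power_mult_distrib using h by (intro add_left_mono mult_left_mono binom) auto
    finally show ?thesis by (simp add: algebra_simps)
  qed
  have inv: "3 / (4 * pi) \<le> 1 / 4" "0 \<le> 3 / (4 * pi)" using pi_bounds by (auto simp: field_simps)
  have r3: "h ^ 3 * (2 + 5 * t ^ 2) = 2 * h ^ 3 + 5 * h ^ 7" "h ^ 5 * (2 + 4 * t) = 2 * h ^ 5 + 4 * h ^ 7" "h ^ 6 * (2 + 4 * t) = 2 * h ^ 6 + 4 * h ^ 8"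
    by (simp_all add: t_def distrib_left flip: power_mult power_add)
  have hp: "h ^ 7 \<le> h ^ 6 * (1 / 32)" "h ^ 8 \<le> h ^ 6 * (1 / 1024)" "0 < h ^ 6" "0 < h ^ 7"
    using power_le_scaled[of h 6 1] power_le_scaled[of h 6 2] h by (auto simp: power_divide)
  have "(delta_model p + 4 / 100 * p ^ 6 + (delta_model q + 4 / 100 * q ^ 6)) / 2 =
     (pi / 4 * (p ^ 3 + q ^ 3) - (p ^ 4 + q ^ 4) + 3 / (4 * pi) * (p ^ 5 + q ^ 5) + 4 / 100 * (p ^ 6 + q ^ 6)) / 2"
    by (simp add: delta_model_def algebra_simps)
  also have "\<dots> \<le> (pi / 4 * (2 * h ^ 3 + 5 * h ^ 7) - 2 * h ^ 4 + 3 / (4 * pi) * (2 * h ^ 5 + 4 * h ^ 7) + 4 / 100 * (2 * h ^ 6 + 4 * h ^ 8)) / 2"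
  proof -
    have m3: "pi / 4 * (p ^ 3 + q ^ 3) \<le> pi / 4 * (2 * h ^ 3 + 5 * h ^ 7)"
      by (rule mult_left_mono[OF c3[unfolded r3]]) simp
    have m5: "3 / (4 * pi) * (p ^ 5 + q ^ 5) \<le> 3 / (4 * pi) * (2 * h ^ 5 + 4 * h ^ 7)"
      by (rule mult_left_mono[OF c5[unfolded r3] inv(2)])
    have m6: "4 / 100 * (p ^ 6 + q ^ 6) \<le> 4 / 100 * (2 * h ^ 6 + 4 * h ^ 8)"
      by (rule mult_left_mono[OF c6[unfolded r3]]) simp
    show ?thesis by (rule divide_right_mono[OF add_mono[OF add_mono[OF diff_mono[OF m3 c4] m5] m6]]) simp
  qed
  also have "\<dots> = delta_model h + 4 / 100 * h ^ 6 + (pi / 4 * (5 / 2) * h ^ 7 + 3 / (4 * pi) * 2 * h ^ 7 + 8 / 100 * h ^ 8)"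
    by (simp add: delta_model_def algebra_simps add_divide_distrib diff_divide_distrib)
  also have "\<dots> \<le> delta_model h + 12 / 100 * h ^ 6"
  proof -
    have "pi / 4 * (5 / 2) * h ^ 7 \<le> 197 / 100 * h ^ 7" using pi_bounds hp by (intro mult_right_mono) auto
    moreover have "3 / (4 * pi) * 2 * h ^ 7 \<le> 1 / 4 * 2 * h ^ 7" using inv hp by (intro mult_right_mono) auto
    ultimately show ?thesis using hp by linarith
  qed
  finally show ?thesis .
qed

text \<open>\<open>b\<close> is \<delta>(n), \<open>A\<close> and \<open>c\<close> are its
  neighbours, \<open>a\<close> a lower bound for \<open>b\<close>, \<open>B\<close> an upper bound
  for the mean. A larger \<open>b\<close> only helps, and B (1 - a) \<le> B - a^2 < a \<le>
  b.\<close>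

lemma defect_criterion:
  fixes a b c A B :: real
  assumes d0: "a \<le> b" "0 < a" and pos: "0 \<le> A" "0 \<le> c"
    and avg: "(A + c) / 2 \<le> B" and key: "B < a + a * a" "a \<le> B"
    and b: "b \<le> 1"
  shows "A * c * (1 - b) ^ 2 < b ^ 2"
proof -
  have "A * c \<le> ((A + c) / 2) ^ 2"
  proof -
    have "((A + c) / 2) ^ 2 - A * c = ((A - c) / 2) ^ 2" by (simp add: power2_eq_square field_simps)
    then show ?thesis using zero_le_power2[of "(A - c) / 2"] by linarith
  qed
  also have "\<dots> \<le> B ^ 2" using avg pos by (intro power_mono) auto
  finally have "A * c * (1 - b) ^ 2 \<le> B ^ 2 * (1 - b) ^ 2" by (intro mult_right_mono) auto
  also have "\<dots> = (B * (1 - b)) ^ 2" by (simp add: power_mult_distrib)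
  also have "\<dots> < b ^ 2"
  proof (rule power_strict_mono)
    have "B * (1 - b) \<le> B * (1 - a)" using d0 key by (intro mult_left_mono) auto
    also have "\<dots> = B - B * a" by (simp add: algebra_simps)
    also have "\<dots> \<le> B - a * a" using key d0 by (intro diff_left_mono mult_right_mono) auto
    also have "\<dots> < b" using key d0 by linarith
    finally show "B * (1 - b) < b" .
    show "0 \<le> B * (1 - b)" using key d0 b by (intro mult_nonneg_nonneg) auto
  qed simp
  finally show ?thesis .
qed

lemma defect_inequality_large:
  fixes n :: nat
  assumes n: "n \<ge> 1026"
  shows "(int (overpartition_count n)^2 - int (overpartition_count (n-1)) * int (overpartition_count (n+1)))^2
       - (int (overpartition_count (n-1))^2 - int (overpartition_count (n-2)) * int (overpartition_count n))
         * (int (overpartition_count (n+1))^2 - int (overpartition_count n) * int (overpartition_count (n+2))) > 0"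
proof -
  define P where "P k = real (overpartition_count k)" for k
  define h where "h = 1 / sqrt (real n)"
  define p where "p = 1 / sqrt (real (n + 1))"
  define q where "q = 1 / sqrt (real (n - 1))"
  have h2: "h ^ 2 = 1 / real n" "p ^ 2 = 1 / real (n + 1)" "q ^ 2 = 1 / real (n - 1)"
    by (simp_all add: h_def p_def q_def power_divide)
  have h: "0 < h" "h \<le> 1 / 32"
  proof -
    have "sqrt (real n) \<ge> 32" using n by (intro real_le_rsqrt) simp
    then show "h \<le> 1 / 32" by (auto simp: h_def divide_simps)
    show "0 < h" using n by (simp add: h_def)
  qed
  have p: "0 < p" "p ^ 2 * (1 + h ^ 2) = h ^ 2" unfolding h2 using n by (auto simp: p_def field_simps)
  have q: "0 < q" "q ^ 2 * (1 - h ^ 2) = h ^ 2" unfolding h2 using n by (auto simp: q_def field_simps of_nat_diff)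
  have "n - 1 \<ge> 1025" "n + 1 \<ge> 1025" "n \<ge> 1025" using n by auto
  note D0 = defect_bounds[OF \<open>n \<ge> 1025\<close>, folded h_def]
  note Dp = defect_bounds[OF \<open>n + 1 \<ge> 1025\<close>, folded p_def]
  note Dm = defect_bounds[OF \<open>n - 1 \<ge> 1025\<close>, folded q_def]
  have lb: "delta_model x - 34 / 100 * x ^ 6 \<ge> 75 / 100 * x ^ 3" if x: "0 < x" "x \<le> 1 / 32" for x
  proof -
    have "x ^ 4 \<le> x ^ 3 * (1 / 32)" "x ^ 6 \<le> x ^ 3 * (1 / 32768)" using power_le_scaled[of x 3 1] power_le_scaled[of x 3 3] x by (auto simp: power_divide)
    moreover have "pi / 4 * x ^ 3 \<ge> 785 / 1000 * x ^ 3" using pi_bounds x by (intro mult_right_mono) auto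
    moreover have "3 / (4 * pi) * x ^ 5 \<ge> 0" "x ^ 3 > 0" using x by auto
    ultimately show ?thesis unfolding delta_model_def by linarith
  qed
  define a where "a = delta_model h - 34 / 100 * h ^ 6"
  have "0 < 75 / 100 * h ^ 3" using h by simp
  moreover have "75 / 100 * h ^ 3 \<le> a" unfolding a_def by (rule lb[OF h])
  ultimately have a: "75 / 100 * h ^ 3 \<le> a" "0 < a" by (simp_all only: order.strict_trans2)
  have h6: "0 < h ^ 6" using h by simp
  have pq: "p \<le> 1 / 32" "q \<le> 1 / 32"
  proof -
    have "sqrt (real (n + 1)) \<ge> 32" "sqrt (real (n - 1)) \<ge> 32" using n by (auto intro!: real_le_rsqrt simp: of_nat_diff)
    then show "p \<le> 1 / 32" "q \<le> 1 / 32" by (auto simp: p_def q_def divide_simps)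
  qed
  have nonneg: "0 \<le> defect (n + 1)" "0 \<le> defect (n - 1)"
    using lb[OF p(1) pq(1)] lb[OF q(1) pq(2)] Dp(1) Dm(1) zero_less_power[OF p(1), of 3] zero_less_power[OF q(1), of 3] by linarith+
  have key: "defect (n - 1) * defect (n + 1) * (1 - defect n) ^ 2 < defect n ^ 2"
  proof (rule defect_criterion)
    show "a \<le> defect n" using D0(1) by (simp add: a_def)
    show "0 < a" by (rule a(2))
    show "(defect (n - 1) + defect (n + 1)) / 2 \<le> delta_model h + 12 / 100 * h ^ 6"
    proof -
      have "(defect (n - 1) + defect (n + 1)) / 2 \<le> (delta_model p + 4 / 100 * p ^ 6 + (delta_model q + 4 / 100 * q ^ 6)) / 2"
        using add_mono[OF Dp(2) Dm(2)] by (intro divide_right_mono) (simp_all only: add.commute[of "defect (n - 1)"] zero_le_numeral)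
      then show ?thesis using neighbour_average[OF h p q] by (rule order_trans)
    qed
    \<comment> \<open>The margin: a^2 is at least 0.5625 h^6, while \<open>B - a\<close> is (0.12 +
      0.34) h^6.\<close>
    have "75 / 100 * h ^ 3 * (75 / 100 * h ^ 3) \<le> a * a" using a h by (intro mult_mono) auto
    moreover have "75 / 100 * h ^ 3 * (75 / 100 * h ^ 3) = 5625 / 10000 * h ^ 6" by (simp flip: power_add)
    ultimately show "delta_model h + 12 / 100 * h ^ 6 < a + a * a" unfolding a_def using h6 by linarith
    show "a \<le> delta_model h + 12 / 100 * h ^ 6" unfolding a_def using h6 by linarith
    show "defect n \<le> 1" by (simp add: defect_def)
  qed (rule nonneg)+
  have Ppos: "P n > 0" "P (n - 1) > 0" "P (n + 1) > 0" using D0(3) Dm(3) Dp(3) by (simp_all add: P_def)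
  have idx: "n - 1 - 1 = n - 2" "n - 1 + 1 = n" "n + 1 - 1 = n" "n + 1 + 1 = n + 2" using n by auto
  have f0: "P n ^ 2 - P (n - 1) * P (n + 1) = P n ^ 2 * defect n"
    using Ppos by (simp add: defect_def P_def field_simps)
  have fm: "P (n - 1) ^ 2 - P (n - 2) * P n = P (n - 1) ^ 2 * defect (n - 1)"
    using Ppos unfolding defect_def idx P_def[symmetric] by (simp add: field_simps)
  have fp: "P (n + 1) ^ 2 - P n * P (n + 2) = P (n + 1) ^ 2 * defect (n + 1)"
    using Ppos unfolding defect_def idx P_def[symmetric] by (simp add: field_simps)
  \<comment> \<open>This turns the squared outer values into P(n)^4 (1 - \<delta>(n))^2, the origin
    of that factor in the criterion.\<close>
  have one: "P (n - 1) * P (n + 1) = P n ^ 2 * (1 - defect n)"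
    using f0 by (simp add: algebra_simps)
  have "P (n - 1) ^ 2 * defect (n - 1) * (P (n + 1) ^ 2 * defect (n + 1)) = (P (n - 1) * P (n + 1)) ^ 2 * (defect (n - 1) * defect (n + 1))"
    by (simp add: power_mult_distrib mult_ac)
  also have "\<dots> = P n ^ 4 * (defect (n - 1) * defect (n + 1) * (1 - defect n) ^ 2)"
    unfolding one by (simp add: power_mult_distrib mult_ac flip: power_mult)
  also have "\<dots> < P n ^ 4 * defect n ^ 2" using key Ppos by (intro mult_strict_left_mono) auto
  also have "\<dots> = (P n ^ 2 * defect n) ^ 2" by (simp add: power_mult_distrib flip: power_mult)
  finally have "0 < (P n ^ 2 - P (n - 1) * P (n + 1)) ^ 2 - (P (n - 1) ^ 2 - P (n - 2) * P n) * (P (n + 1) ^ 2 - P n * P (n + 2))"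
    unfolding f0 fm fp by simp
  then have "0 < real_of_int ((int (overpartition_count n)^2 - int (overpartition_count (n-1)) * int (overpartition_count (n+1)))^2
       - (int (overpartition_count (n-1))^2 - int (overpartition_count (n-2)) * int (overpartition_count n))
         * (int (overpartition_count (n+1))^2 - int (overpartition_count n) * int (overpartition_count (n+2))))"
    by (simp add: P_def)
  then show ?thesis by (simp only: of_int_0_less_iff)
qed

section \<open>Computation for small arguments\<close>

definition pbar :: "nat \<Rightarrow> int" where
  "pbar n = int (overpartition_count n)"

text \<open>On a list whose entry \<open>i\<close> is the value at \<open>N - 1 - i\<close>, this forms the alternating sum of the values at \<open>N - j^2\<close>: the counter \<open>c\<close> is the number of entries still to be skipped, and \<open>d\<close> is the length of the last gap, which grows by two because consecutive squares differ by odd numbers.\<close>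

fun alternating_pick :: "nat \<Rightarrow> nat \<Rightarrow> int list \<Rightarrow> int" where
  "alternating_pick c d [] = 0"
| "alternating_pick 0 d (x # xs) = x - alternating_pick (Suc (Suc d)) (Suc (Suc d)) xs"
| "alternating_pick (Suc c) d (x # xs) = alternating_pick c d xs"

lemma pbar_recurrence:
  assumes "N > 0"
  shows "pbar N = 2 * (\<Sum>j=1..N. if j ^ 2 \<le> N then (-1) ^ (j - 1) * pbar (N - j ^ 2) else 0)"
proof -
  have inj: "inj_on (\<lambda>j::nat. j ^ 2) A" for A by (auto simp: inj_on_def power2_eq_iff_nonneg)
  let ?J = "{j. 1 \<le> j \<and> j \<le> N \<and> j ^ 2 \<le> N}"
  have "(\<Sum>i\<le>N. theta4_coeff i * pbar (N - i)) = theta4_coeff 0 * pbar N + (\<Sum>i=1..N. theta4_coeff i * pbar (N - i))"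
    by (simp add: atLeast0AtMost[symmetric] sum.atLeast_Suc_atMost)
  also have "(\<Sum>i=1..N. theta4_coeff i * pbar (N - i)) = (\<Sum>i\<in>(\<lambda>j. j ^ 2) ` ?J. theta4_coeff i * pbar (N - i))"
  proof (rule sum.mono_neutral_right)
    show "(\<lambda>j. j ^ 2) ` ?J \<subseteq> {1..N}" by auto
    show "\<forall>i\<in>{1..N} - (\<lambda>j. j ^ 2) ` ?J. theta4_coeff i * pbar (N - i) = 0"
    proof
      fix i assume i: "i \<in> {1..N} - (\<lambda>j. j ^ 2) ` ?J"
      have "\<not> (\<exists>k. i = k ^ 2)"
      proof
        assume "\<exists>k. i = k ^ 2"
        then obtain k where k: "i = k ^ 2" by blast
        with i have "1 \<le> k" "k ^ 2 \<le> N" by (cases k; auto)+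
        moreover have "k \<le> k ^ 2" by (simp add: power2_eq_square)
        ultimately show False using i k by auto
      qed
      with i show "theta4_coeff i * pbar (N - i) = 0" by (simp add: theta4_coeff_def)
    qed
  qed auto
  also have "\<dots> = (\<Sum>j\<in>?J. theta4_coeff (j ^ 2) * pbar (N - j ^ 2))"
    by (rule sum.reindex[OF inj, unfolded o_def])
  also have "\<dots> = (\<Sum>j\<in>?J. - 2 * ((-1) ^ (j - 1) * pbar (N - j ^ 2)))"
  proof (intro sum.cong refl)
    fix j assume "j \<in> ?J"
    then have "theta4_coeff (j ^ 2) = 2 * (-1) ^ j" "(-1 :: int) ^ j = - ((-1) ^ (j - 1))"
      by (cases j; auto simp: theta4_coeff_def minus_one_power_iff)+
    then show "theta4_coeff (j ^ 2) * pbar (N - j ^ 2) = - 2 * ((-1) ^ (j - 1) * pbar (N - j ^ 2))" by simp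
  qed
  also have "\<dots> = - 2 * (\<Sum>j\<in>?J. (-1) ^ (j - 1) * pbar (N - j ^ 2))" by (simp only: sum_distrib_left)
  also have "(\<Sum>j\<in>?J. (-1) ^ (j - 1) * pbar (N - j ^ 2)) = (\<Sum>j=1..N. if j ^ 2 \<le> N then (-1) ^ (j - 1) * pbar (N - j ^ 2) else 0)"
    by (subst sum.inter_filter[symmetric]) (auto intro!: sum.cong)
  finally show ?thesis
    using overpartition_recurrence[of N] assms by (simp add: theta4_coeff_def pbar_def)
qed

definition pbar_table :: "nat \<Rightarrow> int list" where
  "pbar_table L = map pbar (rev [0..<L])"

lemma pbar_table_0: "pbar_table 0 = []" and pbar_table_Suc: "pbar_table (Suc L) = pbar L # pbar_table L"
  by (simp_all add: pbar_table_def)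

text \<open>Invariant: skipping \<open>c\<close> entries of a table with head L - 1 leads to index N
  - k^2, and 2 k = (k + 1)^2 - k^2 - 1 entries are skipped after it. The equation is over the
  integers because N - k^2 is negative once the list runs out.\<close>

lemma alternating_pick_table:
  assumes "int L = int N - int k ^ 2 + int c + 1" "1 \<le> k" "d = 2 * (k - 1)" "k \<le> Suc N"
  shows "alternating_pick c d (pbar_table L) = (\<Sum>j=k..N. if j ^ 2 \<le> N then (-1) ^ (j - k) * pbar (N - j ^ 2) else 0)"
  using assms
proof (induction L arbitrary: c d k)
  case 0
  then have "int N < int k ^ 2" by linarith
  then have "int N < int (k ^ 2)" by (simp only: of_nat_power)
  then have kN: "N < k ^ 2" by (simp only: of_nat_less_iff)
  have "N < j ^ 2" if "k \<le> j" for j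
    by (rule less_le_trans[OF kN]) (use that in \<open>simp add: power_mono\<close>)
  then have "(\<Sum>j=k..N. if j ^ 2 \<le> N then (-1) ^ (j - k) * pbar (N - j ^ 2) else 0) = 0"
    by (intro sum.neutral) (auto simp: not_le[symmetric])
  then show ?case by (simp add: pbar_table_0)
next
  case (Suc L)
  show ?case
  proof (cases c)
    case 0
    have "int (L + k ^ 2) = int N" using Suc.prems(1) 0 by simp
    then have L: "N = L + k ^ 2" by (simp only: of_nat_eq_iff)
    have kN: "k \<le> N" using L Suc.prems(2) by (simp add: power2_eq_square trans_le_add2)
    have "alternating_pick (2 * k) (2 * k) (pbar_table L) = (\<Sum>j=Suc k..N. if j ^ 2 \<le> N then (-1) ^ (j - Suc k) * pbar (N - j ^ 2) else 0)"
      by (rule Suc.IH) (use L kN in \<open>auto simp: power2_eq_square algebra_simps\<close>)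
    also have "\<dots> = - (\<Sum>j=Suc k..N. if j ^ 2 \<le> N then (-1) ^ (j - k) * pbar (N - j ^ 2) else 0)"
      unfolding sum_negf[symmetric]
    proof (intro sum.cong refl)
      fix j assume "j \<in> {Suc k..N}"
      then have "j - k = Suc (j - Suc k)" by auto
      then show "(if j ^ 2 \<le> N then (-1) ^ (j - Suc k) * pbar (N - j ^ 2) else 0) = - (if j ^ 2 \<le> N then (-1) ^ (j - k) * pbar (N - j ^ 2) else 0)"
        by simp
    qed
    finally have "alternating_pick c d (pbar_table (Suc L)) = pbar L + (\<Sum>j=Suc k..N. if j ^ 2 \<le> N then (-1) ^ (j - k) * pbar (N - j ^ 2) else 0)"
      using 0 Suc.prems by (cases k) (auto simp: pbar_table_Suc)
    also have "\<dots> = (\<Sum>j=k..N. if j ^ 2 \<le> N then (-1) ^ (j - k) * pbar (N - j ^ 2) else 0)"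
      using L kN by (simp add: sum.atLeast_Suc_atMost)
    finally show ?thesis .
  next
    case (Suc c')
    then show ?thesis using Suc.prems Suc.IH[of k c' d] by (simp add: pbar_table_Suc)
  qed
qed

lemma pbar_table_step:
  assumes "L > 0"
  shows "2 * alternating_pick 0 0 (pbar_table L) # pbar_table L = pbar_table (Suc L)"
  using assms alternating_pick_table[of L L 1 0 0] pbar_recurrence[of L] by (simp add: pbar_table_Suc)

text \<open>Working on binary numerals directly, so that the simplifier need not evaluate a division.\<close>

fun num_shift :: "nat \<Rightarrow> num \<Rightarrow> int" where
  "num_shift 0 n = numeral n"
| "num_shift (Suc k) num.One = 0"
| "num_shift (Suc k) (num.Bit0 n) = num_shift k n"
| "num_shift (Suc k) (num.Bit1 n) = num_shift k n"

definition int_shift :: "nat \<Rightarrow> int \<Rightarrow> int" where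
  "int_shift k x = x div 2 ^ k"

lemma num_shift: "num_shift k n = numeral n div 2 ^ k"
proof (induction k n rule: num_shift.induct)
  case (2 k)
  show ?case by (simp add: zdiv_eq_0_iff one_less_power del: power_Suc)
next
  case (3 k n)
  have "(numeral (num.Bit0 n) :: int) div 2 ^ Suc k = numeral (num.Bit0 n) div 2 div 2 ^ k"
    by (simp add: zdiv_zmult2_eq del: div_mult2_numeral_eq)
  with 3 show ?case by simp
next
  case (4 k n)
  have "(numeral (num.Bit1 n) :: int) div 2 ^ Suc k = numeral (num.Bit1 n) div 2 div 2 ^ k"
    by (simp add: zdiv_zmult2_eq del: div_mult2_numeral_eq)
  with 4 show ?case by simp
qed simp

lemma int_shift_code [code]:
  "int_shift k 0 = 0" "int_shift k (Int.Pos n) = num_shift k n" "int_shift k (Int.Neg n) = - numeral n div 2 ^ k"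
  by (simp_all add: int_shift_def num_shift)

text \<open>The number of bits beyond the leading c + 1; shifting by it leaves at most c + 1
  bits.\<close>

fun num_excess :: "nat \<Rightarrow> num \<Rightarrow> nat" where
  "num_excess c num.One = 0"
| "num_excess 0 (num.Bit0 n) = Suc (num_excess 0 n)"
| "num_excess 0 (num.Bit1 n) = Suc (num_excess 0 n)"
| "num_excess (Suc c) (num.Bit0 n) = num_excess c n"
| "num_excess (Suc c) (num.Bit1 n) = num_excess c n"

definition int_excess :: "nat \<Rightarrow> int \<Rightarrow> nat" where
  "int_excess c x = (if x > 0 then num_excess c (num_of_nat (nat x)) else 0)"

lemma int_excess_code [code]:
  "int_excess c 0 = 0" "int_excess c (Int.Pos n) = num_excess c n" "int_excess c (Int.Neg n) = 0"
  by (simp_all add: int_excess_def num_of_nat_numeral_eq)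

text \<open>A bracket \<open>(k, l, u)\<close> stands for the bounds \<open>2^k * l\<close> and \<open>2^k * u\<close>. Keeping 37 bits of the arguments and 19 bits of the result suffices for all \<open>42 \<le> n \<le> 1025\<close>.\<close>

definition defect_bracket :: "int \<Rightarrow> int \<Rightarrow> int \<Rightarrow> nat \<times> int \<times> int" where
  "defect_bracket p q r = (let k = int_excess 36 q; e = (if k = 0 then 0 else 1);
     a = int_shift k p; b = int_shift k q; c = int_shift k r;
     l = b * b - (a + e) * (c + e); j = int_excess 18 l in
     (k + k + j, int_shift j l, int_shift j ((b + e) * (b + e) - a * c) + (if j = 0 then 0 else 1)))"

fun defect_brackets :: "nat \<Rightarrow> int list \<Rightarrow> (nat \<times> int \<times> int) list" where
  "defect_brackets (Suc n) (r # q # p # xs) = defect_bracket p q r # defect_brackets n (q # p # xs)"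
| "defect_brackets _ _ = []"

text \<open>The comparison of 2^(k1 + k3) u1 u3 with 2^(2 k2) l2^2 after cancelling 2^(k1 + k2). The
  order of the exponents makes the natural subtractions exact, and the numbers stay short.\<close>

fun bracket_check :: "nat \<times> int \<times> int \<Rightarrow> nat \<times> int \<times> int \<Rightarrow> nat \<times> int \<times> int \<Rightarrow> bool" where
  "bracket_check (k1, l1, u1) (k2, l2, u2) (k3, l3, u3) =
    (k1 \<le> k2 \<and> k2 \<le> k3 \<and> 0 \<le> l1 \<and> 0 \<le> l2 \<and> 0 \<le> l3 \<and> 2 ^ (k3 - k2) * (u1 * u3) < 2 ^ (k2 - k1) * (l2 * l2))"

fun table_extend :: "nat \<Rightarrow> int list \<Rightarrow> int list" where
  "table_extend 0 xs = xs"
| "table_extend (Suc n) xs = table_extend n (2 * alternating_pick 0 0 xs # xs)"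

fun brackets_check :: "(nat \<times> int \<times> int) list \<Rightarrow> bool" where
  "brackets_check (t3 # t2 # t1 # ts) = (bracket_check t1 t2 t3 \<and> brackets_check (t2 # t1 # ts))"
| "brackets_check _ = True"

definition bracketing :: "nat \<times> int \<times> int \<Rightarrow> int \<Rightarrow> bool" where
  "bracketing t x = (case t of (k, l, u) \<Rightarrow> 2 ^ k * l \<le> x \<and> x \<le> 2 ^ k * u)"

lemma int_shift_bounds:
  "2 ^ k * int_shift k x \<le> x" "x \<le> 2 ^ k * (int_shift k x + (if k = 0 then 0 else 1))" "0 \<le> x \<Longrightarrow> 0 \<le> int_shift k x"
proof -
  have m: "2 ^ k * int_shift k x + x mod 2 ^ k = x" "0 \<le> x mod 2 ^ k" "x mod 2 ^ k \<le> 2 ^ k"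
    unfolding int_shift_def by (simp_all only: mult_div_mod_eq pos_mod_sign pos_mod_bound less_imp_le zero_less_power zero_less_numeral)
  show "2 ^ k * int_shift k x \<le> x"
    using m by linarith
  show "x \<le> 2 ^ k * (int_shift k x + (if k = 0 then 0 else 1))"
  proof (cases "k = 0")
    case False
    have "x \<le> 2 ^ k * int_shift k x + 2 ^ k" using m by linarith
    with False show ?thesis by (simp add: distrib_left)
  qed (simp add: int_shift_def)
  show "0 \<le> x \<Longrightarrow> 0 \<le> int_shift k x"
    by (simp add: int_shift_def pos_imp_zdiv_nonneg_iff)
qed

text \<open>Interval arithmetic: each argument lies between its truncation and the next multiple of
  2^k, with one shift \<open>k\<close>, taken from \<open>q\<close>, for all three so that the
  scaling factors out. The result is truncated again by the size of its lower bound.\<close>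

lemma defect_bracket:
  assumes "0 \<le> p" "0 \<le> q" "0 \<le> r"
  shows "bracketing (defect_bracket p q r) (q ^ 2 - p * r)"
proof -
  define k where "k = int_excess 36 q"
  \<comment> \<open>Without a shift the truncation is exact, so small values incur no rounding
    error.\<close>
  define e :: int where "e = (if k = 0 then 0 else 1)"
  define a where "a = int_shift k p"
  define b where "b = int_shift k q"
  define c where "c = int_shift k r"
  define l where "l = b * b - (a + e) * (c + e)"
  define u where "u = (b + e) * (b + e) - a * c"
  define j where "j = int_excess 18 l"
  define s :: int where "s = 2 ^ k"
  have s: "0 \<le> s * s" by simp
  have lo: "s * a \<le> p" "s * b \<le> q" "s * c \<le> r" and hi: "p \<le> s * (a + e)" "q \<le> s * (b + e)" "r \<le> s * (c + e)"
    and nonneg: "0 \<le> s * a" "0 \<le> s * b" "0 \<le> s * c"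
    using int_shift_bounds[where k = k] assms by (simp_all add: s_def a_def b_def c_def e_def)
  have "(s * b) * (s * b) \<le> q * q" "q * q \<le> (s * (b + e)) * (s * (b + e))"
    "(s * a) * (s * c) \<le> p * r" "p * r \<le> (s * (a + e)) * (s * (c + e))"
    using lo hi nonneg assms by (intro mult_mono; linarith)+
  then have D: "s * s * l \<le> q ^ 2 - p * r" "q ^ 2 - p * r \<le> s * s * u"
    unfolding l_def u_def right_diff_distrib power2_eq_square by (simp_all only: mult_ac)+
  have "s * s * (2 ^ j * int_shift j l) \<le> s * s * l" "s * s * u \<le> s * s * (2 ^ j * (int_shift j u + (if j = 0 then 0 else 1)))"
    using int_shift_bounds[where k = j] s by (intro mult_left_mono; simp)+
  with D have "s * s * (2 ^ j * int_shift j l) \<le> q ^ 2 - p * r" "q ^ 2 - p * r \<le> s * s * (2 ^ j * (int_shift j u + (if j = 0 then 0 else 1)))"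
    by linarith+
  moreover have "defect_bracket p q r = (k + k + j, int_shift j l, int_shift j u + (if j = 0 then 0 else 1))"
    unfolding defect_bracket_def Let_def k_def e_def a_def b_def c_def l_def u_def j_def by simp
  ultimately show ?thesis
    by (simp add: bracketing_def power_add s_def mult_ac)
qed

lemma bracket_check:
  assumes chk: "bracket_check t1 t2 t3" and D: "bracketing t1 x" "bracketing t2 y" "bracketing t3 z"
  shows "y ^ 2 - x * z > 0"
proof -
  obtain k1 l1 u1 k2 l2 u2 k3 l3 u3 where t: "t1 = (k1, l1, u1)" "t2 = (k2, l2, u2)" "t3 = (k3, l3, u3)"
    by (metis prod_cases3)
  have le: "k1 \<le> k2" "k2 \<le> k3" and nonneg: "0 \<le> l1" "0 \<le> l2" "0 \<le> l3"
    and lt: "2 ^ (k3 - k2) * (u1 * u3) < 2 ^ (k2 - k1) * (l2 * l2)"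
    using chk by (simp_all add: t)
  have b: "2 ^ k1 * l1 \<le> x" "x \<le> 2 ^ k1 * u1" "2 ^ k2 * l2 \<le> y" "2 ^ k3 * l3 \<le> z" "z \<le> 2 ^ k3 * u3"
    using D by (simp_all add: bracketing_def t)
  have xyz: "0 \<le> x" "0 \<le> y" "0 \<le> z"
    using b nonneg by (auto intro: order_trans[rotated])
  have "x * z \<le> (2 ^ k1 * u1) * (2 ^ k3 * u3)"
    using b xyz by (intro mult_mono) auto
  also have "\<dots> = 2 ^ (k1 + k2) * (2 ^ (k3 - k2) * (u1 * u3))"
    using le by (simp add: power_add[symmetric] mult_ac)
  also have "\<dots> < 2 ^ (k1 + k2) * (2 ^ (k2 - k1) * (l2 * l2))"
    using lt by (intro mult_strict_left_mono) auto
  also have "\<dots> = (2 ^ k2 * l2) * (2 ^ k2 * l2)"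
    using le by (simp add: power_add[symmetric] mult_ac)
  also have "\<dots> \<le> y * y"
    using b xyz nonneg by (intro mult_mono) auto
  finally show ?thesis by (simp add: power2_eq_square)
qed

lemma table_extend_pbar: "L > 0 \<Longrightarrow> table_extend n (pbar_table L) = pbar_table (L + n)"
proof (induction n arbitrary: L)
  case (Suc n)
  then show ?case by (simp add: pbar_table_step)
qed simp

definition pbar_defect :: "nat \<Rightarrow> int" where
  "pbar_defect m = pbar (Suc m) ^ 2 - pbar m * pbar (Suc (Suc m))"

lemma defect_brackets_table:
  "n \<le> m \<Longrightarrow> list_all2 bracketing (defect_brackets n (pbar_table (m + 2))) (map pbar_defect (rev [m - n..<m]))"
proof (induction n arbitrary: m)
  case (Suc n)
  then obtain m' where m: "m = Suc m'" "n \<le> m'" by (cases m) auto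
  have "rev [m - Suc n..<m] = m' # rev [m' - n..<m']" using m by simp
  moreover have "bracketing (defect_bracket (pbar m') (pbar (Suc m')) (pbar (Suc (Suc m')))) (pbar_defect m')"
    unfolding pbar_defect_def by (rule defect_bracket) (simp_all add: pbar_def)
  ultimately show ?case
    using Suc.IH[OF m(2)] by (simp add: m pbar_table_Suc)
qed simp

lemma brackets_check_sound:
  "brackets_check ts \<Longrightarrow> list_all2 bracketing ts xs \<Longrightarrow> Suc (Suc i) < length xs \<Longrightarrow>
   (xs ! Suc i) ^ 2 - (xs ! Suc (Suc i)) * (xs ! i) > 0"
proof (induction ts arbitrary: xs i rule: brackets_check.induct)
  case (1 t3 t2 t1 ts)
  then obtain x3 x2 x1 ys where xs: "xs = x3 # x2 # x1 # ys" 
    and b: "bracketing t3 x3" "bracketing t2 x2" "bracketing t1 x1" "list_all2 bracketing (t2 # t1 # ts) (x2 # x1 # ys)"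
    by (auto simp: list_all2_Cons1)
  show ?case
  proof (cases i)
    case 0
    then show ?thesis using bracket_check[of t1 t2 t3 x1 x2 x3] 1(2) b by (simp add: xs)
  next
    case (Suc i')
    then show ?thesis using 1(1)[OF _ b(4), of i'] 1(2,4) by (simp add: xs)
  qed
qed (auto simp: list_all2_Cons1)

lemma brackets_check_defects:
  assumes "brackets_check (defect_brackets n (pbar_table (m + 2)))" "n \<le> m" "Suc (Suc i) < n"
  shows "pbar_defect (m - Suc (Suc i)) ^ 2 - pbar_defect (m - Suc (Suc (Suc i))) * pbar_defect (m - Suc i) > 0"
proof -
  have "map pbar_defect (rev [m - n..<m]) ! j = pbar_defect (m - Suc j)" if "j < n" for j
    using that assms(2) by (simp add: rev_nth)
  then show ?thesis
    using brackets_check_sound[OF assms(1) defect_brackets_table[OF assms(2)], of i] assms(2,3) by simp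
qed

text \<open>Extending the table 1027 times from the value 1 at 0 gives the values up to 1027 = 1025
  + 2. The 986 brackets belong to \<open>pbar_defect\<close> at 1025 down to 40, the indices
  occurring for 42 \<le> n \<le> 1025.\<close>

lemma brackets_check_986: "brackets_check (defect_brackets 986 (table_extend 1027 [1]))"
  by code_simp

lemma defect_inequality_small:
  fixes n :: nat
  assumes n: "n \<ge> 42" "n \<le> 1025"
  shows "(int (overpartition_count n)^2 - int (overpartition_count (n-1)) * int (overpartition_count (n+1)))^2
       - (int (overpartition_count (n-1))^2 - int (overpartition_count (n-2)) * int (overpartition_count n))
         * (int (overpartition_count (n+1))^2 - int (overpartition_count n) * int (overpartition_count (n+2))) > 0"
proof -
  have "pbar 0 = 1" using overpartition_recurrence[of 0] by (simp add: pbar_def theta4_coeff_def)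
  then have "pbar_table 1 = [1]" using pbar_table_Suc[of 0] by (simp add: pbar_table_0)
  then have table: "table_extend 1027 [1] = pbar_table (1026 + 2)"
    using table_extend_pbar[of 1 1027] by simp
  define m where "m = n - 2"
  have m: "n = Suc (Suc m)" using n by (simp add: m_def)
  have "brackets_check (defect_brackets 986 (pbar_table (1026 + 2)))"
    using brackets_check_986 unfolding table .
  \<comment> \<open>In the descending list entry i is \<open>pbar_defect (1025 - i)\<close>, so this
    index puts n - 1 in the middle; \<open>pbar_defect m\<close> is centred at m + 1.\<close>
  from brackets_check_defects[OF this, of "1025 - n"]
  have "pbar_defect (Suc m) ^ 2 - pbar_defect m * pbar_defect (Suc (Suc m)) > 0"
    using n by (simp add: m Suc_diff_Suc)
  then show ?thesis
    by (simp add: m pbar_defect_def pbar_def)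
qed

theorem theorem1p7:
  fixes n :: nat
  assumes "n \<ge> 42"
  shows "(int (overpartition_count n)^2 - int (overpartition_count (n-1)) * int (overpartition_count (n+1)))^2
       - (int (overpartition_count (n-1))^2 - int (overpartition_count (n-2)) * int (overpartition_count n))
         * (int (overpartition_count (n+1))^2 - int (overpartition_count n) * int (overpartition_count (n+2))) > 0"
  using defect_inequality_small[of n] defect_inequality_large[of n] assms by linarith

end
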